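(* Let $H$ be a linear cycle set and let $I$ be a trivial linear cycle set endowed with a map $\diamond\colon H\times I\to I$ such that, for all $h,h'\in H$ and $y,y'\in I$, $(h'h)\diamond y=h\diamond(h'\diamond y)$, $h\diamond(y+y')=h\diamond y+h\diamond y'$ and $0\diamond y=y$. Then there is a bijective correspondence $$\mathrm{Ext}_{\diamond}(H,I)\longleftrightarrow \mathrm H^2_{\diamond}(H,I).$$
   Context: A linear cycle set is an abelian group $(A,+)$ with a binary operation $\cdot$ such that for each $b\in A$ the map $a\mapsto b\cdot a$ is bijective, and $a\cdot(b+c)=a\cdot b+a\cdot c$ and $(a+b)\cdot c=(a\cdot b)\cdot(a\cdot c)$ for all $a,b,c$. It is trivial if $a\cdot b=b$ for all $a,b$. It carries a multiplication $ab={}^ab+a$, where $b\mapsto{}^ab$ is the inverse of $b\mapsto a\cdot b$; this is a group operation with neutral element $0$. Morphisms preserve $+$ and $\cdot$. An extension $(\iota,B,\pi)$ of $H$ by $I$ is a short exact sequence of abelian groups $0\to I\xrightarrow{\iota}B\xrightarrow{\pi}H\to0$ with $B$ a linear cycle set and $\iota,\pi$ morphisms of linear cycle sets. Two extensions $(\iota,B,\pi)$, $(\iota',B',\pi')$ are equivalent if there is a linear cycle set morphism $\phi\colon B\to B'$ with $\pi'\circ\phi=\pi$ and $\phi\circ\iota=\iota'$. $\mathrm{Ext}_{\diamond}(H,I)$ is the set of equivalence classes of extensions $(\iota,B,\pi)$ of $H$ by $I$ such that, for every set-theoretic section $s$ of $\pi$ with $s(0)=0$, one has $s(h)\cdot\iota(y)=\iota(h\diamond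 y)$ and $\iota(y)\cdot s(h)-s(h)=0$ for all $h\in H$, $y\in I$. Let $\overline H=H\setminus\{0\}$. For $s\ge1$ let $\mathbb Z[\overline H^s]$ be the free abelian group on $\overline H^s$ (and $\mathbb Z[\overline H^0]=\mathbb Z$), and let $\mathrm{sh}(\mathbb Z[\overline H^s])$ be the subgroup generated by the shuffles $\sum_{\sigma\in\mathrm{sh}_{l,s-l}}\mathrm{sg}(\sigma)(h_{\sigma^{-1}(1)},\dots,h_{\sigma^{-1}(s)})$, for $1\le l<s$ and $h_k\in\overline H$, where $\mathrm{sh}_{l,s-l}$ is the set of permutations $\sigma$ of $\{1,\dots,s\}$ with $\sigma(1)<\dots<\sigma(l)$ and $\sigma(l+1)<\dots<\sigma(s)$. Put $\overline M(s)=\mathbb Z[\overline H^s]/\mathrm{sh}(\mathbb Z[\overline H^s])$ and denote by $[h_1,\dots,h_s]$ the class of $(h_1,\dots,h_s)$. For $r\ge0$, $s\ge1$ let $\widehat C_N^{rs}(H,I)=\mathrm{Hom}(\mathbb Z[\overline H^r]\otimes\overline M(s),I)$. We write $f(h_1,\dots,h_r,[h_{r+1},\dots,h_{r+s}])$ for the value of $f$ on $(h_1,\dots,h_r)\otimes[h_{r+1},\dots,h_{r+s}]$; by convention this value is $0$ if some $h_i=0$. For $r\ge0$ let $R_{r1}(h_1,\dots,h_{r+1})=(h_1+\dots+h_r)\cdot h_{r+1}\in H$ (so $R_{01}(h_1)=h_1$). The maps $\partial_{\mathrm h}^{r+1,s}\colon\widehat C_N^{rs}(H,I)\to\widehat C_N^{r+1,s}(H,I)$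 and $\partial_{\mathrm v}^{r,s+1}\colon\widehat C_N^{rs}(H,I)\to\widehat C_N^{r,s+1}(H,I)$ are \begin{align*} \partial_{\mathrm h}^{r+1,s}(f)(h_1,\dots,h_{r+1},[h_{r+2},\dots,h_{r+s+1}])&=f(h_1\cdot h_2,\dots,h_1\cdot h_{r+1},[h_1\cdot h_{r+2},\dots,h_1\cdot h_{r+s+1}])\\ &+\sum_{j=1}^r(-1)^jf(h_1,\dots,h_{j-1},h_j+h_{j+1},h_{j+2},\dots,h_{r+1},[h_{r+2},\dots,h_{r+s+1}])\\ &+(-1)^{r+1}R_{r1}(h_1,\dots,h_{r+1})\diamond f(h_1,\dots,h_r,[h_{r+2},\dots,h_{r+s+1}]),\\ \partial_{\mathrm v}^{r,s+1}(f)(h_1,\dots,h_r,[h_{r+1},\dots,h_{r+s+1}])&=(-1)^rf(h_1,\dots,h_r,[h_{r+2},\dots,h_{r+s+1}])\\ &+\sum_{j=r+1}^{r+s}(-1)^jf(h_1,\dots,h_r,[h_{r+1},\dots,h_{j-1},h_j+h_{j+1},h_{j+2},\dots,h_{r+s+1}])\\ &+(-1)^{r+s+1}f(h_1,\dots,h_r,[h_{r+1},\dots,h_{r+s}]). \end{align*} These form a double cochain complex, and $\mathrm H^*_{\diamond}(H,I)$ denotes the cohomology of its total complex, whose group in degree $n\ge1$ is $\bigoplus_{r=0}^{n-1}\widehat C_N^{r,n-r}(H,I)$ and whose differential is $\partial_{\mathrm h}+\partial_{\mathrm v}$. *)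

theory Defs
  imports
    "HOL-Combinatorics.Permutations"
    "HOL-Algebra.Free_Abelian_Groups"
    "HOL-Algebra.Generated_Groups"
begin

section \<open>Linear cycle sets\<close>

text \<open>
  As always for \<^const>\<open>comm_group\<close>, the operation \<open>+\<close> and the element \<open>0\<close> of the mathematics are
  \<open>\<otimes>\<close> and \<open>\<one>\<close> here. This also concerns sums: \<^const>\<open>finprod\<close> is a finite sum, and
  \<open>x [^] (k::int)\<close> is the integer multiple \<open>k x\<close>.
\<close>

record 'a lcs = "'a monoid" +
  lcs_dot :: "'a \<Rightarrow> 'a \<Rightarrow> 'a" (infixl "\<cdot>\<index>" 75)

locale linear_cycle_set = comm_group A for A (structure) +
  assumes dot_bij: "b \<in> carrier A \<Longrightarrow> bij_betw (\<lambda>a. b \<cdot> a) (carrier A) (carrier A)"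
    and dot_distrib: "\<lbrakk>a \<in> carrier A; b \<in> carrier A; c \<in> carrier A\<rbrakk>
          \<Longrightarrow> a \<cdot> (b \<otimes> c) = (a \<cdot> b) \<otimes> (a \<cdot> c)"
    and dot_cycle: "\<lbrakk>a \<in> carrier A; b \<in> carrier A; c \<in> carrier A\<rbrakk>
          \<Longrightarrow> (a \<otimes> b) \<cdot> c = (a \<cdot> b) \<cdot> (a \<cdot> c)"

definition lcs_trivial :: "('a, 'm) lcs_scheme \<Rightarrow> bool" where
  "lcs_trivial A \<longleftrightarrow> (\<forall>a\<in>carrier A. \<forall>b\<in>carrier A. a \<cdot>\<^bsub>A\<^esub> b = b)"

text \<open>\<open>lcs_act A a b\<close> is \<open>\<^sup>ab\<close>, and \<open>lcs_mult A a b\<close> is the product \<open>ab = \<^sup>ab + a\<close>.\<close>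

definition lcs_act :: "('a, 'm) lcs_scheme \<Rightarrow> 'a \<Rightarrow> 'a \<Rightarrow> 'a" where
  "lcs_act A a = inv_into (carrier A) (\<lambda>b. a \<cdot>\<^bsub>A\<^esub> b)"

definition lcs_mult :: "('a, 'm) lcs_scheme \<Rightarrow> 'a \<Rightarrow> 'a \<Rightarrow> 'a" where
  "lcs_mult A a b = lcs_act A a b \<otimes>\<^bsub>A\<^esub> a"

definition lcs_hom :: "('a, 'm) lcs_scheme \<Rightarrow> ('b, 'n) lcs_scheme \<Rightarrow> ('a \<Rightarrow> 'b) set" where
  "lcs_hom A B = {f \<in> hom A B. \<forall>a\<in>carrier A. \<forall>b\<in>carrier A. f (a \<cdot>\<^bsub>A\<^esub> b) = f a \<cdot>\<^bsub>B\<^esub> f b}"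


section \<open>Extensions\<close>

type_synonym ('h, 'i, 'b) extension = "('i \<Rightarrow> 'b) \<times> 'b lcs \<times> ('b \<Rightarrow> 'h)"

definition is_extension :: "'h lcs \<Rightarrow> 'i lcs \<Rightarrow> ('h, 'i, 'b) extension \<Rightarrow> bool" where
  "is_extension H I = (\<lambda>(\<iota>, B, \<pi>).
     linear_cycle_set B \<and> \<iota> \<in> lcs_hom I B \<and> \<pi> \<in> lcs_hom B H \<and>
     inj_on \<iota> (carrier I) \<and> \<iota> ` carrier I = kernel B H \<pi> \<and> \<pi> ` carrier B = carrier H)"

definition ext_equiv ::
    "'h lcs \<Rightarrow> 'i lcs \<Rightarrow> ('h, 'i, 'b) extension \<Rightarrow> ('h, 'i, 'c) extension \<Rightarrow> bool" where
  "ext_equiv H I = (\<lambda>(\<iota>, B, \<pi>) (\<iota>', B', \<pi>').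
     \<exists>\<phi>\<in>lcs_hom B B'. (\<forall>b\<in>carrier B. \<pi>' (\<phi> b) = \<pi> b) \<and> (\<forall>y\<in>carrier I. \<phi> (\<iota> y) = \<iota>' y))"

definition normalized_section ::
    "('h, 'm) monoid_scheme \<Rightarrow> ('b, 'n) monoid_scheme \<Rightarrow> ('b \<Rightarrow> 'h) \<Rightarrow> ('h \<Rightarrow> 'b) \<Rightarrow> bool" where
  "normalized_section H B \<pi> s \<longleftrightarrow>
     s \<in> carrier H \<rightarrow> carrier B \<and> (\<forall>h\<in>carrier H. \<pi> (s h) = h) \<and> s \<one>\<^bsub>H\<^esub> = \<one>\<^bsub>B\<^esub>"

definition extensions ::
    "'h lcs \<Rightarrow> 'i lcs \<Rightarrow> ('h \<Rightarrow> 'i \<Rightarrow> 'i) \<Rightarrow> ('h, 'i, 'b) extension set" where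
  "extensions H I dia = {(\<iota>, B, \<pi>). is_extension H I (\<iota>, B, \<pi>) \<and>
     (\<forall>s. normalized_section H B \<pi> s \<longrightarrow>
        (\<forall>h\<in>carrier H. \<forall>y\<in>carrier I.
           s h \<cdot>\<^bsub>B\<^esub> \<iota> y = \<iota> (dia h y) \<and>
           (\<iota> y \<cdot>\<^bsub>B\<^esub> s h) \<otimes>\<^bsub>B\<^esub> inv\<^bsub>B\<^esub> (s h) = \<one>\<^bsub>B\<^esub>))}"

text \<open>
  The middle terms \<open>B\<close> range over the linear cycle sets with carrier in the type \<open>'b\<close>. Since the
  carrier of \<open>B\<close> is always in bijection with \<open>H \<times> I\<close>, every extension is equivalent to one of these
  as soon as \<open>H \<times> I\<close> embeds in \<open>'b\<close>.
\<close>

definition Ext ::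
    "'h lcs \<Rightarrow> 'i lcs \<Rightarrow> ('h \<Rightarrow> 'i \<Rightarrow> 'i) \<Rightarrow> ('h, 'i, 'b) extension set set" where
  "Ext H I dia = extensions H I dia //
     {(E, E'). E \<in> extensions H I dia \<and> E' \<in> extensions H I dia \<and> ext_equiv H I E E'}"


section \<open>Homomorphism groups and tensor products\<close>

text \<open>Homomorphisms are made extensional, so that equality in the group is equality on \<open>G\<close>.\<close>

definition Hom_group ::
    "('a, 'm) monoid_scheme \<Rightarrow> ('b, 'n) monoid_scheme \<Rightarrow> ('a \<Rightarrow> 'b) monoid" where
  "Hom_group G K = \<lparr>carrier = hom G K \<inter> extensional (carrier G),
     mult = (\<lambda>f g. \<lambda>x\<in>carrier G. f x \<otimes>\<^bsub>K\<^esub> g x),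
     one = (\<lambda>x\<in>carrier G. \<one>\<^bsub>K\<^esub>)\<rparr>"

definition tensor_relators ::
    "('a, 'm) monoid_scheme \<Rightarrow> ('b, 'n) monoid_scheme \<Rightarrow> ('a \<times> 'b \<Rightarrow>\<^sub>0 int) set" where
  "tensor_relators A B =
     {frag_of (a \<otimes>\<^bsub>A\<^esub> a', b) - frag_of (a, b) - frag_of (a', b) | a a' b.
        a \<in> carrier A \<and> a' \<in> carrier A \<and> b \<in> carrier B} \<union>
     {frag_of (a, b \<otimes>\<^bsub>B\<^esub> b') - frag_of (a, b) - frag_of (a, b') | a b b'.
        a \<in> carrier A \<and> b \<in> carrier B \<and> b' \<in> carrier B}"

definition tensor_subgroup ::
    "('a, 'm) monoid_scheme \<Rightarrow> ('b, 'n) monoid_scheme \<Rightarrow> ('a \<times> 'b \<Rightarrow>\<^sub>0 int) set" where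
  "tensor_subgroup A B =
     generate (free_Abelian_group (carrier A \<times> carrier B)) (tensor_relators A B)"

definition tensor ::
    "('a, 'm) monoid_scheme \<Rightarrow> ('b, 'n) monoid_scheme \<Rightarrow> ('a \<times> 'b \<Rightarrow>\<^sub>0 int) set monoid" where
  "tensor A B = free_Abelian_group (carrier A \<times> carrier B) Mod tensor_subgroup A B"

definition pure_tensor ::
    "('a, 'm) monoid_scheme \<Rightarrow> ('b, 'n) monoid_scheme \<Rightarrow> 'a \<Rightarrow> 'b \<Rightarrow> ('a \<times> 'b \<Rightarrow>\<^sub>0 int) set" where
  "pure_tensor A B a b =
     tensor_subgroup A B #>\<^bsub>free_Abelian_group (carrier A \<times> carrier B)\<^esub> frag_of (a, b)"


section \<open>The cochain groups\<close>

text \<open>Tuples \<open>(h\<^sub>1, \<dots>, h\<^sub>s)\<close> are lists of length \<open>s\<close>; in particular \<open>\<int>[H\<^sup>0]\<close> is free on \<open>[]\<close>.\<close>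

definition tuples :: "('h, 'm) monoid_scheme \<Rightarrow> nat \<Rightarrow> 'h list set" where
  "tuples H s = {hs. length hs = s \<and> set hs \<subseteq> carrier H - {\<one>\<^bsub>H\<^esub>}}"

abbreviation ZH :: "('h, 'm) monoid_scheme \<Rightarrow> nat \<Rightarrow> ('h list \<Rightarrow>\<^sub>0 int) monoid" where
  "ZH H s \<equiv> free_Abelian_group (tuples H s)"

text \<open>Permutations act on \<open>{0, \<dots>, s - 1}\<close> instead of \<open>{1, \<dots>, s}\<close>.\<close>

definition shuffle_perms :: "nat \<Rightarrow> nat \<Rightarrow> (nat \<Rightarrow> nat) set" where
  "shuffle_perms l s =
     {\<sigma>. \<sigma> permutes {..<s} \<and> strict_mono_on {..<l} \<sigma> \<and> strict_mono_on {l..<s} \<sigma>}"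

definition shuffle_elem :: "nat \<Rightarrow> 'h list \<Rightarrow> ('h list \<Rightarrow>\<^sub>0 int)" where
  "shuffle_elem l hs = (\<Sum>\<sigma>\<in>shuffle_perms l (length hs).
     frag_cmul (sign \<sigma>) (frag_of (permute_list (inv_into UNIV \<sigma>) hs)))"

definition shuffle_subgroup :: "('h, 'm) monoid_scheme \<Rightarrow> nat \<Rightarrow> ('h list \<Rightarrow>\<^sub>0 int) set" where
  "shuffle_subgroup H s =
     generate (ZH H s) {shuffle_elem l hs | l hs. 1 \<le> l \<and> l < s \<and> hs \<in> tuples H s}"

definition Mbar :: "('h, 'm) monoid_scheme \<Rightarrow> nat \<Rightarrow> ('h list \<Rightarrow>\<^sub>0 int) set monoid" where
  "Mbar H s = ZH H s Mod shuffle_subgroup H s"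

definition Mbar_class :: "('h, 'm) monoid_scheme \<Rightarrow> 'h list \<Rightarrow> ('h list \<Rightarrow>\<^sub>0 int) set" where
  "Mbar_class H hs = shuffle_subgroup H (length hs) #>\<^bsub>ZH H (length hs)\<^esub> frag_of hs"

type_synonym ('h, 'i) cochain =
  "(('h list \<Rightarrow>\<^sub>0 int) \<times> ('h list \<Rightarrow>\<^sub>0 int) set \<Rightarrow>\<^sub>0 int) set \<Rightarrow> 'i"

definition cochain_group :: "'h lcs \<Rightarrow> 'i lcs \<Rightarrow> nat \<Rightarrow> nat \<Rightarrow> ('h, 'i) cochain monoid" where
  "cochain_group H I r s = Hom_group (tensor (ZH H r) (Mbar H s)) I"

text \<open>\<open>cval H I f [h\<^sub>1, \<dots>, h\<^sub>r] [k\<^sub>1, \<dots>, k\<^sub>s]\<close> is \<open>f(h\<^sub>1, \<dots>, h\<^sub>r, [k\<^sub>1, \<dots>, k\<^sub>s])\<close>, with the convention that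
  it vanishes if one of the entries does.\<close>

definition cval ::
    "'h lcs \<Rightarrow> 'i lcs \<Rightarrow> ('h, 'i) cochain \<Rightarrow> 'h list \<Rightarrow> 'h list \<Rightarrow> 'i" where
  "cval H I f hs ks =
     (if \<one>\<^bsub>H\<^esub> \<in> set hs \<union> set ks then \<one>\<^bsub>I\<^esub>
      else f (pure_tensor (ZH H (length hs)) (Mbar H (length ks)) (frag_of hs) (Mbar_class H ks)))"


section \<open>The coboundary maps\<close>

text \<open>\<open>merge_at H j\<close> replaces the entries number \<open>j\<close> and \<open>j + 1\<close>, counted from \<open>1\<close>, by their sum.\<close>

definition merge_at :: "('h, 'm) monoid_scheme \<Rightarrow> nat \<Rightarrow> 'h list \<Rightarrow> 'h list" where
  "merge_at H j hs = take (j - 1) hs @ [hs ! (j - 1) \<otimes>\<^bsub>H\<^esub> hs ! j] @ drop (j + 1) hs"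

text \<open>\<open>R1 H [h\<^sub>1, \<dots>, h\<^sub>r\<^sub>+\<^sub>1]\<close> is \<open>R\<^sub>r\<^sub>1(h\<^sub>1, \<dots>, h\<^sub>r\<^sub>+\<^sub>1)\<close>. For \<open>r = 0\<close> the sum is empty, and \<open>0 \<cdot> h = h\<close>.\<close>

definition R1 :: "('h, 'm) lcs_scheme \<Rightarrow> 'h list \<Rightarrow> 'h" where
  "R1 H hs = foldr (\<lambda>x y. x \<otimes>\<^bsub>H\<^esub> y) (butlast hs) \<one>\<^bsub>H\<^esub> \<cdot>\<^bsub>H\<^esub> last hs"

definition dh_formula ::
    "'h lcs \<Rightarrow> 'i lcs \<Rightarrow> ('h \<Rightarrow> 'i \<Rightarrow> 'i) \<Rightarrow> nat \<Rightarrow> ('h, 'i) cochain \<Rightarrow> 'h list \<Rightarrow> 'h list \<Rightarrow> 'i" where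
  "dh_formula H I dia r f hs ks =
     cval H I f (map (\<lambda>h. hd hs \<cdot>\<^bsub>H\<^esub> h) (tl hs)) (map (\<lambda>k. hd hs \<cdot>\<^bsub>H\<^esub> k) ks) \<otimes>\<^bsub>I\<^esub>
     finprod I (\<lambda>j. cval H I f (merge_at H j hs) ks [^]\<^bsub>I\<^esub> ((-1) ^ j :: int)) {1..r} \<otimes>\<^bsub>I\<^esub>
     dia (R1 H hs) (cval H I f (butlast hs) ks) [^]\<^bsub>I\<^esub> ((-1) ^ (r + 1) :: int)"

definition dv_formula ::
    "'h lcs \<Rightarrow> 'i lcs \<Rightarrow> nat \<Rightarrow> nat \<Rightarrow> ('h, 'i) cochain \<Rightarrow> 'h list \<Rightarrow> 'h list \<Rightarrow> 'i" where
  "dv_formula H I r s f hs ks =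
     cval H I f hs (tl ks) [^]\<^bsub>I\<^esub> ((-1) ^ r :: int) \<otimes>\<^bsub>I\<^esub>
     finprod I (\<lambda>j. cval H I f hs (merge_at H (j - r) ks) [^]\<^bsub>I\<^esub> ((-1) ^ j :: int)) {r+1..r+s} \<otimes>\<^bsub>I\<^esub>
     cval H I f hs (butlast ks) [^]\<^bsub>I\<^esub> ((-1) ^ (r + s + 1) :: int)"

text \<open>
  A homomorphism on \<open>\<int>[H\<^sup>r] \<otimes> M(s)\<close> is determined by its values on the generators
  \<open>(h\<^sub>1, \<dots>, h\<^sub>r) \<otimes> [k\<^sub>1, \<dots>, k\<^sub>s]\<close> with all entries nonzero, so the coboundaries are the unique cochains
  with the prescribed values there. Here \<open>dh r s\<close> and \<open>dv r s\<close> are indexed by the bidegree of their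
  source: they are \<open>\<partial>\<^sub>h\<close> into bidegree \<open>(r + 1, s)\<close> and \<open>\<partial>\<^sub>v\<close> into bidegree \<open>(r, s + 1)\<close>.
\<close>

definition dh ::
    "'h lcs \<Rightarrow> 'i lcs \<Rightarrow> ('h \<Rightarrow> 'i \<Rightarrow> 'i) \<Rightarrow> nat \<Rightarrow> nat \<Rightarrow> ('h, 'i) cochain \<Rightarrow> ('h, 'i) cochain" where
  "dh H I dia r s f = (THE g. g \<in> carrier (cochain_group H I (r + 1) s) \<and>
     (\<forall>hs\<in>tuples H (r + 1). \<forall>ks\<in>tuples H s. cval H I g hs ks = dh_formula H I dia r f hs ks))"

definition dv ::
    "'h lcs \<Rightarrow> 'i lcs \<Rightarrow> nat \<Rightarrow> nat \<Rightarrow> ('h, 'i) cochain \<Rightarrow> ('h, 'i) cochain" where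
  "dv H I r s f = (THE g. g \<in> carrier (cochain_group H I r (s + 1)) \<and>
     (\<forall>hs\<in>tuples H r. \<forall>ks\<in>tuples H (s + 1). cval H I g hs ks = dv_formula H I r s f hs ks))"


section \<open>The total complex and its cohomology\<close>

text \<open>The total complex starts in degree \<open>1\<close>; for \<open>n = 0\<close> the direct sum is empty and \<open>Tot\<close> is
  the trivial group.\<close>

definition Tot :: "'h lcs \<Rightarrow> 'i lcs \<Rightarrow> nat \<Rightarrow> (nat \<Rightarrow> ('h, 'i) cochain) monoid" where
  "Tot H I n = sum_group {..<n} (\<lambda>r. cochain_group H I r (n - r))"

text \<open>The component of the differential in \<open>C\<^sup>r\<^sup>,\<^sup>n\<^sup>+\<^sup>1\<^sup>-\<^sup>r\<close> comes from \<open>C\<^sup>r\<^sup>-\<^sup>1\<^sup>,\<^sup>n\<^sup>+\<^sup>1\<^sup>-\<^sup>r\<close> and from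
  \<open>C\<^sup>r\<^sup>,\<^sup>n\<^sup>-\<^sup>r\<close>; the first is absent for \<open>r = 0\<close>, the second for \<open>r = n\<close>.\<close>

definition Tot_d ::
    "'h lcs \<Rightarrow> 'i lcs \<Rightarrow> ('h \<Rightarrow> 'i \<Rightarrow> 'i) \<Rightarrow> nat \<Rightarrow>
     (nat \<Rightarrow> ('h, 'i) cochain) \<Rightarrow> (nat \<Rightarrow> ('h, 'i) cochain)" where
  "Tot_d H I dia n f = (\<lambda>r\<in>{..<n + 1}.
     (if r = 0 then \<one>\<^bsub>cochain_group H I r (n + 1 - r)\<^esub> else dh H I dia (r - 1) (n + 1 - r) (f (r - 1)))
       \<otimes>\<^bsub>cochain_group H I r (n + 1 - r)\<^esub>
     (if r = n then \<one>\<^bsub>cochain_group H I r (n + 1 - r)\<^esub> else dv H I r (n - r) (f r)))"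

text \<open>Cohomology in degree \<open>n \<ge> 1\<close>, as cocycles modulo coboundaries.\<close>

definition cohomology ::
    "'h lcs \<Rightarrow> 'i lcs \<Rightarrow> ('h \<Rightarrow> 'i \<Rightarrow> 'i) \<Rightarrow> nat \<Rightarrow> (nat \<Rightarrow> ('h, 'i) cochain) set monoid" where
  "cohomology H I dia n =
     (Tot H I n)\<lparr>carrier := kernel (Tot H I n) (Tot H I (n + 1)) (Tot_d H I dia n)\<rparr>
       Mod (Tot_d H I dia (n - 1) ` carrier (Tot H I (n - 1)))"

end

theory Submission
  imports Defs
begin

text \<open>
  A cochain is the same as a function on tuples of nonzero elements that vanishes on shuffles. Hence
  a degree-two cocycle is a pair of normalized functions \<open>\<beta>, \<gamma> :: H \<Rightarrow> H \<Rightarrow> I\<close> with \<open>\<beta>\<close> symmetric,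
  and vanishing of the differential becomes three equations. Choosing a normalized section \<open>s\<close> of an
  extension and writing \<open>s a + s b = \<iota> (\<beta> a b) + s (a + b)\<close> and \<open>s a \<cdot> s b = - \<iota> (\<gamma> a b) + s (a \<cdot> b)\<close>
  (the minus sign is forced by the sign conventions of the double complex), these three equations
  are associativity of \<open>+\<close> and the two distributivity laws of the dot. Two extensions are
  equivalent exactly when their pairs \<open>(\<beta>, \<gamma>)\<close> differ by the coboundary of the function \<open>\<theta>\<close> that
  compares the two sections.
\<close>

section \<open>Homomorphisms out of presented abelian groups and tensor products\<close>

text \<open>The cochain groups are homomorphism groups on tensor products of a free group with a
  quotient, and they are handled only through universal properties. The existence half is the real
  obstacle: \<open>dh\<close> and \<open>dv\<close> are definite descriptions, so nothing is known
  about them until their formulas are shown to vanish on shuffles. This is checked bidegree by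
  bidegree, for the coboundaries leaving total degrees one and two. The sign of \<gamma> comes from
  bidegree (1, 2), where the differential is \<beta>(a \<cdot> b, a \<cdot> c) - a \<diamondop>
  \<beta>(b, c) - \<gamma>(a, b) - \<gamma>(a, c) + \<gamma>(a, b + c). If s a \<cdot> s b = \<iota>
  (d a b) + s (a \<cdot> b), distributivity of the dot says that this expression is zero for
  \<gamma> = - d. The cocycle equations alone do not make left translations by the dot bijective on
  H \<times> I; this uses that each \<open>dia h\<close> is invertible, which has to be extracted
  from the action law. The pair (\<beta>, \<gamma>) depends on the section, so extensions are
  matched with cocycles by the relation \<open>represents\<close>, and a map out of
  \<open>Ext\<close> appears only on classes.\<close>

lemma hom_Mod_generate:
  assumes "comm_group G" "group K" "h \<in> hom G K" "R \<subseteq> carrier G" "\<And>r. r \<in> R \<Longrightarrow> h r = \<one>\<^bsub>K\<^esub>"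
  obtains g where "g \<in> hom (G Mod generate G R) K"
    "\<And>x. x \<in> carrier G \<Longrightarrow> g (generate G R #>\<^bsub>G\<^esub> x) = h x"
proof -
  interpret comm_group G by fact
  interpret gh: group_hom G K h
    using assms by (simp add: group_hom_def group_hom_axioms_def is_group)
  have "generate G R \<subseteq> kernel G K h"
    using assms by (intro generate_subgroup_incl gh.subgroup_kernel) (auto simp: kernel_def)
  moreover have "generate G R \<lhd> G"
    using assms(4) by (intro subgroup_imp_normal generate_is_subgroup)
  ultimately show ?thesis
    using gh.FactGroup_universal_kernel that by metis
qed

lemma hom_free_Abelian_group_eqI:
  fixes S :: "'a set"
  assumes "group K" "f \<in> hom (free_Abelian_group S) K" "g \<in> hom (free_Abelian_group S) K"
    and eq: "\<And>a. a \<in> S \<Longrightarrow> f (frag_of a) = g (frag_of a)"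
    and x: "x \<in> carrier (free_Abelian_group S)"
  shows "f x = g x"
proof -
  interpret f: group_hom "free_Abelian_group S" K f
    using assms by (simp add: group_hom_def group_hom_axioms_def)
  interpret g: group_hom "free_Abelian_group S" K g
    using assms by (simp add: group_hom_def group_hom_axioms_def)
  \<comment> \<open>The induction principle for free abelian groups closes under differences, while
    homomorphisms respect product and inverse; this equation translates between the two.\<close>
  have minus: "x \<otimes>\<^bsub>free_Abelian_group S\<^esub> inv\<^bsub>free_Abelian_group S\<^esub> y = x - y"
    if "Poly_Mapping.keys y \<subseteq> S" for x y
    using that by simp
  have "Poly_Mapping.keys x \<subseteq> S" using x by simp
  then show ?thesis
  proof (rule free_Abelian_group_induct[where P = "\<lambda>x. f x = g x"])
    show "f 0 = g 0" using f.hom_one g.hom_one by simp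
  next
    fix x y :: "'a \<Rightarrow>\<^sub>0 int"
    assume 2: "Poly_Mapping.keys x \<subseteq> S" "Poly_Mapping.keys y \<subseteq> S" "f x = g x" "f y = g y"
    have x: "x \<in> carrier (free_Abelian_group S)" and y: "y \<in> carrier (free_Abelian_group S)"
      using 2 by simp_all
    have "f (x - y) = f x \<otimes>\<^bsub>K\<^esub> inv\<^bsub>K\<^esub> (f y)"
      using f.hom_mult[OF x f.G.inv_closed[OF y]] f.hom_inv[OF y] minus[OF 2(2)] by (simp only:)
    moreover have "g (x - y) = g x \<otimes>\<^bsub>K\<^esub> inv\<^bsub>K\<^esub> (g y)"
      using g.hom_mult[OF x f.G.inv_closed[OF y]] g.hom_inv[OF y] minus[OF 2(2)] by (simp only:)
    ultimately show "f (x - y) = g (x - y)" using 2 by simp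
  qed (use eq in auto)
qed

lemma generate_free_normal:
  assumes "R \<subseteq> carrier (free_Abelian_group S)"
  shows "generate (free_Abelian_group S) R \<lhd> free_Abelian_group S"
proof -
  interpret comm_group "free_Abelian_group S" by (rule abelian_free_Abelian_group)
  show ?thesis using assms by (intro subgroup_imp_normal generate_is_subgroup)
qed

lemma generate_free_coset_eqI:
  assumes "R \<subseteq> carrier (free_Abelian_group S)" "x - y \<in> generate (free_Abelian_group S) R"
    "Poly_Mapping.keys x \<subseteq> S" "Poly_Mapping.keys y \<subseteq> S"
  shows "generate (free_Abelian_group S) R #>\<^bsub>free_Abelian_group S\<^esub> x =
    generate (free_Abelian_group S) R #>\<^bsub>free_Abelian_group S\<^esub> y"
proof -
  interpret comm_group "free_Abelian_group S" by (rule abelian_free_Abelian_group)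
  let ?N = "generate (free_Abelian_group S) R"
  have N: "subgroup ?N (free_Abelian_group S)"
    using assms by (intro generate_is_subgroup)
  have "x = (x - y) \<otimes>\<^bsub>free_Abelian_group S\<^esub> y" by simp
  then have "x \<in> ?N #>\<^bsub>free_Abelian_group S\<^esub> y"
    using assms(2) by (metis r_coset_def UN_iff singleton_iff)
  then show ?thesis
    using N repr_independence[of x ?N y] assms(4) by simp
qed

lemma Mod_generate_free_comm_group:
  assumes "R \<subseteq> carrier (free_Abelian_group S)"
  shows "comm_group (free_Abelian_group S Mod generate (free_Abelian_group S) R)"
proof -
  interpret comm_group "free_Abelian_group S" by (rule abelian_free_Abelian_group)
  show ?thesis
    using assms by (intro abelian_FactGroup generate_is_subgroup)
qed

section \<open>Tensor products: bilinearity and the universal property\<close>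

lemma tensor_relators_subset:
  assumes "group A" "group B"
  shows "tensor_relators A B \<subseteq> carrier (free_Abelian_group (carrier A \<times> carrier B))"
proof -
  interpret A: group A by fact
  interpret B: group B by fact
  have keys: "Poly_Mapping.keys (frag_of p - frag_of q - frag_of r) \<subseteq> X"
    if "p \<in> X" "q \<in> X" "r \<in> X" for p q r :: "'a \<times> 'c" and X
    using that keys_diff[of "frag_of p - frag_of q" "frag_of r"] keys_diff[of "frag_of p" "frag_of q"]
    by auto
  show ?thesis
    unfolding tensor_relators_def
    by (rule subsetI, subst carrier_free_Abelian_group_iff)
      (elim UnE CollectE exE conjE; hypsubst; rule keys; simp)
qed

context
  fixes A :: "('a, 'm) monoid_scheme" and B :: "('b, 'n) monoid_scheme"
  assumes A: "group A" and B: "group B"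
begin

lemma tensor_subgroup_normal: "tensor_subgroup A B \<lhd> free_Abelian_group (carrier A \<times> carrier B)"
  unfolding tensor_subgroup_def by (intro generate_free_normal tensor_relators_subset A B)

lemma pure_tensor_closed:
  "a \<in> carrier A \<Longrightarrow> b \<in> carrier B \<Longrightarrow> pure_tensor A B a b \<in> carrier (tensor A B)"
  unfolding pure_tensor_def tensor_def carrier_FactGroup by (rule imageI) simp

lemma tensor_coset_mult:
  assumes "Poly_Mapping.keys x \<subseteq> carrier A \<times> carrier B" "Poly_Mapping.keys y \<subseteq> carrier A \<times> carrier B"
  shows "(tensor_subgroup A B #>\<^bsub>free_Abelian_group (carrier A \<times> carrier B)\<^esub> x) \<otimes>\<^bsub>tensor A B\<^esub>
      (tensor_subgroup A B #>\<^bsub>free_Abelian_group (carrier A \<times> carrier B)\<^esub> y) =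
    tensor_subgroup A B #>\<^bsub>free_Abelian_group (carrier A \<times> carrier B)\<^esub> (x + y)"
  using normal.rcos_sum[OF tensor_subgroup_normal, of x y] assms by (simp add: tensor_def)

text \<open>Both families of relators have the shape of one generator minus two others. Treating
  that shape once yields additivity in either argument.\<close>

lemma pure_tensor_relI:
  assumes "frag_of p - frag_of q - frag_of r \<in> tensor_relators A B"
    "p \<in> carrier A \<times> carrier B" "q \<in> carrier A \<times> carrier B" "r \<in> carrier A \<times> carrier B"
  shows "pure_tensor A B (fst p) (snd p) =
    pure_tensor A B (fst q) (snd q) \<otimes>\<^bsub>tensor A B\<^esub> pure_tensor A B (fst r) (snd r)"
proof -
  have "pure_tensor A B (fst p) (snd p) =
    tensor_subgroup A B #>\<^bsub>free_Abelian_group (carrier A \<times> carrier B)\<^esub> (frag_of q + frag_of r)"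
    unfolding pure_tensor_def tensor_subgroup_def
    using assms keys_add[of "frag_of q" "frag_of r"]
    by (intro generate_free_coset_eqI tensor_relators_subset A B generate.incl)
      (auto simp: diff_diff_add)
  also have "\<dots> = pure_tensor A B (fst q) (snd q) \<otimes>\<^bsub>tensor A B\<^esub> pure_tensor A B (fst r) (snd r)"
    using assms by (subst tensor_coset_mult[symmetric]) (auto simp: pure_tensor_def)
  finally show ?thesis .
qed

lemma pure_tensor_add_left:
  assumes "a \<in> carrier A" "a' \<in> carrier A" "b \<in> carrier B"
  shows "pure_tensor A B (a \<otimes>\<^bsub>A\<^esub> a') b = pure_tensor A B a b \<otimes>\<^bsub>tensor A B\<^esub> pure_tensor A B a' b"
proof -
  interpret A: group A by (rule A)
  show ?thesis
    using pure_tensor_relI[of "(a \<otimes>\<^bsub>A\<^esub> a', b)" "(a, b)" "(a', b)"] assms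
    unfolding tensor_relators_def by simp blast
qed

lemma pure_tensor_add_right:
  assumes "a \<in> carrier A" "b \<in> carrier B" "b' \<in> carrier B"
  shows "pure_tensor A B a (b \<otimes>\<^bsub>B\<^esub> b') = pure_tensor A B a b \<otimes>\<^bsub>tensor A B\<^esub> pure_tensor A B a b'"
proof -
  interpret B: group B by (rule B)
  show ?thesis
    using pure_tensor_relI[of "(a, b \<otimes>\<^bsub>B\<^esub> b')" "(a, b)" "(a, b')"] assms
    unfolding tensor_relators_def by simp blast
qed

lemma tensor_hom_eqI:
  assumes K: "group K" and f: "f \<in> hom (tensor A B) K" and g: "g \<in> hom (tensor A B) K"
    and eq: "\<And>a b. a \<in> carrier A \<Longrightarrow> b \<in> carrier B \<Longrightarrow> f (pure_tensor A B a b) = g (pure_tensor A B a b)"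
    and x: "x \<in> carrier (tensor A B)"
  shows "f x = g x"
proof -
  let ?F = "free_Abelian_group (carrier A \<times> carrier B)"
  let ?q = "\<lambda>x. tensor_subgroup A B #>\<^bsub>?F\<^esub> x"
  have q: "?q \<in> hom ?F (tensor A B)"
    unfolding tensor_def using tensor_subgroup_normal by (rule normal.r_coset_hom_Mod)
  obtain y where y: "y \<in> carrier ?F" "x = ?q y"
    using x by (auto simp: tensor_def carrier_FactGroup simp del: carrier_free_Abelian_group_iff)
  have "(f \<circ> ?q) y = (g \<circ> ?q) y"
    by (rule hom_free_Abelian_group_eqI[OF K hom_compose[OF q f] hom_compose[OF q g] _ y(1)])
      (use eq in \<open>auto simp: pure_tensor_def\<close>)
  then show ?thesis by (simp add: y)
qed

lemma tensor_hom_exists: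
  assumes K: "comm_group K"
    and l: "\<And>b. b \<in> carrier B \<Longrightarrow> (\<lambda>a. \<phi> a b) \<in> hom A K"
    and r: "\<And>a. a \<in> carrier A \<Longrightarrow> \<phi> a \<in> hom B K"
  obtains f where "f \<in> hom (tensor A B) K"
    "\<And>a b. a \<in> carrier A \<Longrightarrow> b \<in> carrier B \<Longrightarrow> f (pure_tensor A B a b) = \<phi> a b"
proof -
  interpret A: group A by (rule A)
  interpret B: group B by (rule B)
  interpret K: comm_group K by (rule K)
  let ?F = "free_Abelian_group (carrier A \<times> carrier B)"
  have clo: "\<phi> a b \<in> carrier K" if "a \<in> carrier A" "b \<in> carrier B" for a b
    using r[OF that(1)] that(2) by (auto simp: hom_def)
  obtain h where h: "h \<in> hom ?F K" "\<And>p. p \<in> carrier A \<times> carrier B \<Longrightarrow> h (frag_of p) = \<phi> (fst p) (snd p)"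
    using K.free_Abelian_group_universal[of "\<lambda>p. \<phi> (fst p) (snd p)" "carrier A \<times> carrier B"] clo
    by (auto simp: image_subset_iff)
  interpret h: group_hom ?F K h
    using h by (simp add: group_hom_def group_hom_axioms_def K.is_group)
  \<comment> \<open>Additivity of \<phi> in either argument relates three of its values in the same
    way, so this one computation kills both families of relators.\<close>
  have h3: "h (frag_of p - frag_of q - frag_of r) = \<one>\<^bsub>K\<^esub>"
    if "p \<in> carrier A \<times> carrier B" "q \<in> carrier A \<times> carrier B" "r \<in> carrier A \<times> carrier B"
      "\<phi> (fst p) (snd p) = \<phi> (fst q) (snd q) \<otimes>\<^bsub>K\<^esub> \<phi> (fst r) (snd r)" for p q r
  proof -
    have "frag_of p - frag_of q - frag_of r = frag_of p \<otimes>\<^bsub>?F\<^esub> inv\<^bsub>?F\<^esub> (frag_of q \<otimes>\<^bsub>?F\<^esub> frag_of r)"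
      using that keys_add[of "frag_of q" "frag_of r"]
      by (subst inv_free_Abelian_group) auto
    also have "h \<dots> = h (frag_of p) \<otimes>\<^bsub>K\<^esub> inv\<^bsub>K\<^esub> (h (frag_of q) \<otimes>\<^bsub>K\<^esub> h (frag_of r))"
      using that by (metis frag_of_in_free_Abelian_group h.G.inv_closed h.hom_inv h.hom_mult h.G.m_closed)
    finally show ?thesis using that clo by (simp add: h mem_Times_iff)
  qed
  have "h x = \<one>\<^bsub>K\<^esub>" if x: "x \<in> tensor_relators A B" for x
  proof -
    consider a a' b where "a \<in> carrier A" "a' \<in> carrier A" "b \<in> carrier B"
        "x = frag_of (a \<otimes>\<^bsub>A\<^esub> a', b) - frag_of (a, b) - frag_of (a', b)"
      | a b b' where "a \<in> carrier A" "b \<in> carrier B" "b' \<in> carrier B"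
        "x = frag_of (a, b \<otimes>\<^bsub>B\<^esub> b') - frag_of (a, b) - frag_of (a, b')"
      using x by (auto simp: tensor_relators_def)
    then show ?thesis
      using l r by cases (simp_all add: h3 hom_mult[of "\<lambda>a. \<phi> a _" A K] hom_mult[of "\<phi> _" B K])
  qed
  then obtain g where "g \<in> hom (tensor A B) K" "\<And>x. x \<in> carrier ?F \<Longrightarrow> g (tensor_subgroup A B #>\<^bsub>?F\<^esub> x) = h x"
    using hom_Mod_generate[OF abelian_free_Abelian_group K.is_group h(1) tensor_relators_subset[OF A B]]
    unfolding tensor_def tensor_subgroup_def by metis
  with h that show ?thesis by (auto simp: pure_tensor_def)
qed

end

section \<open>Cochains as functions on tuples\<close>

lemma tuplesD: "hs \<in> tuples H s \<Longrightarrow> length hs = s" "hs \<in> tuples H s \<Longrightarrow> \<one>\<^bsub>H\<^esub> \<notin> set hs"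
  "hs \<in> tuples H s \<Longrightarrow> h \<in> set hs \<Longrightarrow> h \<in> carrier H"
  by (auto simp: tuples_def)

section \<open>The quotient by shuffles and its universal property\<close>

lemma shuffle_perms_permutes: "\<sigma> \<in> shuffle_perms l s \<Longrightarrow> \<sigma> permutes {..<s}"
  by (simp add: shuffle_perms_def)

lemma finite_shuffle_perms: "finite (shuffle_perms l s)"
  by (rule finite_subset[OF _ finite_permutations[of "{..<s}"]]) (auto simp: shuffle_perms_def)

lemma permute_list_tuples:
  assumes "hs \<in> tuples H s" "\<sigma> permutes {..<s}"
  shows "permute_list (inv_into UNIV \<sigma>) hs \<in> tuples H s"
  using assms permutes_inv[OF assms(2)] by (auto simp: tuples_def)

lemma shuffle_generators_subset:
  "{shuffle_elem l hs | l hs. 1 \<le> l \<and> l < s \<and> hs \<in> tuples H s} \<subseteq> carrier (ZH H s)"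
proof -
  have "shuffle_elem l hs \<in> carrier (ZH H s)" if "hs \<in> tuples H s" for l hs
    unfolding shuffle_elem_def
  proof (rule sum_closed_free_Abelian_group)
    fix \<sigma> assume "\<sigma> \<in> shuffle_perms l (length hs)"
    then have "permute_list (inv_into UNIV \<sigma>) hs \<in> tuples H s"
      using that by (auto intro!: permute_list_tuples dest: tuplesD shuffle_perms_permutes)
    then show "frag_cmul (sign \<sigma>) (frag_of (permute_list (inv_into UNIV \<sigma>) hs)) \<in> carrier (ZH H s)"
      using keys_cmul[of "sign \<sigma>" "frag_of (permute_list (inv_into UNIV \<sigma>) hs)"] by auto
  qed
  then show ?thesis by blast
qed

lemma Mbar_comm_group: "comm_group (Mbar H s)"
  unfolding Mbar_def shuffle_subgroup_def
  by (intro Mod_generate_free_comm_group shuffle_generators_subset)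

lemma Mbar_group: "group (Mbar H s)"
  by (rule comm_group.axioms(2)[OF Mbar_comm_group])

lemma Mbar_class_closed: "ks \<in> tuples H s \<Longrightarrow> Mbar_class H ks \<in> carrier (Mbar H s)"
  unfolding Mbar_class_def Mbar_def carrier_FactGroup by (rule image_eqI) (auto dest: tuplesD)

lemma Mbar_hom_eqI:
  assumes K: "group K" and f: "f \<in> hom (Mbar H s) K" and g: "g \<in> hom (Mbar H s) K"
    and eq: "\<And>ks. ks \<in> tuples H s \<Longrightarrow> f (Mbar_class H ks) = g (Mbar_class H ks)"
    and x: "x \<in> carrier (Mbar H s)"
  shows "f x = g x"
proof -
  let ?q = "\<lambda>x. shuffle_subgroup H s #>\<^bsub>ZH H s\<^esub> x"
  have q: "?q \<in> hom (ZH H s) (Mbar H s)"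
    unfolding Mbar_def shuffle_subgroup_def
    by (intro normal.r_coset_hom_Mod generate_free_normal shuffle_generators_subset)
  obtain y where y: "y \<in> carrier (ZH H s)" "x = ?q y"
    using x by (auto simp: Mbar_def carrier_FactGroup simp del: carrier_free_Abelian_group_iff)
  have "(f \<circ> ?q) y = (g \<circ> ?q) y"
    by (rule hom_free_Abelian_group_eqI[OF K hom_compose[OF q f] hom_compose[OF q g] _ y(1)])
      (use eq in \<open>auto simp: Mbar_class_def dest: tuplesD\<close>)
  then show ?thesis by (simp add: y)
qed

lemma hom_sum_frag_cmul:
  assumes K: "comm_group K" and h: "h \<in> hom (free_Abelian_group S) K"
    and X: "finite X" "\<And>i. i \<in> X \<Longrightarrow> x i \<in> S"
  shows "h (\<Sum>i\<in>X. frag_cmul (c i) (frag_of (x i))) =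
    finprod K (\<lambda>i. h (frag_of (x i)) [^]\<^bsub>K\<^esub> (c i :: int)) X"
proof -
  interpret K: comm_group K by fact
  interpret h: group_hom "free_Abelian_group S" K h
    using h by (simp add: group_hom_def group_hom_axioms_def K.is_group)
  have fr: "frag_cmul (c i) (frag_of (x i)) \<in> carrier (free_Abelian_group S)" if "i \<in> X" for i
    using X(2)[OF that] keys_cmul[of "c i" "frag_of (x i)"] by auto
  have hx: "h (frag_of (x i)) \<in> carrier K" if "i \<in> X" for i
    using X(2)[OF that] by (intro h.hom_closed) simp
  have hc: "h (frag_cmul (c i) (frag_of (x i))) = h (frag_of (x i)) [^]\<^bsub>K\<^esub> c i" if "i \<in> X" for i
    using h.hom_int_pow[of "frag_of (x i)" "c i"] X(2)[OF that] by simp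
  show ?thesis
    using X(1) fr hx hc
  proof (induction X rule: finite_induct)
    case empty
    then show ?case using h.hom_one by simp
  next
    case (insert i X)
    have "h (frag_cmul (c i) (frag_of (x i)) + (\<Sum>i\<in>X. frag_cmul (c i) (frag_of (x i)))) =
      h (frag_cmul (c i) (frag_of (x i))) \<otimes>\<^bsub>K\<^esub> h (\<Sum>i\<in>X. frag_cmul (c i) (frag_of (x i)))"
      using h.hom_mult[of "frag_cmul (c i) (frag_of (x i))" "\<Sum>i\<in>X. frag_cmul (c i) (frag_of (x i))"]
        insert.prems(1) sum_closed_free_Abelian_group[of X "\<lambda>i. frag_cmul (c i) (frag_of (x i))" S]
      by simp
    then show ?case
      using insert by (simp add: K.finprod_insert Pi_iff)
  qed
qed

text \<open>The hypothesis \<open>shuffle\<close> says that the linear extension of \<open>F\<close>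
  to the free group kills each generator of \<open>shuffle_subgroup\<close>. It is spelled out as a
  \<open>finprod\<close> of values of \<open>F\<close>, the form in which concrete formulas are
  later tested.\<close>

lemma Mbar_hom_exists:
  assumes K: "comm_group K"
    and F: "\<And>ks. ks \<in> tuples H s \<Longrightarrow> F ks \<in> carrier K"
    and shuffle: "\<And>l ks. \<lbrakk>1 \<le> l; l < s; ks \<in> tuples H s\<rbrakk> \<Longrightarrow>
      finprod K (\<lambda>\<sigma>. F (permute_list (inv_into UNIV \<sigma>) ks) [^]\<^bsub>K\<^esub> sign \<sigma>) (shuffle_perms l s) = \<one>\<^bsub>K\<^esub>"
  obtains f where "f \<in> hom (Mbar H s) K" "\<And>ks. ks \<in> tuples H s \<Longrightarrow> f (Mbar_class H ks) = F ks"
proof -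
  interpret K: comm_group K by (rule K)
  obtain h where h: "h \<in> hom (ZH H s) K" "\<And>ks. ks \<in> tuples H s \<Longrightarrow> h (frag_of ks) = F ks"
    using K.free_Abelian_group_universal[of F "tuples H s"] F by blast
  have 0: "h (shuffle_elem l ks) = \<one>\<^bsub>K\<^esub>" if "1 \<le> l" "l < s" and ks: "ks \<in> tuples H s" for l ks
  proof -
    have perm: "permute_list (inv_into UNIV \<sigma>) ks \<in> tuples H s" if "\<sigma> \<in> shuffle_perms l s" for \<sigma>
      using ks that by (blast intro: permute_list_tuples dest: shuffle_perms_permutes)
    have "h (shuffle_elem l ks) = finprod K
        (\<lambda>\<sigma>. h (frag_of (permute_list (inv_into UNIV \<sigma>) ks)) [^]\<^bsub>K\<^esub> sign \<sigma>) (shuffle_perms l s)"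
      unfolding shuffle_elem_def tuplesD(1)[OF ks]
      by (rule hom_sum_frag_cmul[OF K h(1) finite_shuffle_perms perm])
    also have "\<dots> = finprod K
        (\<lambda>\<sigma>. F (permute_list (inv_into UNIV \<sigma>) ks) [^]\<^bsub>K\<^esub> sign \<sigma>) (shuffle_perms l s)"
      by (rule K.finprod_cong') (use perm in \<open>auto simp: h F\<close>)
    finally show ?thesis using shuffle that by simp
  qed
  obtain g where g: "g \<in> hom (Mbar H s) K"
      "\<And>x. x \<in> carrier (ZH H s) \<Longrightarrow> g (shuffle_subgroup H s #>\<^bsub>ZH H s\<^esub> x) = h x"
  proof (rule hom_Mod_generate[OF abelian_free_Abelian_group K.is_group h(1) shuffle_generators_subset])
    show "h r = \<one>\<^bsub>K\<^esub>" if "r \<in> {shuffle_elem l hs |l hs. 1 \<le> l \<and> l < s \<and> hs \<in> tuples H s}" for r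
      using that 0 by blast
  qed (simp add: that Mbar_def shuffle_subgroup_def)
  show ?thesis
    by (rule that[OF g(1)]) (auto simp: Mbar_class_def tuplesD(1) g h)
qed

section \<open>Cochains and their values on tuples\<close>

lemma cval_tuples:
  assumes "hs \<in> tuples H r" "ks \<in> tuples H s"
  shows "cval H I f hs ks = f (pure_tensor (ZH H r) (Mbar H s) (frag_of hs) (Mbar_class H ks))"
  using assms by (auto simp: cval_def tuples_def)

lemma pure_tensor_tuples_closed:
  assumes "hs \<in> tuples H r" "ks \<in> tuples H s"
  shows "pure_tensor (ZH H r) (Mbar H s) (frag_of hs) (Mbar_class H ks) \<in> carrier (tensor (ZH H r) (Mbar H s))"
  by (rule pure_tensor_closed) (use assms in \<open>simp_all add: Mbar_group Mbar_class_closed\<close>)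

text \<open>Equality is reduced one factor at a time. With \<open>b\<close> fixed, both sides are
  homomorphisms in the left factor, so free generators suffice there; with the left factor a
  generator, both sides are homomorphisms in \<open>b\<close>, so classes of tuples suffice.\<close>

lemma cochain_eqI:
  assumes I: "group I" and f: "f \<in> carrier (cochain_group H I r s)" and g: "g \<in> carrier (cochain_group H I r s)"
    and eq: "\<And>hs ks. \<lbrakk>hs \<in> tuples H r; ks \<in> tuples H s\<rbrakk> \<Longrightarrow> cval H I f hs ks = cval H I g hs ks"
  shows "f = g"
proof -
  let ?T = "tensor (ZH H r) (Mbar H s)"
  have fh: "f \<in> hom ?T I" "g \<in> hom ?T I" and ext: "f \<in> extensional (carrier ?T)" "g \<in> extensional (carrier ?T)"
    using f g by (auto simp: cochain_group_def Hom_group_def)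
  have "f (pure_tensor (ZH H r) (Mbar H s) a b) = g (pure_tensor (ZH H r) (Mbar H s) a b)"
    if a: "a \<in> carrier (ZH H r)" and b: "b \<in> carrier (Mbar H s)" for a b
  proof -
    have L: "(\<lambda>a. u (pure_tensor (ZH H r) (Mbar H s) a b)) \<in> hom (ZH H r) I" if "u \<in> hom ?T I" for u
      using that b
      by (intro homI)
        (simp_all add: pure_tensor_add_left Mbar_group hom_mult[OF that] pure_tensor_closed
          hom_in_carrier[OF that] del: carrier_free_Abelian_group_iff mult_free_Abelian_group)
    have R: "(\<lambda>b. u (pure_tensor (ZH H r) (Mbar H s) (frag_of hs) b)) \<in> hom (Mbar H s) I"
      if "u \<in> hom ?T I" "hs \<in> tuples H r" for u hs
      using that by (intro homI)
        (simp_all add: pure_tensor_add_right Mbar_group hom_mult[OF that(1)] pure_tensor_closed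
          hom_in_carrier[OF that(1)])
    show ?thesis
    proof (rule hom_free_Abelian_group_eqI[OF I L[OF fh(1)] L[OF fh(2)] _ a])
      show "f (pure_tensor (ZH H r) (Mbar H s) (frag_of hs) b) =
          g (pure_tensor (ZH H r) (Mbar H s) (frag_of hs) b)" if hs: "hs \<in> tuples H r" for hs
        by (rule Mbar_hom_eqI[OF I R[OF fh(1) hs] R[OF fh(2) hs] _ b])
          (use eq[OF hs] in \<open>simp add: cval_tuples[OF hs]\<close>)
    qed
  qed
  then have "f x = g x" if "x \<in> carrier ?T" for x
    using tensor_hom_eqI[OF _ Mbar_group I fh _ that] by simp
  then show ?thesis using ext by (rule extensionalityI[rotated 2])
qed

text \<open>The prescribed values are extended in two stages: for each tuple \<open>hs\<close> to a
  homomorphism \<open>u hs\<close> on \<open>Mbar H s\<close>, then for each element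
  \<open>b\<close> of \<open>Mbar H s\<close> to a homomorphism \<open>e b\<close> on the free
  group. The result is biadditive, hence factors through the tensor product.\<close>

lemma cochain_exists:
  assumes I: "comm_group I"
    and F: "\<And>hs ks. \<lbrakk>hs \<in> tuples H r; ks \<in> tuples H s\<rbrakk> \<Longrightarrow> F hs ks \<in> carrier I"
    and shuffle: "\<And>l hs ks. \<lbrakk>hs \<in> tuples H r; 1 \<le> l; l < s; ks \<in> tuples H s\<rbrakk> \<Longrightarrow>
      finprod I (\<lambda>\<sigma>. F hs (permute_list (inv_into UNIV \<sigma>) ks) [^]\<^bsub>I\<^esub> sign \<sigma>) (shuffle_perms l s) = \<one>\<^bsub>I\<^esub>"
  shows "\<exists>f\<in>carrier (cochain_group H I r s). \<forall>hs\<in>tuples H r. \<forall>ks\<in>tuples H s. cval H I f hs ks = F hs ks"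
proof -
  interpret I: comm_group I by (rule I)
  let ?T = "tensor (ZH H r) (Mbar H s)"
  have "\<exists>f. f \<in> hom (Mbar H s) I \<and> (\<forall>ks\<in>tuples H s. f (Mbar_class H ks) = F hs ks)"
    if "hs \<in> tuples H r" for hs
    by (rule Mbar_hom_exists[OF I, of H s "F hs"]) (use that F shuffle in auto)
  then obtain u where u: "\<And>hs. hs \<in> tuples H r \<Longrightarrow> u hs \<in> hom (Mbar H s) I"
      "\<And>hs ks. \<lbrakk>hs \<in> tuples H r; ks \<in> tuples H s\<rbrakk> \<Longrightarrow> u hs (Mbar_class H ks) = F hs ks"
    by metis
  have uc: "u hs b \<in> carrier I" if "hs \<in> tuples H r" "b \<in> carrier (Mbar H s)" for hs b
    using hom_in_carrier[OF u(1)] that by blast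
  have "\<exists>e. e \<in> hom (ZH H r) I \<and> (\<forall>hs\<in>tuples H r. e (frag_of hs) = u hs b)"
    if "b \<in> carrier (Mbar H s)" for b
    by (rule I.free_Abelian_group_universal[of "\<lambda>hs. u hs b" "tuples H r"]) (use uc that in auto)
  then obtain e where e: "\<And>b. b \<in> carrier (Mbar H s) \<Longrightarrow> e b \<in> hom (ZH H r) I"
      "\<And>b hs. \<lbrakk>b \<in> carrier (Mbar H s); hs \<in> tuples H r\<rbrakk> \<Longrightarrow> e b (frag_of hs) = u hs b"
    by metis
  interpret M: group "Mbar H s" by (rule Mbar_group)
  have ec: "e b a \<in> carrier I" if "a \<in> carrier (ZH H r)" "b \<in> carrier (Mbar H s)" for a b
    using hom_in_carrier[OF e(1)] that by blast
  \<comment> \<open>Additivity in \<open>b\<close> is not built into the choice of \<open>e\<close>.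
    It follows by uniqueness: both sides are homomorphisms in \<open>a\<close>, and on generators
    they agree because \<open>u hs\<close> is additive.\<close>
  have R: "(\<lambda>b. e b a) \<in> hom (Mbar H s) I" if a: "a \<in> carrier (ZH H r)" for a
  proof (rule homI)
    fix b b' assume b: "b \<in> carrier (Mbar H s)" "b' \<in> carrier (Mbar H s)"
    have prod: "(\<lambda>a. e b a \<otimes>\<^bsub>I\<^esub> e b' a) \<in> hom (ZH H r) I"
      using b ec by (intro homI)
        (simp_all add: hom_mult[OF e(1)] I.m_ac del: carrier_free_Abelian_group_iff mult_free_Abelian_group)
    show "e (b \<otimes>\<^bsub>Mbar H s\<^esub> b') a = e b a \<otimes>\<^bsub>I\<^esub> e b' a"
      by (rule hom_free_Abelian_group_eqI[OF I.is_group e(1)[OF M.m_closed[OF b]] prod _ a])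
        (use b in \<open>simp_all add: e(2) hom_mult[OF u(1)]\<close>)
  qed (use ec a in simp)
  obtain g where g: "g \<in> hom ?T I" "\<And>a b. a \<in> carrier (ZH H r) \<Longrightarrow> b \<in> carrier (Mbar H s) \<Longrightarrow>
      g (pure_tensor (ZH H r) (Mbar H s) a b) = e b a"
    using tensor_hom_exists[OF _ Mbar_group I, of "ZH H r" H s "\<lambda>a b. e b a"] e(1) R by auto
  interpret T: group ?T
    unfolding tensor_def
    by (intro normal.factorgroup_is_group tensor_subgroup_normal Mbar_group) simp
  let ?f = "restrict g (carrier ?T)"
  have f: "?f \<in> carrier (cochain_group H I r s)"
    using g(1) by (auto simp: cochain_group_def Hom_group_def hom_def)
  show ?thesis
  proof (intro bexI[OF _ f] ballI)
    fix hs ks assume "hs \<in> tuples H r" "ks \<in> tuples H s"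
    then show "cval H I ?f hs ks = F hs ks"
      by (simp add: cval_tuples pure_tensor_tuples_closed g Mbar_class_closed e u)
  qed
qed

lemma cochain_one_closed: "group I \<Longrightarrow> \<one>\<^bsub>cochain_group H I r s\<^esub> \<in> carrier (cochain_group H I r s)"
proof -
  assume "group I"
  interpret I: group I by fact
  interpret T: group "tensor (ZH H r) (Mbar H s)"
    unfolding tensor_def
    by (intro normal.factorgroup_is_group tensor_subgroup_normal Mbar_group) simp
  show ?thesis by (auto simp: cochain_group_def Hom_group_def hom_def)
qed

lemma cochain_mult_closed:
  assumes "comm_group I" "f \<in> carrier (cochain_group H I r s)" "g \<in> carrier (cochain_group H I r s)"
  shows "f \<otimes>\<^bsub>cochain_group H I r s\<^esub> g \<in> carrier (cochain_group H I r s)"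
proof -
  interpret I: comm_group I by fact
  interpret T: group "tensor (ZH H r) (Mbar H s)"
    unfolding tensor_def
    by (intro normal.factorgroup_is_group tensor_subgroup_normal Mbar_group) simp
  show ?thesis
    using assms(2,3) by (auto simp: cochain_group_def Hom_group_def hom_def Pi_iff I.m_ac)
qed

lemma cval_one:
  assumes "hs \<in> tuples H r" "ks \<in> tuples H s"
  shows "cval H I \<one>\<^bsub>cochain_group H I r s\<^esub> hs ks = \<one>\<^bsub>I\<^esub>"
  using assms by (simp add: cval_tuples pure_tensor_tuples_closed cochain_group_def Hom_group_def)

lemma cval_mult:
  assumes "hs \<in> tuples H r" "ks \<in> tuples H s"
  shows "cval H I (f \<otimes>\<^bsub>cochain_group H I r s\<^esub> g) hs ks = cval H I f hs ks \<otimes>\<^bsub>I\<^esub> cval H I g hs ks"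
  using assms by (simp add: cval_tuples pure_tensor_tuples_closed cochain_group_def Hom_group_def)

text \<open>Entries may be zero here. This matters because the coboundary formulas evaluate cochains
  at sums of nonzero elements, which can vanish.\<close>

lemma cval_closed:
  assumes "group I" "f \<in> carrier (cochain_group H I r s)"
    "length hs = r" "length ks = s" "set hs \<subseteq> carrier H" "set ks \<subseteq> carrier H"
  shows "cval H I f hs ks \<in> carrier I"
proof (cases "\<one>\<^bsub>H\<^esub> \<in> set hs \<union> set ks")
  case True
  then show ?thesis using assms(1) by (simp add: cval_def group.is_monoid monoid.one_closed)
next
  case False
  then have "hs \<in> tuples H r" "ks \<in> tuples H s" using assms by (auto simp: tuples_def)
  then show ?thesis
    using assms(2) by (auto simp: cval_tuples cochain_group_def Hom_group_def
        intro!: hom_in_carrier[of f "tensor (ZH H r) (Mbar H s)" I] pure_tensor_tuples_closed)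
qed

section \<open>Shuffles of degree two and three\<close>

lemma permutes_lessThan_eqI:
  assumes "\<sigma> permutes {..<n}" "\<tau> permutes {..<n}" "\<And>i. i < n \<Longrightarrow> \<sigma> i = \<tau> i"
  shows "\<sigma> = \<tau>"
  using assms by (metis ext lessThan_iff permutes_not_in)

text \<open>Both blocks have a single element, so monotonicity is no restriction and every
  permutation of two letters is a shuffle.\<close>

lemma shuffle_perms_1_2: "shuffle_perms 1 2 = {id, Transposition.transpose 0 1}"
proof (intro equalityI subsetI)
  fix \<sigma> assume "\<sigma> \<in> shuffle_perms 1 2"
  then have p: "\<sigma> permutes {..<2}" by (simp add: shuffle_perms_def)
  then have inj: "\<sigma> 0 \<noteq> \<sigma> 1" and lt: "\<sigma> 0 < 2" "\<sigma> 1 < 2"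
    using permutes_inj[OF p] permutes_in_image[OF p] by (auto dest: injD)
  have q: "Transposition.transpose 0 1 permutes {..<2::nat}" by (intro permutes_swap_id) auto
  consider "\<sigma> 0 = 0 \<and> \<sigma> 1 = 1" | "\<sigma> 0 = 1 \<and> \<sigma> 1 = 0" using inj lt by linarith
  then show "\<sigma> \<in> {id, Transposition.transpose 0 1}"
  proof cases
    case 1
    then have "\<sigma> = id"
      by (intro permutes_lessThan_eqI[OF p permutes_id]) (auto simp: less_Suc_eq numeral_eq_Suc)
    then show ?thesis by simp
  next
    case 2
    then have "\<sigma> = Transposition.transpose 0 1"
      by (intro permutes_lessThan_eqI[OF p q])
        (auto simp: less_Suc_eq numeral_eq_Suc Transposition.transpose_def)
    then show ?thesis by simp
  qed
next
  fix \<sigma> :: "nat \<Rightarrow> nat" assume "\<sigma> \<in> {id, Transposition.transpose 0 1}"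
  then show "\<sigma> \<in> shuffle_perms 1 2"
    by (auto simp: shuffle_perms_def strict_mono_on_def intro!: permutes_swap_id permutes_id)
qed

lemma permutes_lessThan_3:
  assumes p: "\<sigma> permutes {..<3}"
  shows "\<sigma> 0 < 3 \<and> \<sigma> 1 < 3 \<and> \<sigma> 2 < 3 \<and> \<sigma> 0 \<noteq> \<sigma> 1 \<and> \<sigma> 0 \<noteq> \<sigma> 2 \<and> \<sigma> 1 \<noteq> \<sigma> (2::nat)"
proof -
  have "\<sigma> i = \<sigma> j \<longleftrightarrow> i = j" for i j using permutes_inj[OF p] by (auto dest: injD)
  moreover have "\<sigma> i < 3 \<longleftrightarrow> i < 3" for i using permutes_in_image[OF p] by auto
  ultimately show ?thesis by simp
qed

lemma permutes_lessThan_3_eqI: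
  assumes "\<sigma> permutes {..<3}" "\<tau> permutes {..<3}" "\<sigma> 0 = \<tau> 0" "\<sigma> 1 = \<tau> 1" "\<sigma> 2 = \<tau> (2::nat)"
  shows "\<sigma> = \<tau>"
proof (rule permutes_lessThan_eqI[OF assms(1,2)])
  fix i :: nat assume "i < 3"
  then have "i = 0 \<or> i = 1 \<or> i = 2" by linarith
  then show "\<sigma> i = \<tau> i" using assms by auto
qed

text \<open>On three letters one block is a singleton, so a single inequality on the other block
  decides membership.\<close>

lemma shuffle_permsI_3:
  assumes "\<sigma> permutes {..<3}"
  shows "\<sigma> 1 < \<sigma> 2 \<Longrightarrow> \<sigma> \<in> shuffle_perms 1 3" "\<sigma> 0 < \<sigma> 1 \<Longrightarrow> \<sigma> \<in> shuffle_perms 2 3"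
proof -
  have lt: "i < 3 \<Longrightarrow> i = 0 \<or> i = 1 \<or> i = 2" for i :: nat by linarith
  show "\<sigma> \<in> shuffle_perms 1 3" if "\<sigma> 1 < \<sigma> 2"
    using assms that by (auto simp: shuffle_perms_def strict_mono_on_def dest!: lt)
  show "\<sigma> \<in> shuffle_perms 2 3" if "\<sigma> 0 < \<sigma> 1"
    using assms that by (auto simp: shuffle_perms_def strict_mono_on_def numeral_2_eq_2 less_Suc_eq)
qed

lemma shuffle_permsD_3:
  "\<sigma> \<in> shuffle_perms 1 3 \<Longrightarrow> \<sigma> 1 < \<sigma> 2" "\<sigma> \<in> shuffle_perms 2 3 \<Longrightarrow> \<sigma> 0 < \<sigma> 1"
  by (auto simp: shuffle_perms_def strict_mono_on_def)

text \<open>The two three-cycles are written as products of transpositions so that sign and inverse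
  can be computed from the factors. The points 0, 1, 2 go to 2, 0, 1 under \<open>cyc3\<close> and
  to 1, 2, 0 under \<open>cyc3'\<close>.\<close>

abbreviation "cyc3 \<equiv> Transposition.transpose 0 (1::nat) \<circ> Transposition.transpose 0 2"
abbreviation "cyc3' \<equiv> Transposition.transpose 0 (1::nat) \<circ> Transposition.transpose 1 2"

lemma perms_3:
  "Transposition.transpose 0 1 permutes {..<3::nat}" "Transposition.transpose 1 2 permutes {..<3::nat}"
  "cyc3 permutes {..<3}" "cyc3' permutes {..<3}"
  by (auto intro!: permutes_compose permutes_swap_id)

lemma shuffle_perms_1_3: "shuffle_perms 1 3 = {id, Transposition.transpose 0 1, cyc3}"
proof (intro equalityI subsetI)
  fix \<sigma> assume s: "\<sigma> \<in> shuffle_perms 1 3"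
  have p: "\<sigma> permutes {..<3}" by (rule shuffle_perms_permutes[OF s])
  consider "\<sigma> 0 = 0 \<and> \<sigma> 1 = 1 \<and> \<sigma> 2 = 2" | "\<sigma> 0 = 1 \<and> \<sigma> 1 = 0 \<and> \<sigma> 2 = 2" | "\<sigma> 0 = 2 \<and> \<sigma> 1 = 0 \<and> \<sigma> 2 = 1"
    using permutes_lessThan_3[OF p] shuffle_permsD_3(1)[OF s] by (auto simp: numeral_eq_Suc less_Suc_eq)
  then have "\<sigma> = id \<or> \<sigma> = Transposition.transpose 0 1 \<or> \<sigma> = cyc3"
    by cases (use permutes_lessThan_3_eqI[OF p] perms_3 in \<open>simp_all add: Transposition.transpose_def\<close>)
  then show "\<sigma> \<in> {id, Transposition.transpose 0 1, cyc3}" by simp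
next
  fix \<sigma> :: "nat \<Rightarrow> nat" assume "\<sigma> \<in> {id, Transposition.transpose 0 1, cyc3}"
  then show "\<sigma> \<in> shuffle_perms 1 3"
    by (elim insertE emptyE; hypsubst)
      (rule shuffle_permsI_3(1), use perms_3 permutes_id in blast, simp add: Transposition.transpose_def)+
qed

lemma shuffle_perms_2_3: "shuffle_perms 2 3 = {id, Transposition.transpose 1 2, cyc3'}"
proof (intro equalityI subsetI)
  fix \<sigma> assume s: "\<sigma> \<in> shuffle_perms 2 3"
  have p: "\<sigma> permutes {..<3}" by (rule shuffle_perms_permutes[OF s])
  consider "\<sigma> 0 = 0 \<and> \<sigma> 1 = 1 \<and> \<sigma> 2 = 2" | "\<sigma> 0 = 0 \<and> \<sigma> 1 = 2 \<and> \<sigma> 2 = 1" | "\<sigma> 0 = 1 \<and> \<sigma> 1 = 2 \<and> \<sigma> 2 = 0"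
    using permutes_lessThan_3[OF p] shuffle_permsD_3(2)[OF s] by (auto simp: numeral_eq_Suc less_Suc_eq)
  then have "\<sigma> = id \<or> \<sigma> = Transposition.transpose 1 2 \<or> \<sigma> = cyc3'"
    by cases (use permutes_lessThan_3_eqI[OF p] perms_3 in \<open>simp_all add: Transposition.transpose_def\<close>)
  then show "\<sigma> \<in> {id, Transposition.transpose 1 2, cyc3'}" by simp
next
  fix \<sigma> :: "nat \<Rightarrow> nat" assume "\<sigma> \<in> {id, Transposition.transpose 1 2, cyc3'}"
  then show "\<sigma> \<in> shuffle_perms 2 3"
    by (elim insertE emptyE; hypsubst)
      (rule shuffle_permsI_3(2), use perms_3 permutes_id in blast, simp add: Transposition.transpose_def)+
qed

lemma inv_into_shuffles:
  "inv_into UNIV (Transposition.transpose a b) = Transposition.transpose a b"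
  "inv_into UNIV cyc3 = Transposition.transpose 0 2 \<circ> Transposition.transpose 0 (1::nat)"
  "inv_into UNIV cyc3' = Transposition.transpose 1 2 \<circ> Transposition.transpose 0 (1::nat)"
  by (simp_all add: o_inv_distrib)

lemma permute_list_shuffles:
  "permute_list (inv_into UNIV id) xs = xs"
  "permute_list (inv_into UNIV (Transposition.transpose 0 1)) [a, b] = [b, a]"
  "permute_list (inv_into UNIV (Transposition.transpose 0 1)) [a, b, c] = [b, a, c]"
  "permute_list (inv_into UNIV (Transposition.transpose 1 2)) [a, b, c] = [a, c, b]"
  "permute_list (inv_into UNIV cyc3) [a, b, c] = [b, c, a]"
  "permute_list (inv_into UNIV cyc3') [a, b, c] = [c, a, b]"
  by (simp add: inv_id, simp_all only: inv_into_shuffles permute_list_def)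
    (simp_all add: Transposition.transpose_def upt_conv_Cons)

lemma sign_shuffles:
  "sign (Transposition.transpose 0 (1::nat)) = -1" "sign (Transposition.transpose 1 (2::nat)) = -1"
  "sign cyc3 = 1" "sign cyc3' = 1"
  by (simp_all add: sign_swap_id sign_compose permutation_swap_id)

lemma distinct_shuffles:
  "id \<noteq> Transposition.transpose 0 (1::nat)" "id \<noteq> Transposition.transpose 1 (2::nat)"
  "id \<noteq> cyc3" "id \<noteq> cyc3'" "Transposition.transpose 0 1 \<noteq> cyc3" "Transposition.transpose 1 2 \<noteq> cyc3'"
proof -
  have neqI: "f \<noteq> g" if "f x \<noteq> g x" for f g :: "nat \<Rightarrow> nat" and x using that by auto
  show "id \<noteq> Transposition.transpose 1 (2::nat)"
    by (rule neqI[where x = 1]) (simp add: Transposition.transpose_def)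
qed (rule notI, drule fun_cong[where x = 0], simp add: Transposition.transpose_def)+

section \<open>Alternating shuffle sums in an abelian group\<close>

context comm_group
begin

lemma mult_inv_eq_one_iff: "\<lbrakk>x \<in> carrier G; y \<in> carrier G\<rbrakk> \<Longrightarrow> x \<otimes> inv y = \<one> \<longleftrightarrow> x = y"
  by (metis inv_closed inv_equality inv_inv r_inv)

lemma finprod_three:
  assumes "i \<noteq> j" "i \<noteq> k" "j \<noteq> k" "f i \<in> carrier G" "f j \<in> carrier G" "f k \<in> carrier G"
  shows "finprod G f {i, j, k} = f i \<otimes> (f j \<otimes> f k)"
  using assms by (simp add: finprod_insert)

lemma finprod_two:
  assumes "i \<noteq> j" "f i \<in> carrier G" "f j \<in> carrier G"
  shows "finprod G f {i, j} = f i \<otimes> f j"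
  using assms by (simp add: finprod_insert)

lemma int_pow_minus_one: "x \<in> carrier G \<Longrightarrow> x [^] (-1::int) = inv x"
  using int_pow_neg[of x 1] by simp

lemma finprod_shuffle_perms_1_2:
  assumes "F [a, b] \<in> carrier G" "F [b, a] \<in> carrier G"
  shows "finprod G (\<lambda>\<sigma>. F (permute_list (inv_into UNIV \<sigma>) [a, b]) [^] sign \<sigma>) (shuffle_perms 1 2) =
    F [a, b] \<otimes> inv (F [b, a])"
  unfolding shuffle_perms_1_2
  by (subst finprod_two)
    (use assms in \<open>simp_all only: distinct_shuffles permute_list_shuffles sign_shuffles sign_id
        inv_closed int_pow_closed int_pow_1 int_pow_minus_one not_False_eq_True\<close>)

lemma finprod_shuffle_perms_1_3:
  assumes "F [a, b, c] \<in> carrier G" "F [b, a, c] \<in> carrier G" "F [b, c, a] \<in> carrier G"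
  shows "finprod G (\<lambda>\<sigma>. F (permute_list (inv_into UNIV \<sigma>) [a, b, c]) [^] sign \<sigma>) (shuffle_perms 1 3) =
    F [a, b, c] \<otimes> (inv (F [b, a, c]) \<otimes> F [b, c, a])"
  unfolding shuffle_perms_1_3
  by (subst finprod_three)
    (use assms in \<open>simp_all only: distinct_shuffles permute_list_shuffles sign_shuffles sign_id
        inv_closed int_pow_closed int_pow_1 int_pow_minus_one not_False_eq_True\<close>)

lemma finprod_shuffle_perms_2_3:
  assumes "F [a, b, c] \<in> carrier G" "F [a, c, b] \<in> carrier G" "F [c, a, b] \<in> carrier G"
  shows "finprod G (\<lambda>\<sigma>. F (permute_list (inv_into UNIV \<sigma>) [a, b, c]) [^] sign \<sigma>) (shuffle_perms 2 3) =
    F [a, b, c] \<otimes> (inv (F [a, c, b]) \<otimes> F [c, a, b])"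
  unfolding shuffle_perms_2_3
  by (subst finprod_three)
    (use assms in \<open>simp_all only: distinct_shuffles permute_list_shuffles sign_shuffles sign_id
        inv_closed int_pow_closed int_pow_1 int_pow_minus_one not_False_eq_True\<close>)

end

section \<open>Linear cycle sets and the coboundary maps\<close>

context linear_cycle_set
begin

lemma dot_closed [simp]: "\<lbrakk>a \<in> carrier A; b \<in> carrier A\<rbrakk> \<Longrightarrow> a \<cdot> b \<in> carrier A"
  using dot_bij by (blast dest: bij_betwE)

lemma dot_cancel: "\<lbrakk>a \<in> carrier A; b \<in> carrier A; c \<in> carrier A\<rbrakk> \<Longrightarrow> a \<cdot> b = a \<cdot> c \<longleftrightarrow> b = c"
  using dot_bij[of a] by (auto simp: bij_betw_def dest: inj_onD)

lemma dot_one [simp]: "a \<in> carrier A \<Longrightarrow> a \<cdot> \<one> = \<one>"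
  using dot_distrib[of a \<one> \<one>] by simp

lemma one_dot [simp]: "a \<in> carrier A \<Longrightarrow> \<one> \<cdot> a = a"
  \<comment> \<open>The cycle law at 0 + 0 gives 0 \<cdot> a = 0 \<cdot> (0 \<cdot> a), and left
    translation by 0 is injective.\<close>
  using dot_cycle[of \<one> \<one> a] dot_cancel[of \<one> "\<one> \<cdot> a" a] by simp

lemma dot_eq_one_iff [simp]: "\<lbrakk>a \<in> carrier A; b \<in> carrier A\<rbrakk> \<Longrightarrow> a \<cdot> b = \<one> \<longleftrightarrow> b = \<one>"
  using dot_cancel[of a b \<one>] by simp

end

lemma tuples_0 [simp]: "tuples H 0 = {[]}"
  by (auto simp: tuples_def)

lemma tuples_Suc: "hs \<in> tuples H (Suc n) \<longleftrightarrow>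
    (\<exists>h hs'. hs = h # hs' \<and> h \<in> carrier H \<and> h \<noteq> \<one>\<^bsub>H\<^esub> \<and> hs' \<in> tuples H n)"
  by (cases hs) (auto simp: tuples_def)

lemma cochain_group_group:
  assumes "comm_group I"
  shows "group (cochain_group H I r s)"
proof (rule groupI)
  interpret I: comm_group I by fact
  interpret T: group "tensor (ZH H r) (Mbar H s)"
    unfolding tensor_def
    by (intro normal.factorgroup_is_group tensor_subgroup_normal Mbar_group) simp
  let ?C = "cochain_group H I r s"
  show "\<one>\<^bsub>?C\<^esub> \<in> carrier ?C" by (rule cochain_one_closed[OF I.is_group])
  show mult: "f \<otimes>\<^bsub>?C\<^esub> g \<in> carrier ?C" if "f \<in> carrier ?C" "g \<in> carrier ?C" for f g
    using that by (rule cochain_mult_closed[OF assms])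
  have clo: "cval H I f hs ks \<in> carrier I"
    if "f \<in> carrier ?C" "hs \<in> tuples H r" "ks \<in> tuples H s" for f hs ks
    using that by (intro cval_closed[OF I.is_group that(1)]) (auto dest: tuplesD)
  show "(f \<otimes>\<^bsub>?C\<^esub> g) \<otimes>\<^bsub>?C\<^esub> h = f \<otimes>\<^bsub>?C\<^esub> (g \<otimes>\<^bsub>?C\<^esub> h)"
    if "f \<in> carrier ?C" "g \<in> carrier ?C" "h \<in> carrier ?C" for f g h
    by (rule cochain_eqI[OF I.is_group, where H = H and r = r and s = s]) (use that in \<open>simp_all add: mult cval_mult I.m_assoc clo\<close>)
  show "\<one>\<^bsub>?C\<^esub> \<otimes>\<^bsub>?C\<^esub> f = f" if "f \<in> carrier ?C" for f
    by (rule cochain_eqI[OF I.is_group, where H = H and r = r and s = s])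
      (use that in \<open>simp_all add: mult cochain_one_closed cval_mult cval_one clo\<close>)
  show "\<exists>g\<in>carrier ?C. g \<otimes>\<^bsub>?C\<^esub> f = \<one>\<^bsub>?C\<^esub>" if f: "f \<in> carrier ?C" for f
  proof
    let ?g = "\<lambda>x\<in>carrier (tensor (ZH H r) (Mbar H s)). inv\<^bsub>I\<^esub> f x"
    show g: "?g \<in> carrier ?C"
      using f by (auto simp: cochain_group_def Hom_group_def hom_def Pi_iff I.inv_mult)
    show "?g \<otimes>\<^bsub>?C\<^esub> f = \<one>\<^bsub>?C\<^esub>"
    proof (rule cochain_eqI[OF I.is_group, where H = H and r = r and s = s])
      fix hs ks assume hk: "hs \<in> tuples H r" "ks \<in> tuples H s"
      then have "cval H I ?g hs ks = inv\<^bsub>I\<^esub> cval H I f hs ks"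
        by (simp add: cval_tuples pure_tensor_tuples_closed)
      then show "cval H I (?g \<otimes>\<^bsub>?C\<^esub> f) hs ks = cval H I \<one>\<^bsub>?C\<^esub> hs ks"
        using hk f by (simp add: cval_mult cval_one clo)
    qed (fact mult[OF g f] cochain_one_closed[OF I.is_group])+
  qed
qed

lemma no_shuffles_1: "1 \<le> l \<Longrightarrow> l < (1::nat) \<Longrightarrow> P"
  by simp

text \<open>The only shuffle in weight two is (a, b) - (b, a), so vanishing on shuffles amounts to
  symmetry.\<close>

lemma (in comm_group) finprod_shuffle_perms_2_eq_one:
  assumes "1 \<le> l" "l < 2" "ks \<in> tuples H 2"
    and F: "\<And>a b. \<lbrakk>a \<in> carrier H - {\<one>\<^bsub>H\<^esub>}; b \<in> carrier H - {\<one>\<^bsub>H\<^esub>}\<rbrakk> \<Longrightarrow>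
      F [a, b] \<in> carrier G \<and> F [a, b] = F [b, a]"
  shows "finprod G (\<lambda>\<sigma>. F (permute_list (inv_into UNIV \<sigma>) ks) [^] sign \<sigma>) (shuffle_perms l 2) = \<one>"
proof -
  obtain a b where ks: "ks = [a, b]" "a \<in> carrier H - {\<one>\<^bsub>H\<^esub>}" "b \<in> carrier H - {\<one>\<^bsub>H\<^esub>}"
    using assms(3) by (auto simp: numeral_2_eq_2 tuples_Suc)
  have "l = 1" using assms by simp
  then show ?thesis
    using F[OF ks(2,3)] conjunct1[OF F[OF ks(3,2)]] unfolding ks(1)
    by (simp only: finprod_shuffle_perms_1_2 r_inv)
qed

text \<open>In weight three there are two shuffle sums, from \<open>l = 1\<close> and
  \<open>l = 2\<close>, each with two positive terms and one negative term. The negative term is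
  moved across so that the hypotheses contain no inverses.\<close>

lemma (in comm_group) finprod_shuffle_perms_3_eq_one:
  assumes "1 \<le> l" "l < 3" "ks \<in> tuples H 3"
    and F: "\<And>a b c. \<lbrakk>a \<in> carrier H - {\<one>\<^bsub>H\<^esub>}; b \<in> carrier H - {\<one>\<^bsub>H\<^esub>}; c \<in> carrier H - {\<one>\<^bsub>H\<^esub>}\<rbrakk> \<Longrightarrow>
      F [a, b, c] \<in> carrier G \<and> F [a, b, c] \<otimes> F [b, c, a] = F [b, a, c] \<and>
      F [a, b, c] \<otimes> F [c, a, b] = F [a, c, b]"
  shows "finprod G (\<lambda>\<sigma>. F (permute_list (inv_into UNIV \<sigma>) ks) [^] sign \<sigma>) (shuffle_perms l 3) = \<one>"
proof -
  obtain a b c where ks: "ks = [a, b, c]" "a \<in> carrier H - {\<one>\<^bsub>H\<^esub>}" "b \<in> carrier H - {\<one>\<^bsub>H\<^esub>}" "c \<in> carrier H - {\<one>\<^bsub>H\<^esub>}"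
    using assms(3) by (auto simp: numeral_3_eq_3 tuples_Suc)
  have *: "x \<otimes> (inv y \<otimes> z) = \<one>" if "x \<in> carrier G" "y \<in> carrier G" "z \<in> carrier G" "x \<otimes> z = y" for x y z
    using that m_lcomm[of x "inv y" z] by auto
  have clo: "F [x, y, z] \<in> carrier G" if "x \<in> {a, b, c}" "y \<in> {a, b, c}" "z \<in> {a, b, c}" for x y z
    using F[of x y z] ks that by auto
  have "l = 1 \<or> l = 2" using assms by linarith
  then show ?thesis
  proof
    assume "l = 1"
    then show ?thesis
      using F[OF ks(2-4)] clo unfolding ks(1) \<open>l = 1\<close>
      by (subst finprod_shuffle_perms_1_3) (auto intro!: *)
  next
    assume "l = 2"
    then show ?thesis
      using F[OF ks(2-4)] clo unfolding ks(1) \<open>l = 2\<close>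
      by (subst finprod_shuffle_perms_2_3) (auto intro!: *)
  qed
qed

lemma cval_zero: "\<one>\<^bsub>H\<^esub> \<in> set hs \<union> set ks \<Longrightarrow> cval H I f hs ks = \<one>\<^bsub>I\<^esub>"
  by (simp add: cval_def)

text \<open>Turns the definite descriptions defining \<open>dh\<close> and \<open>dv\<close> into
  usable facts: existence needs the formula to vanish on shuffles, uniqueness holds because values
  determine a cochain. Stating \<open>g\<close> through an equation lets the lemma be applied to
  either coboundary by unfolding its definition.\<close>

lemma cochain_THE_spec:
  fixes F :: "'h list \<Rightarrow> 'h list \<Rightarrow> 'i" and H :: "'h lcs" and I :: "'i lcs"
  assumes I: "comm_group I"
    and F: "\<And>hs ks. \<lbrakk>hs \<in> tuples H r; ks \<in> tuples H s\<rbrakk> \<Longrightarrow> F hs ks \<in> carrier I"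
    and shuffle: "\<And>l hs ks. \<lbrakk>hs \<in> tuples H r; 1 \<le> l; l < s; ks \<in> tuples H s\<rbrakk> \<Longrightarrow>
      finprod I (\<lambda>\<sigma>. F hs (permute_list (inv_into UNIV \<sigma>) ks) [^]\<^bsub>I\<^esub> sign \<sigma>) (shuffle_perms l s) = \<one>\<^bsub>I\<^esub>"
    and g: "g = (THE g. g \<in> carrier (cochain_group H I r s) \<and>
      (\<forall>hs\<in>tuples H r. \<forall>ks\<in>tuples H s. cval H I g hs ks = F hs ks))"
  shows "g \<in> carrier (cochain_group H I r s) \<and>
    (\<forall>hs\<in>tuples H r. \<forall>ks\<in>tuples H s. cval H I g hs ks = F hs ks)"
proof -
  have grp: "group I" by (rule comm_group.axioms(2)[OF I])
  obtain f where f: "f \<in> carrier (cochain_group H I r s)"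
    "\<forall>hs\<in>tuples H r. \<forall>ks\<in>tuples H s. cval H I f hs ks = F hs ks"
    using cochain_exists[OF I, of H r s F, OF F shuffle] by blast
  let ?P = "\<lambda>g. g \<in> carrier (cochain_group H I r s) \<and>
    (\<forall>hs\<in>tuples H r. \<forall>ks\<in>tuples H s. cval H I g hs ks = F hs ks)"
  have "?P (THE g. ?P g)"
  proof (rule theI[of ?P f])
    show "?P f" using f by blast
    show "u = f" if "?P u" for u
      using that f by (intro cochain_eqI[OF grp, of u H r s f]) simp_all
  qed
  then show ?thesis unfolding g .
qed

section \<open>Coboundaries leaving total degrees one and two\<close>

locale lcs_action = H: linear_cycle_set H + I: linear_cycle_set I
  for H :: "'h lcs" and I :: "'i lcs" +
  fixes dia :: "'h \<Rightarrow> 'i \<Rightarrow> 'i"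
  assumes I_trivial: "lcs_trivial I"
    and dia_funcset: "dia \<in> carrier H \<rightarrow> carrier I \<rightarrow> carrier I"
    and dia_lcs_mult: "\<lbrakk>h \<in> carrier H; h' \<in> carrier H; y \<in> carrier I\<rbrakk>
           \<Longrightarrow> dia (lcs_mult H h' h) y = dia h (dia h' y)"
    and dia_add: "\<lbrakk>h \<in> carrier H; y \<in> carrier I; y' \<in> carrier I\<rbrakk>
           \<Longrightarrow> dia h (y \<otimes>\<^bsub>I\<^esub> y') = dia h y \<otimes>\<^bsub>I\<^esub> dia h y'"
    and dia_zero: "y \<in> carrier I \<Longrightarrow> dia \<one>\<^bsub>H\<^esub> y = y"
begin

lemma dia_closed [simp]: "\<lbrakk>h \<in> carrier H; y \<in> carrier I\<rbrakk> \<Longrightarrow> dia h y \<in> carrier I"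
  using dia_funcset by blast

lemma dia_one [simp]: "h \<in> carrier H \<Longrightarrow> dia h \<one>\<^bsub>I\<^esub> = \<one>\<^bsub>I\<^esub>"
  using dia_add[of h "\<one>\<^bsub>I\<^esub>" "\<one>\<^bsub>I\<^esub>"] by simp

lemma dia_inv: "\<lbrakk>h \<in> carrier H; y \<in> carrier I\<rbrakk> \<Longrightarrow> dia h (inv\<^bsub>I\<^esub> y) = inv\<^bsub>I\<^esub> dia h y"
  using dia_add[of h "inv\<^bsub>I\<^esub> y" y] by (intro I.inv_equality[symmetric]) auto

text \<open>In \<open>H\<close> the product of a and a \<cdot> b is b + a, because acting by a
  undoes the dot by a. The action law for this product therefore becomes a statement about sums,
  which is the form used from here on.\<close>

lemma dia_dot:
  assumes "a \<in> carrier H" "b \<in> carrier H" "y \<in> carrier I"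
  shows "dia (a \<cdot>\<^bsub>H\<^esub> b) (dia a y) = dia (a \<otimes>\<^bsub>H\<^esub> b) y"
proof -
  have "lcs_act H a (a \<cdot>\<^bsub>H\<^esub> b) = b"
    unfolding lcs_act_def using assms H.dot_bij[of a]
    by (intro inv_into_f_f) (auto simp: bij_betw_def)
  then show ?thesis
    using dia_lcs_mult[of "a \<cdot>\<^bsub>H\<^esub> b" a y] assms by (simp add: lcs_mult_def H.m_comm)
qed

lemma cval_closed_01:
  assumes "f \<in> carrier (cochain_group H I 0 1)" "a \<in> carrier H"
  shows "cval H I f [] [a] \<in> carrier I"
  using assms by (intro cval_closed[OF I.is_group assms(1)]) auto

lemma cval_closed_02:
  assumes "f \<in> carrier (cochain_group H I 0 2)" "a \<in> carrier H" "b \<in> carrier H"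
  shows "cval H I f [] [a, b] \<in> carrier I"
  using assms by (intro cval_closed[OF I.is_group assms(1)]) auto

lemma cval_closed_11:
  assumes "f \<in> carrier (cochain_group H I 1 1)" "a \<in> carrier H" "b \<in> carrier H"
  shows "cval H I f [a] [b] \<in> carrier I"
  using assms by (intro cval_closed[OF I.is_group assms(1)]) auto

text \<open>The classes of (a, b) and (b, a) coincide in \<open>Mbar H 2\<close>, since their
  difference is the shuffle element for \<open>l = 1\<close>. If an entry is zero, both values are
  zero by convention.\<close>

lemma cval_commute_02:
  assumes f: "f \<in> carrier (cochain_group H I 0 2)" and ab: "a \<in> carrier H" "b \<in> carrier H"
  shows "cval H I f [] [a, b] = cval H I f [] [b, a]"
proof (cases "a = \<one>\<^bsub>H\<^esub> \<or> b = \<one>\<^bsub>H\<^esub>")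
  case True
  then show ?thesis by (auto simp: cval_def)
next
  case False
  then have t: "[a, b] \<in> tuples H 2" "[b, a] \<in> tuples H 2" using ab by (auto simp: tuples_def)
  have "shuffle_elem 1 [a, b] = frag_of [a, b] - frag_of [b, a]"
  proof -
    have "length [a, b] = 2" by simp
    then have "shuffle_elem 1 [a, b] = (\<Sum>\<sigma>\<in>{id, Transposition.transpose 0 1}.
        frag_cmul (sign \<sigma>) (frag_of (permute_list (inv_into UNIV \<sigma>) [a, b])))"
      unfolding shuffle_elem_def by (simp only: shuffle_perms_1_2)
    also have "\<dots> = frag_of [a, b] - frag_of [b, a]"
      by (subst sum.insert)
        (simp_all add: distinct_shuffles[simplified] permute_list_shuffles[simplified] sign_shuffles[simplified])
    finally show ?thesis .
  qed
  moreover have "shuffle_elem 1 [a, b] \<in> shuffle_subgroup H 2"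
    unfolding shuffle_subgroup_def using t by (intro generate.incl) force
  ultimately have "Mbar_class H [a, b] = Mbar_class H [b, a]"
    using t unfolding Mbar_class_def shuffle_subgroup_def tuplesD(1)[OF t(1)] tuplesD(1)[OF t(2)]
    by (intro generate_free_coset_eqI shuffle_generators_subset) simp_all
  then show ?thesis
    using t by (simp add: cval_tuples[of "[]" H 0 _ 2])
qed

lemma dv_formula_01:
  assumes "f \<in> carrier (cochain_group H I 0 1)" "a \<in> carrier H" "b \<in> carrier H"
  shows "dv_formula H I 0 1 f [] [a, b] = cval H I f [] [b] \<otimes>\<^bsub>I\<^esub>
    inv\<^bsub>I\<^esub> cval H I f [] [a \<otimes>\<^bsub>H\<^esub> b] \<otimes>\<^bsub>I\<^esub> cval H I f [] [a]"
  using assms by (simp add: dv_formula_def merge_at_def cval_closed_01[simplified] I.finprod_insert I.int_pow_minus_one)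

lemma dv_formula_02:
  assumes "f \<in> carrier (cochain_group H I 0 2)" "a \<in> carrier H" "b \<in> carrier H" "c \<in> carrier H"
  shows "dv_formula H I 0 2 f [] [a, b, c] = cval H I f [] [b, c] \<otimes>\<^bsub>I\<^esub>
    (inv\<^bsub>I\<^esub> cval H I f [] [a \<otimes>\<^bsub>H\<^esub> b, c] \<otimes>\<^bsub>I\<^esub> cval H I f [] [a, b \<otimes>\<^bsub>H\<^esub> c]) \<otimes>\<^bsub>I\<^esub>
    inv\<^bsub>I\<^esub> cval H I f [] [a, b]"
proof -
  have "{0 + 1..0 + 2} = {1, 2::nat}" by auto
  then show ?thesis
    using assms by (simp add: dv_formula_def merge_at_def cval_closed_02 I.finprod_two I.int_pow_minus_one)
qed

lemma dv_formula_11: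
  assumes "f \<in> carrier (cochain_group H I 1 1)" "a \<in> carrier H" "b \<in> carrier H" "c \<in> carrier H"
  shows "dv_formula H I 1 1 f [a] [b, c] = inv\<^bsub>I\<^esub> cval H I f [a] [c] \<otimes>\<^bsub>I\<^esub>
    cval H I f [a] [b \<otimes>\<^bsub>H\<^esub> c] \<otimes>\<^bsub>I\<^esub> inv\<^bsub>I\<^esub> cval H I f [a] [b]"
  using assms by (simp add: dv_formula_def merge_at_def cval_closed_11[simplified] I.finprod_insert
      I.int_pow_minus_one numeral_2_eq_2)

lemma dh_formula_01:
  assumes "f \<in> carrier (cochain_group H I 0 1)" "a \<in> carrier H" "b \<in> carrier H"
  shows "dh_formula H I dia 0 f [a] [b] = cval H I f [] [a \<cdot>\<^bsub>H\<^esub> b] \<otimes>\<^bsub>I\<^esub>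
    inv\<^bsub>I\<^esub> dia a (cval H I f [] [b])"
  using assms by (simp add: dh_formula_def R1_def cval_closed_01[simplified] I.int_pow_minus_one)

lemma dh_formula_02:
  assumes "f \<in> carrier (cochain_group H I 0 2)" "a \<in> carrier H" "b \<in> carrier H" "c \<in> carrier H"
  shows "dh_formula H I dia 0 f [a] [b, c] = cval H I f [] [a \<cdot>\<^bsub>H\<^esub> b, a \<cdot>\<^bsub>H\<^esub> c] \<otimes>\<^bsub>I\<^esub>
    inv\<^bsub>I\<^esub> dia a (cval H I f [] [b, c])"
  using assms by (simp add: dh_formula_def R1_def cval_closed_02 I.int_pow_minus_one)

lemma dh_formula_11:
  assumes "f \<in> carrier (cochain_group H I 1 1)" "a \<in> carrier H" "b \<in> carrier H" "c \<in> carrier H"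
  shows "dh_formula H I dia 1 f [a, b] [c] = cval H I f [a \<cdot>\<^bsub>H\<^esub> b] [a \<cdot>\<^bsub>H\<^esub> c] \<otimes>\<^bsub>I\<^esub>
    inv\<^bsub>I\<^esub> cval H I f [a \<otimes>\<^bsub>H\<^esub> b] [c] \<otimes>\<^bsub>I\<^esub> dia (a \<cdot>\<^bsub>H\<^esub> b) (cval H I f [a] [c])"
  using assms by (simp add: dh_formula_def R1_def merge_at_def cval_closed_11[simplified]
      I.finprod_insert I.int_pow_minus_one)

end

lemma tuples_1_2_3_iff:
  "ks \<in> tuples H 1 \<longleftrightarrow> (\<exists>a\<in>carrier H - {\<one>\<^bsub>H\<^esub>}. ks = [a])"
  "ks \<in> tuples H 2 \<longleftrightarrow> (\<exists>a\<in>carrier H - {\<one>\<^bsub>H\<^esub>}. \<exists>b\<in>carrier H - {\<one>\<^bsub>H\<^esub>}. ks = [a, b])"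
  "ks \<in> tuples H 3 \<longleftrightarrow> (\<exists>a\<in>carrier H - {\<one>\<^bsub>H\<^esub>}. \<exists>b\<in>carrier H - {\<one>\<^bsub>H\<^esub>}. \<exists>c\<in>carrier H - {\<one>\<^bsub>H\<^esub>}. ks = [a, b, c])"
  by (auto simp: numeral_2_eq_2 numeral_3_eq_3 tuples_Suc)

lemma nat_numeral_sums: "0 + 1 = (1::nat)" "1 + 1 = (2::nat)" "0 + 2 = (2::nat)" "2 + 1 = (3::nat)"
  by simp_all

context lcs_action
begin

text \<open>The formula is symmetric in its two entries, hence a cochain. The value statement covers
  zero entries too: there the left side is zero by convention and the right side cancels, as one
  summand of a + b is zero.\<close>

lemma dv_01:
  assumes f: "f \<in> carrier (cochain_group H I 0 1)"
  shows "dv H I 0 1 f \<in> carrier (cochain_group H I 0 2)"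
    and "\<lbrakk>a \<in> carrier H; b \<in> carrier H\<rbrakk> \<Longrightarrow> cval H I (dv H I 0 1 f) [] [a, b] =
      cval H I f [] [b] \<otimes>\<^bsub>I\<^esub> inv\<^bsub>I\<^esub> cval H I f [] [a \<otimes>\<^bsub>H\<^esub> b] \<otimes>\<^bsub>I\<^esub> cval H I f [] [a]"
proof -
  note f1 = dv_formula_01[OF f] cval_closed_01[OF f]
  have *: "dv H I 0 1 f \<in> carrier (cochain_group H I 0 2) \<and>
    (\<forall>hs\<in>tuples H 0. \<forall>ks\<in>tuples H 2. cval H I (dv H I 0 1 f) hs ks = dv_formula H I 0 1 f hs ks)"
  proof (rule cochain_THE_spec[OF I.comm_group_axioms])
    show "dv_formula H I 0 1 f hs ks \<in> carrier I" if "hs \<in> tuples H 0" "ks \<in> tuples H 2" for hs ks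
      using that by (auto simp: tuples_1_2_3_iff f1 simp del: One_nat_def)
    show "finprod I (\<lambda>\<sigma>. dv_formula H I 0 1 f hs (permute_list (inv_into UNIV \<sigma>) ks) [^]\<^bsub>I\<^esub> sign \<sigma>)
        (shuffle_perms l 2) = \<one>\<^bsub>I\<^esub>"
      if "hs \<in> tuples H 0" "1 \<le> l" "l < 2" "ks \<in> tuples H 2" for l hs ks
      by (rule I.finprod_shuffle_perms_2_eq_one[OF that(2-4)])
        (use that in \<open>auto simp: f1 H.m_comm I.m_ac simp del: One_nat_def\<close>)
    show "dv H I 0 1 f = (THE g. g \<in> carrier (cochain_group H I 0 2) \<and>
        (\<forall>hs\<in>tuples H 0. \<forall>ks\<in>tuples H 2. cval H I g hs ks = dv_formula H I 0 1 f hs ks))"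
      by (simp only: dv_def nat_numeral_sums)
  qed
  then show "dv H I 0 1 f \<in> carrier (cochain_group H I 0 2)" by blast
  assume ab: "a \<in> carrier H" "b \<in> carrier H"
  consider "a = \<one>\<^bsub>H\<^esub>" | "b = \<one>\<^bsub>H\<^esub>" | "[a, b] \<in> tuples H 2"
    using ab by (auto simp: tuples_1_2_3_iff)
  then show "cval H I (dv H I 0 1 f) [] [a, b] =
      cval H I f [] [b] \<otimes>\<^bsub>I\<^esub> inv\<^bsub>I\<^esub> cval H I f [] [a \<otimes>\<^bsub>H\<^esub> b] \<otimes>\<^bsub>I\<^esub> cval H I f [] [a]"
  proof cases
    case 3
    then show ?thesis using * ab by (simp add: f1 del: One_nat_def)
  qed (use ab in \<open>simp_all add: cval_zero f1\<close>)
qed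

text \<open>Weight one has no shuffles to check. For a zero first entry the formula vanishes because
  0 acts as the identity, both through the dot and through \<open>dia\<close>.\<close>

lemma dh_01:
  assumes f: "f \<in> carrier (cochain_group H I 0 1)"
  shows "dh H I dia 0 1 f \<in> carrier (cochain_group H I 1 1)"
    and "\<lbrakk>a \<in> carrier H; b \<in> carrier H\<rbrakk> \<Longrightarrow> cval H I (dh H I dia 0 1 f) [a] [b] =
      cval H I f [] [a \<cdot>\<^bsub>H\<^esub> b] \<otimes>\<^bsub>I\<^esub> inv\<^bsub>I\<^esub> dia a (cval H I f [] [b])"
proof -
  note f1 = dh_formula_01[OF f] cval_closed_01[OF f]
  have *: "dh H I dia 0 1 f \<in> carrier (cochain_group H I 1 1) \<and>
    (\<forall>hs\<in>tuples H 1. \<forall>ks\<in>tuples H 1. cval H I (dh H I dia 0 1 f) hs ks = dh_formula H I dia 0 f hs ks)"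
  proof (rule cochain_THE_spec[OF I.comm_group_axioms])
    show "dh_formula H I dia 0 f hs ks \<in> carrier I" if "hs \<in> tuples H 1" "ks \<in> tuples H 1" for hs ks
      using that by (auto simp: tuples_1_2_3_iff f1 simp del: One_nat_def)
    show "dh H I dia 0 1 f = (THE g. g \<in> carrier (cochain_group H I 1 1) \<and>
        (\<forall>hs\<in>tuples H 1. \<forall>ks\<in>tuples H 1. cval H I g hs ks = dh_formula H I dia 0 f hs ks))"
      by (simp only: dh_def nat_numeral_sums)
  qed (erule (1) no_shuffles_1)
  then show "dh H I dia 0 1 f \<in> carrier (cochain_group H I 1 1)" by blast
  assume ab: "a \<in> carrier H" "b \<in> carrier H"
  consider "a = \<one>\<^bsub>H\<^esub>" | "b = \<one>\<^bsub>H\<^esub>" | "[a] \<in> tuples H 1" "[b] \<in> tuples H 1"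
    using ab by (auto simp: tuples_1_2_3_iff simp del: One_nat_def)
  then show "cval H I (dh H I dia 0 1 f) [a] [b] =
      cval H I f [] [a \<cdot>\<^bsub>H\<^esub> b] \<otimes>\<^bsub>I\<^esub> inv\<^bsub>I\<^esub> dia a (cval H I f [] [b])"
  proof cases
    case 3
    then show ?thesis using * ab by (simp add: f1 del: One_nat_def)
  qed (use ab in \<open>simp_all add: cval_zero f1 dia_zero del: One_nat_def\<close>)
qed

text \<open>This is the coboundary of a symmetric two-cochain. Its vanishing on both weight-three
  shuffles is a consequence of that symmetry, by cancellation between cyclically shifted
  arguments.\<close>

lemma dv_02:
  assumes f: "f \<in> carrier (cochain_group H I 0 2)"
  shows "dv H I 0 2 f \<in> carrier (cochain_group H I 0 3) \<and>
    (\<forall>hs\<in>tuples H 0. \<forall>ks\<in>tuples H 3. cval H I (dv H I 0 2 f) hs ks = dv_formula H I 0 2 f hs ks)"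
proof (rule cochain_THE_spec[OF I.comm_group_axioms])
  note f1 = dv_formula_02[OF f] cval_closed_02[OF f]
  note comm = cval_commute_02[OF f]
  show "dv_formula H I 0 2 f hs ks \<in> carrier I" if "hs \<in> tuples H 0" "ks \<in> tuples H 3" for hs ks
    using that by (auto simp: tuples_1_2_3_iff f1)
  show "finprod I (\<lambda>\<sigma>. dv_formula H I 0 2 f hs (permute_list (inv_into UNIV \<sigma>) ks) [^]\<^bsub>I\<^esub> sign \<sigma>)
      (shuffle_perms l 3) = \<one>\<^bsub>I\<^esub>"
    if "hs \<in> tuples H 0" "1 \<le> l" "l < 3" "ks \<in> tuples H 3" for l hs ks
  proof (rule I.finprod_shuffle_perms_3_eq_one[OF that(2-4)])
    fix a b c assume "a \<in> carrier H - {\<one>\<^bsub>H\<^esub>}" "b \<in> carrier H - {\<one>\<^bsub>H\<^esub>}" "c \<in> carrier H - {\<one>\<^bsub>H\<^esub>}"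
    then have abc: "a \<in> carrier H" "b \<in> carrier H" "c \<in> carrier H" by auto
    have hs: "hs = []" using that by simp
    define p where "p x y = cval H I f [] [x, y]" for x y
    have pc: "p x y \<in> carrier I" if "x \<in> carrier H" "y \<in> carrier H" for x y
      using that f1 by (simp add: p_def)
    have ps: "p x y = p y x" if "x \<in> carrier H" "y \<in> carrier H" for x y
      using that comm by (simp add: p_def)
    have F: "dv_formula H I 0 2 f hs [x, y, z] = p y z \<otimes>\<^bsub>I\<^esub>
        (inv\<^bsub>I\<^esub> p (x \<otimes>\<^bsub>H\<^esub> y) z \<otimes>\<^bsub>I\<^esub> p x (y \<otimes>\<^bsub>H\<^esub> z)) \<otimes>\<^bsub>I\<^esub> inv\<^bsub>I\<^esub> p x y"
      if "x \<in> carrier H" "y \<in> carrier H" "z \<in> carrier H" for x y z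
      using that f1 by (simp add: p_def hs)
    \<comment> \<open>Between cyclic neighbours two terms cancel: \<open>u\<close>, the outer term
      shared by both, and \<open>w\<close>, the shared term with a summed entry. The four survivors
      form the third value of the formula.\<close>
    have cancel: "(u \<otimes>\<^bsub>I\<^esub> (inv\<^bsub>I\<^esub> v \<otimes>\<^bsub>I\<^esub> w) \<otimes>\<^bsub>I\<^esub> inv\<^bsub>I\<^esub> x) \<otimes>\<^bsub>I\<^esub> (y \<otimes>\<^bsub>I\<^esub> (inv\<^bsub>I\<^esub> w \<otimes>\<^bsub>I\<^esub> z) \<otimes>\<^bsub>I\<^esub> inv\<^bsub>I\<^esub> u)
       = y \<otimes>\<^bsub>I\<^esub> (inv\<^bsub>I\<^esub> v \<otimes>\<^bsub>I\<^esub> z) \<otimes>\<^bsub>I\<^esub> inv\<^bsub>I\<^esub> x"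
      if c: "u \<in> carrier I" "v \<in> carrier I" "w \<in> carrier I" "x \<in> carrier I" "y \<in> carrier I" "z \<in> carrier I" for u v w x y z
    proof -
      have "(u \<otimes>\<^bsub>I\<^esub> (inv\<^bsub>I\<^esub> v \<otimes>\<^bsub>I\<^esub> w) \<otimes>\<^bsub>I\<^esub> inv\<^bsub>I\<^esub> x) \<otimes>\<^bsub>I\<^esub> (y \<otimes>\<^bsub>I\<^esub> (inv\<^bsub>I\<^esub> w \<otimes>\<^bsub>I\<^esub> z) \<otimes>\<^bsub>I\<^esub> inv\<^bsub>I\<^esub> u)
        = (u \<otimes>\<^bsub>I\<^esub> inv\<^bsub>I\<^esub> u) \<otimes>\<^bsub>I\<^esub> ((w \<otimes>\<^bsub>I\<^esub> inv\<^bsub>I\<^esub> w) \<otimes>\<^bsub>I\<^esub> (y \<otimes>\<^bsub>I\<^esub> (inv\<^bsub>I\<^esub> v \<otimes>\<^bsub>I\<^esub> z) \<otimes>\<^bsub>I\<^esub> inv\<^bsub>I\<^esub> x))"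
        using c by (simp add: I.m_ac del: I.r_inv I.l_inv I.Units_r_inv I.Units_l_inv)
      then show ?thesis using c by simp
    qed
    have 1: "dv_formula H I 0 2 f hs [a, b, c] \<otimes>\<^bsub>I\<^esub> dv_formula H I 0 2 f hs [b, c, a] =
        dv_formula H I 0 2 f hs [b, a, c]"
      using abc cancel[of "p b c" "p (a \<otimes>\<^bsub>H\<^esub> b) c" "p a (b \<otimes>\<^bsub>H\<^esub> c)" "p a b" "p a c" "p b (a \<otimes>\<^bsub>H\<^esub> c)"]
      by (simp add: F pc H.m_comm[of b a] H.m_comm[of c a] ps[of b a] ps[of c a] ps[of "b \<otimes>\<^bsub>H\<^esub> c" a])
    \<comment> \<open>The factors appear in the order (c, a, b), (a, b, c), so that they are again
      cyclic neighbours and \<open>cancel\<close> applies; commutativity restores the required order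
      at the end.\<close>
    have 2: "dv_formula H I 0 2 f hs [c, a, b] \<otimes>\<^bsub>I\<^esub> dv_formula H I 0 2 f hs [a, b, c] =
        dv_formula H I 0 2 f hs [a, c, b]"
      using abc cancel[of "p a b" "p (a \<otimes>\<^bsub>H\<^esub> c) b" "p (a \<otimes>\<^bsub>H\<^esub> b) c" "p a c" "p b c" "p a (b \<otimes>\<^bsub>H\<^esub> c)"]
      by (simp add: F pc H.m_comm[of c b] H.m_comm[of c a] ps[of c b] ps[of c a] ps[of c "a \<otimes>\<^bsub>H\<^esub> b"])
    have cl: "dv_formula H I 0 2 f hs [x, y, z] \<in> carrier I"
      if "x \<in> carrier H" "y \<in> carrier H" "z \<in> carrier H" for x y z
      using that by (simp add: F pc)
    show "dv_formula H I 0 2 f hs [a, b, c] \<in> carrier I \<and>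
        dv_formula H I 0 2 f hs [a, b, c] \<otimes>\<^bsub>I\<^esub> dv_formula H I 0 2 f hs [b, c, a] = dv_formula H I 0 2 f hs [b, a, c] \<and>
        dv_formula H I 0 2 f hs [a, b, c] \<otimes>\<^bsub>I\<^esub> dv_formula H I 0 2 f hs [c, a, b] = dv_formula H I 0 2 f hs [a, c, b]"
      using 1 2 cl abc I.m_comm by simp
  qed
  show "dv H I 0 2 f = (THE g. g \<in> carrier (cochain_group H I 0 3) \<and>
      (\<forall>hs\<in>tuples H 0. \<forall>ks\<in>tuples H 3. cval H I g hs ks = dv_formula H I 0 2 f hs ks))"
    by (simp only: dv_def nat_numeral_sums)
qed

text \<open>Symmetry in the last two entries comes from commutativity of addition in
  \<open>H\<close> and in \<open>I\<close>.\<close>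

lemma dv_11:
  assumes f: "f \<in> carrier (cochain_group H I 1 1)"
  shows "dv H I 1 1 f \<in> carrier (cochain_group H I 1 2) \<and>
    (\<forall>hs\<in>tuples H 1. \<forall>ks\<in>tuples H 2. cval H I (dv H I 1 1 f) hs ks = dv_formula H I 1 1 f hs ks)"
proof (rule cochain_THE_spec[OF I.comm_group_axioms])
  note f1 = dv_formula_11[OF f] cval_closed_11[OF f]
  show "dv_formula H I 1 1 f hs ks \<in> carrier I" if "hs \<in> tuples H 1" "ks \<in> tuples H 2" for hs ks
    using that by (auto simp: tuples_1_2_3_iff f1 simp del: One_nat_def)
  show "finprod I (\<lambda>\<sigma>. dv_formula H I 1 1 f hs (permute_list (inv_into UNIV \<sigma>) ks) [^]\<^bsub>I\<^esub> sign \<sigma>)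
      (shuffle_perms l 2) = \<one>\<^bsub>I\<^esub>"
    if "hs \<in> tuples H 1" "1 \<le> l" "l < 2" "ks \<in> tuples H 2" for l hs ks
    by (rule I.finprod_shuffle_perms_2_eq_one[OF that(2-4)])
      (use that in \<open>auto simp: tuples_1_2_3_iff f1 H.m_comm I.m_ac simp del: One_nat_def\<close>)
  show "dv H I 1 1 f = (THE g. g \<in> carrier (cochain_group H I 1 2) \<and>
      (\<forall>hs\<in>tuples H 1. \<forall>ks\<in>tuples H 2. cval H I g hs ks = dv_formula H I 1 1 f hs ks))"
    by (simp only: dv_def nat_numeral_sums)
qed

text \<open>Symmetry in the last two entries is inherited from \<open>f\<close>, applied once to b,
  c and once to their images under a.\<close>

lemma dh_02:
  assumes f: "f \<in> carrier (cochain_group H I 0 2)"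
  shows "dh H I dia 0 2 f \<in> carrier (cochain_group H I 1 2) \<and>
    (\<forall>hs\<in>tuples H 1. \<forall>ks\<in>tuples H 2. cval H I (dh H I dia 0 2 f) hs ks = dh_formula H I dia 0 f hs ks)"
proof (rule cochain_THE_spec[OF I.comm_group_axioms])
  note f1 = dh_formula_02[OF f] cval_closed_02[OF f]
  show "dh_formula H I dia 0 f hs ks \<in> carrier I" if "hs \<in> tuples H 1" "ks \<in> tuples H 2" for hs ks
    using that by (auto simp: tuples_1_2_3_iff f1 simp del: One_nat_def)
  show "finprod I (\<lambda>\<sigma>. dh_formula H I dia 0 f hs (permute_list (inv_into UNIV \<sigma>) ks) [^]\<^bsub>I\<^esub> sign \<sigma>)
      (shuffle_perms l 2) = \<one>\<^bsub>I\<^esub>"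
    if hs: "hs \<in> tuples H 1" and "1 \<le> l" "l < 2" "ks \<in> tuples H 2" for l hs ks
  proof (rule I.finprod_shuffle_perms_2_eq_one[OF that(2-4)])
    fix b c assume "b \<in> carrier H - {\<one>\<^bsub>H\<^esub>}" "c \<in> carrier H - {\<one>\<^bsub>H\<^esub>}"
    moreover obtain a where "hs = [a]" "a \<in> carrier H" using hs by (auto simp: tuples_1_2_3_iff simp del: One_nat_def)
    ultimately show "dh_formula H I dia 0 f hs [b, c] \<in> carrier I \<and>
        dh_formula H I dia 0 f hs [b, c] = dh_formula H I dia 0 f hs [c, b]"
      using cval_commute_02[OF f, of "a \<cdot>\<^bsub>H\<^esub> b" "a \<cdot>\<^bsub>H\<^esub> c"] cval_commute_02[OF f, of b c]
      by (simp add: f1)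
  qed
  show "dh H I dia 0 2 f = (THE g. g \<in> carrier (cochain_group H I 1 2) \<and>
      (\<forall>hs\<in>tuples H 1. \<forall>ks\<in>tuples H 2. cval H I g hs ks = dh_formula H I dia 0 f hs ks))"
    by (simp only: dh_def nat_numeral_sums)
qed

lemma dh_11:
  assumes f: "f \<in> carrier (cochain_group H I 1 1)"
  shows "dh H I dia 1 1 f \<in> carrier (cochain_group H I 2 1) \<and>
    (\<forall>hs\<in>tuples H 2. \<forall>ks\<in>tuples H 1. cval H I (dh H I dia 1 1 f) hs ks = dh_formula H I dia 1 f hs ks)"
proof (rule cochain_THE_spec[OF I.comm_group_axioms])
  note f1 = dh_formula_11[OF f] cval_closed_11[OF f]
  show "dh_formula H I dia 1 f hs ks \<in> carrier I" if "hs \<in> tuples H 2" "ks \<in> tuples H 1" for hs ks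
    using that by (auto simp: tuples_1_2_3_iff f1 simp del: One_nat_def)
  show "dh H I dia 1 1 f = (THE g. g \<in> carrier (cochain_group H I 2 1) \<and>
      (\<forall>hs\<in>tuples H 2. \<forall>ks\<in>tuples H 1. cval H I g hs ks = dh_formula H I dia 1 f hs ks))"
    by (simp only: dh_def nat_numeral_sums)
qed (erule (1) no_shuffles_1)

end

section \<open>Cocycles and coboundaries in degree two\<close>

lemma ball_tuples:
  "(\<forall>ks\<in>tuples H 0. P ks) \<longleftrightarrow> P []"
  "(\<forall>ks\<in>tuples H 1. P ks) \<longleftrightarrow> (\<forall>a\<in>carrier H - {\<one>\<^bsub>H\<^esub>}. P [a])"
  "(\<forall>ks\<in>tuples H 2. P ks) \<longleftrightarrow> (\<forall>a\<in>carrier H - {\<one>\<^bsub>H\<^esub>}. \<forall>b\<in>carrier H - {\<one>\<^bsub>H\<^esub>}. P [a, b])"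
  "(\<forall>ks\<in>tuples H 3. P ks) \<longleftrightarrow>
    (\<forall>a\<in>carrier H - {\<one>\<^bsub>H\<^esub>}. \<forall>b\<in>carrier H - {\<one>\<^bsub>H\<^esub>}. \<forall>c\<in>carrier H - {\<one>\<^bsub>H\<^esub>}. P [a, b, c])"
  unfolding tuples_0 Ball_def[of "tuples H _"] tuples_1_2_3_iff by blast+

context lcs_action
begin

text \<open>The three equations are the components of the differential in bidegrees (0, 3), (1, 2)
  and (2, 1), with negative terms moved across. They are required on all of \<open>H\<close>, zero
  included, so that they can be compared directly with identities in an extension.\<close>

definition cocycle :: "('h \<Rightarrow> 'h \<Rightarrow> 'i) \<Rightarrow> ('h \<Rightarrow> 'h \<Rightarrow> 'i) \<Rightarrow> bool" where
  "cocycle \<beta> \<gamma> \<longleftrightarrow>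
    (\<forall>a\<in>carrier H. \<forall>b\<in>carrier H. \<beta> a b \<in> carrier I \<and> \<gamma> a b \<in> carrier I \<and> \<beta> a b = \<beta> b a) \<and>
    (\<forall>a\<in>carrier H. \<beta> \<one>\<^bsub>H\<^esub> a = \<one>\<^bsub>I\<^esub> \<and> \<gamma> \<one>\<^bsub>H\<^esub> a = \<one>\<^bsub>I\<^esub> \<and> \<gamma> a \<one>\<^bsub>H\<^esub> = \<one>\<^bsub>I\<^esub>) \<and>
    (\<forall>a\<in>carrier H. \<forall>b\<in>carrier H. \<forall>c\<in>carrier H.
      \<beta> b c \<otimes>\<^bsub>I\<^esub> \<beta> a (b \<otimes>\<^bsub>H\<^esub> c) = \<beta> (a \<otimes>\<^bsub>H\<^esub> b) c \<otimes>\<^bsub>I\<^esub> \<beta> a b \<and>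
      dia a (\<beta> b c) \<otimes>\<^bsub>I\<^esub> (\<gamma> a b \<otimes>\<^bsub>I\<^esub> \<gamma> a c) =
        \<beta> (a \<cdot>\<^bsub>H\<^esub> b) (a \<cdot>\<^bsub>H\<^esub> c) \<otimes>\<^bsub>I\<^esub> \<gamma> a (b \<otimes>\<^bsub>H\<^esub> c) \<and>
      \<gamma> (a \<cdot>\<^bsub>H\<^esub> b) (a \<cdot>\<^bsub>H\<^esub> c) \<otimes>\<^bsub>I\<^esub> dia (a \<cdot>\<^bsub>H\<^esub> b) (\<gamma> a c) = \<gamma> (a \<otimes>\<^bsub>H\<^esub> b) c)"

lemma cocycleD:
  assumes "cocycle \<beta> \<gamma>" and a: "a \<in> carrier H" and b: "b \<in> carrier H"
  shows "\<beta> a b \<in> carrier I" "\<gamma> a b \<in> carrier I" "\<beta> a b = \<beta> b a"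
    "\<beta> \<one>\<^bsub>H\<^esub> a = \<one>\<^bsub>I\<^esub>" "\<beta> a \<one>\<^bsub>H\<^esub> = \<one>\<^bsub>I\<^esub>" "\<gamma> \<one>\<^bsub>H\<^esub> a = \<one>\<^bsub>I\<^esub>" "\<gamma> a \<one>\<^bsub>H\<^esub> = \<one>\<^bsub>I\<^esub>"
    and "c \<in> carrier H \<Longrightarrow> \<beta> b c \<otimes>\<^bsub>I\<^esub> \<beta> a (b \<otimes>\<^bsub>H\<^esub> c) = \<beta> (a \<otimes>\<^bsub>H\<^esub> b) c \<otimes>\<^bsub>I\<^esub> \<beta> a b"
    and "c \<in> carrier H \<Longrightarrow> dia a (\<beta> b c) \<otimes>\<^bsub>I\<^esub> (\<gamma> a b \<otimes>\<^bsub>I\<^esub> \<gamma> a c) =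
      \<beta> (a \<cdot>\<^bsub>H\<^esub> b) (a \<cdot>\<^bsub>H\<^esub> c) \<otimes>\<^bsub>I\<^esub> \<gamma> a (b \<otimes>\<^bsub>H\<^esub> c)"
    and "c \<in> carrier H \<Longrightarrow>
      \<gamma> (a \<cdot>\<^bsub>H\<^esub> b) (a \<cdot>\<^bsub>H\<^esub> c) \<otimes>\<^bsub>I\<^esub> dia (a \<cdot>\<^bsub>H\<^esub> b) (\<gamma> a c) = \<gamma> (a \<otimes>\<^bsub>H\<^esub> b) c"
proof -
  have comm: "\<beta> x y = \<beta> y x" if "x \<in> carrier H" "y \<in> carrier H" for x y
    using assms(1) that unfolding cocycle_def by blast
  show "\<beta> a b = \<beta> b a" using a b by (rule comm)
  show one: "\<beta> \<one>\<^bsub>H\<^esub> a = \<one>\<^bsub>I\<^esub>"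
    using assms unfolding cocycle_def by blast
  show "\<beta> a \<one>\<^bsub>H\<^esub> = \<one>\<^bsub>I\<^esub>" using comm[OF a H.one_closed] one by simp
qed (use assms in \<open>unfold cocycle_def, blast+\<close>)

text \<open>Written without inverses, this says that (\<beta>, \<gamma>) is (\<beta>', \<gamma>')
  plus the total differential of the degree-one cochain \<theta>.\<close>

definition cohomologous ::
    "('h \<Rightarrow> 'h \<Rightarrow> 'i) \<Rightarrow> ('h \<Rightarrow> 'h \<Rightarrow> 'i) \<Rightarrow> ('h \<Rightarrow> 'h \<Rightarrow> 'i) \<Rightarrow> ('h \<Rightarrow> 'h \<Rightarrow> 'i) \<Rightarrow> bool" where
  "cohomologous \<beta> \<gamma> \<beta>' \<gamma>' \<longleftrightarrow> (\<exists>\<theta>\<in>carrier H \<rightarrow> carrier I. \<theta> \<one>\<^bsub>H\<^esub> = \<one>\<^bsub>I\<^esub> \<and>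
    (\<forall>a\<in>carrier H. \<forall>b\<in>carrier H.
      \<beta> a b \<otimes>\<^bsub>I\<^esub> \<theta> (a \<otimes>\<^bsub>H\<^esub> b) = \<beta>' a b \<otimes>\<^bsub>I\<^esub> (\<theta> a \<otimes>\<^bsub>I\<^esub> \<theta> b) \<and>
      \<gamma> a b \<otimes>\<^bsub>I\<^esub> dia a (\<theta> b) = \<gamma>' a b \<otimes>\<^bsub>I\<^esub> \<theta> (a \<cdot>\<^bsub>H\<^esub> b)))"

definition beta :: "(nat \<Rightarrow> ('h, 'i) cochain) \<Rightarrow> 'h \<Rightarrow> 'h \<Rightarrow> 'i" where
  "beta c a b = cval H I (c 0) [] [a, b]"

definition gamma :: "(nat \<Rightarrow> ('h, 'i) cochain) \<Rightarrow> 'h \<Rightarrow> 'h \<Rightarrow> 'i" where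
  "gamma c a b = cval H I (c 1) [a] [b]"

section \<open>The total complex in degrees one to three, in terms of \<beta> and \<gamma>\<close>

lemma carrier_Tot: "carrier (Tot H I n) = (\<Pi>\<^sub>E r\<in>{..<n}. carrier (cochain_group H I r (n - r)))"
  unfolding Tot_def by (subst carrier_sum_group) (auto intro: cochain_group_group I.comm_group_axioms)

lemma carrier_Tot_1: "c \<in> carrier (Tot H I 1) \<longleftrightarrow> c \<in> extensional {..<1} \<and> c 0 \<in> carrier (cochain_group H I 0 1)"
proof -
  have "{..<1} = {0::nat}" by auto
  then show ?thesis by (auto simp: carrier_Tot PiE_def)
qed

lemma carrier_Tot_2: "c \<in> carrier (Tot H I 2) \<longleftrightarrow> c \<in> extensional {..<2} \<and>
    c 0 \<in> carrier (cochain_group H I 0 2) \<and> c 1 \<in> carrier (cochain_group H I 1 1)"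
proof -
  have "{..<2} = {0, 1::nat}" by auto
  then show ?thesis by (auto simp: carrier_Tot PiE_def)
qed

lemma Tot_d_1:
  assumes "f \<in> carrier (Tot H I 1)"
  shows "Tot_d H I dia 1 f \<in> carrier (Tot H I 2)"
    and "\<lbrakk>a \<in> carrier H; b \<in> carrier H\<rbrakk> \<Longrightarrow> beta (Tot_d H I dia 1 f) a b =
      cval H I (f 0) [] [b] \<otimes>\<^bsub>I\<^esub> inv\<^bsub>I\<^esub> cval H I (f 0) [] [a \<otimes>\<^bsub>H\<^esub> b] \<otimes>\<^bsub>I\<^esub> cval H I (f 0) [] [a]"
    and "\<lbrakk>a \<in> carrier H; b \<in> carrier H\<rbrakk> \<Longrightarrow> gamma (Tot_d H I dia 1 f) a b =
      cval H I (f 0) [] [a \<cdot>\<^bsub>H\<^esub> b] \<otimes>\<^bsub>I\<^esub> inv\<^bsub>I\<^esub> dia a (cval H I (f 0) [] [b])"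
proof -
  have f: "f 0 \<in> carrier (cochain_group H I 0 1)" using assms carrier_Tot_1 by blast
  interpret C0: group "cochain_group H I 0 2" by (rule cochain_group_group[OF I.comm_group_axioms])
  interpret C1: group "cochain_group H I 1 1" by (rule cochain_group_group[OF I.comm_group_axioms])
  have 0: "Tot_d H I dia 1 f 0 = dv H I 0 1 (f 0)"
    using dv_01(1)[OF f] C0.l_one by (simp add: Tot_d_def numeral_2_eq_2)
  have 1: "Tot_d H I dia 1 f 1 = dh H I dia 0 1 (f 0)"
    using dh_01(1)[OF f] C1.r_one by (simp add: Tot_d_def)
  show "Tot_d H I dia 1 f \<in> carrier (Tot H I 2)"
    unfolding carrier_Tot_2 0 1 using dv_01(1)[OF f] dh_01(1)[OF f]
    by (auto simp: Tot_d_def numeral_2_eq_2)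
  show "\<lbrakk>a \<in> carrier H; b \<in> carrier H\<rbrakk> \<Longrightarrow> beta (Tot_d H I dia 1 f) a b =
      cval H I (f 0) [] [b] \<otimes>\<^bsub>I\<^esub> inv\<^bsub>I\<^esub> cval H I (f 0) [] [a \<otimes>\<^bsub>H\<^esub> b] \<otimes>\<^bsub>I\<^esub> cval H I (f 0) [] [a]"
    unfolding beta_def 0 by (rule dv_01(2)[OF f])
  show "\<lbrakk>a \<in> carrier H; b \<in> carrier H\<rbrakk> \<Longrightarrow> gamma (Tot_d H I dia 1 f) a b =
      cval H I (f 0) [] [a \<cdot>\<^bsub>H\<^esub> b] \<otimes>\<^bsub>I\<^esub> inv\<^bsub>I\<^esub> dia a (cval H I (f 0) [] [b])"
    unfolding gamma_def 1 by (rule dh_01(2)[OF f])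
qed

lemma Tot_2_mult:
  assumes "c \<in> carrier (Tot H I 2)" "c' \<in> carrier (Tot H I 2)"
  shows "c \<otimes>\<^bsub>Tot H I 2\<^esub> c' \<in> carrier (Tot H I 2)"
    and "\<lbrakk>a \<in> carrier H; b \<in> carrier H\<rbrakk> \<Longrightarrow> beta (c \<otimes>\<^bsub>Tot H I 2\<^esub> c') a b = beta c a b \<otimes>\<^bsub>I\<^esub> beta c' a b"
    and "\<lbrakk>a \<in> carrier H; b \<in> carrier H\<rbrakk> \<Longrightarrow> gamma (c \<otimes>\<^bsub>Tot H I 2\<^esub> c') a b = gamma c a b \<otimes>\<^bsub>I\<^esub> gamma c' a b"
proof -
  interpret T: group "Tot H I 2"
    unfolding Tot_def by (intro sum_group cochain_group_group I.comm_group_axioms)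
  show "c \<otimes>\<^bsub>Tot H I 2\<^esub> c' \<in> carrier (Tot H I 2)" using assms by (rule T.m_closed)
  have 0: "(c \<otimes>\<^bsub>Tot H I 2\<^esub> c') 0 = c 0 \<otimes>\<^bsub>cochain_group H I 0 2\<^esub> c' 0" by (simp add: Tot_def)
  have 1: "(c \<otimes>\<^bsub>Tot H I 2\<^esub> c') 1 = c 1 \<otimes>\<^bsub>cochain_group H I 1 1\<^esub> c' 1" by (simp add: Tot_def)
  assume ab: "a \<in> carrier H" "b \<in> carrier H"
  show "beta (c \<otimes>\<^bsub>Tot H I 2\<^esub> c') a b = beta c a b \<otimes>\<^bsub>I\<^esub> beta c' a b"
  proof (cases "[a, b] \<in> tuples H 2")
    case True
    then show ?thesis unfolding beta_def 0 by (intro cval_mult) auto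
  qed (use ab in \<open>auto simp: beta_def cval_def tuples_1_2_3_iff\<close>)
  show "gamma (c \<otimes>\<^bsub>Tot H I 2\<^esub> c') a b = gamma c a b \<otimes>\<^bsub>I\<^esub> gamma c' a b"
  proof (cases "[a] \<in> tuples H 1 \<and> [b] \<in> tuples H 1")
    case True
    then show ?thesis unfolding gamma_def 1 by (intro cval_mult) auto
  qed (use ab in \<open>auto simp: gamma_def cval_def tuples_1_2_3_iff simp del: One_nat_def\<close>)
qed

lemma Tot_2_eqI:
  assumes c: "c \<in> carrier (Tot H I 2)" "c' \<in> carrier (Tot H I 2)"
    and eq: "\<And>a b. \<lbrakk>a \<in> carrier H; b \<in> carrier H\<rbrakk> \<Longrightarrow> beta c a b = beta c' a b \<and> gamma c a b = gamma c' a b"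
  shows "c = c'"
proof (rule extensionalityI[of _ "{..<2}"])
  note c' = c[unfolded carrier_Tot_2]
  have 0: "c 0 = c' 0"
  proof (rule cochain_eqI[OF I.is_group, of _ H 0 2])
    fix hs ks assume "hs \<in> tuples H 0" "ks \<in> tuples H 2"
    then obtain a b where "hs = []" "ks = [a, b]" "a \<in> carrier H" "b \<in> carrier H"
      unfolding tuples_1_2_3_iff by auto
    then show "cval H I (c 0) hs ks = cval H I (c' 0) hs ks"
      using eq[of a b] by (simp add: beta_def)
  qed (use c' in blast)+
  have 1: "c 1 = c' 1"
  proof (rule cochain_eqI[OF I.is_group, of _ H 1 1])
    fix hs ks assume "hs \<in> tuples H 1" "ks \<in> tuples H 1"
    then obtain a b where "hs = [a]" "ks = [b]" "a \<in> carrier H" "b \<in> carrier H"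
      unfolding tuples_1_2_3_iff by auto
    then show "cval H I (c 1) hs ks = cval H I (c' 1) hs ks"
      using eq[of a b] by (simp add: gamma_def)
  qed (use c' in blast)+
  show "c r = c' r" if "r \<in> {..<2}" for r
  proof -
    have "r = 0 \<or> r = 1" using that by auto
    then show ?thesis using 0 1 by blast
  qed
  show "c \<in> extensional {..<2}" "c' \<in> extensional {..<2}" using c' by blast+
qed

text \<open>Symmetry of \<beta> is the weight-two shuffle condition, and \<gamma> has weight one,
  where there is no such condition. Normalization matches the zero convention of
  \<open>cval\<close>, so the values agree on all of \<open>H\<close>.\<close>

lemma Tot_2_exists:
  assumes "cocycle \<beta> \<gamma>"
  shows "\<exists>c\<in>carrier (Tot H I 2). \<forall>a\<in>carrier H. \<forall>b\<in>carrier H. beta c a b = \<beta> a b \<and> gamma c a b = \<gamma> a b"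
proof -
  have clo: "\<beta> a b \<in> carrier I" "\<gamma> a b \<in> carrier I" and comm: "\<beta> a b = \<beta> b a"
    if "a \<in> carrier H" "b \<in> carrier H" for a b
    using cocycleD[OF assms that] by blast+
  have zero: "\<beta> \<one>\<^bsub>H\<^esub> a = \<one>\<^bsub>I\<^esub>" "\<beta> a \<one>\<^bsub>H\<^esub> = \<one>\<^bsub>I\<^esub>" "\<gamma> \<one>\<^bsub>H\<^esub> a = \<one>\<^bsub>I\<^esub>" "\<gamma> a \<one>\<^bsub>H\<^esub> = \<one>\<^bsub>I\<^esub>"
    if "a \<in> carrier H" for a
    using cocycleD[OF assms that that] by blast+
  have "\<exists>f\<in>carrier (cochain_group H I 0 2). \<forall>hs\<in>tuples H 0. \<forall>ks\<in>tuples H 2.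
      cval H I f hs ks = \<beta> (ks ! 0) (ks ! 1)"
  proof (rule cochain_exists[OF I.comm_group_axioms])
    show "finprod I (\<lambda>\<sigma>. \<beta> (permute_list (inv_into UNIV \<sigma>) ks ! 0) (permute_list (inv_into UNIV \<sigma>) ks ! 1)
        [^]\<^bsub>I\<^esub> sign \<sigma>) (shuffle_perms l 2) = \<one>\<^bsub>I\<^esub>"
      if "1 \<le> l" "l < 2" "ks \<in> tuples H 2" for l ks
      by (rule I.finprod_shuffle_perms_2_eq_one[OF that, of "\<lambda>ks. \<beta> (ks ! 0) (ks ! 1)"])
        (use clo comm in auto)
  qed (use clo in \<open>auto simp: tuples_1_2_3_iff\<close>)
  then obtain f where f: "f \<in> carrier (cochain_group H I 0 2)"
    "\<And>ks. ks \<in> tuples H 2 \<Longrightarrow> cval H I f [] ks = \<beta> (ks ! 0) (ks ! 1)" by auto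
  have "\<exists>f\<in>carrier (cochain_group H I 1 1). \<forall>hs\<in>tuples H 1. \<forall>ks\<in>tuples H 1.
      cval H I f hs ks = \<gamma> (hd hs) (hd ks)"
    by (rule cochain_exists[OF I.comm_group_axioms])
      (use clo in \<open>auto simp: tuples_1_2_3_iff simp del: One_nat_def elim: no_shuffles_1\<close>)
  then obtain g where g: "g \<in> carrier (cochain_group H I 1 1)"
    "\<And>hs ks. hs \<in> tuples H 1 \<Longrightarrow> ks \<in> tuples H 1 \<Longrightarrow> cval H I g hs ks = \<gamma> (hd hs) (hd ks)" by auto
  let ?c = "\<lambda>r\<in>{..<2::nat}. if r = 0 then f else g"
  show ?thesis
  proof (intro bexI[of _ ?c] ballI conjI)
    show "?c \<in> carrier (Tot H I 2)" using f(1) g(1) unfolding carrier_Tot_2 by simp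
    fix a b assume ab: "a \<in> carrier H" "b \<in> carrier H"
    consider "a = \<one>\<^bsub>H\<^esub>" | "b = \<one>\<^bsub>H\<^esub>" | "[a, b] \<in> tuples H 2" "[a] \<in> tuples H 1" "[b] \<in> tuples H 1"
      using ab by (auto simp: tuples_1_2_3_iff simp del: One_nat_def)
    then show "beta ?c a b = \<beta> a b"
      by cases (use ab zero in \<open>simp_all add: beta_def cval_zero f(2)\<close>)
    consider "a = \<one>\<^bsub>H\<^esub>" | "b = \<one>\<^bsub>H\<^esub>" | "[a] \<in> tuples H 1" "[b] \<in> tuples H 1"
      using ab by (auto simp: tuples_1_2_3_iff simp del: One_nat_def)
    then show "gamma ?c a b = \<gamma> a b"
      by cases (use ab zero in \<open>simp_all add: gamma_def cval_zero g(2)\<close>)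
  qed
qed

lemma beta_gamma_normalized:
  assumes "c \<in> carrier (Tot H I 2)" "a \<in> carrier H" "b \<in> carrier H"
  shows "beta c a b \<in> carrier I" "gamma c a b \<in> carrier I" "beta c a b = beta c b a"
    "beta c \<one>\<^bsub>H\<^esub> b = \<one>\<^bsub>I\<^esub>" "beta c a \<one>\<^bsub>H\<^esub> = \<one>\<^bsub>I\<^esub>" "gamma c \<one>\<^bsub>H\<^esub> b = \<one>\<^bsub>I\<^esub>" "gamma c a \<one>\<^bsub>H\<^esub> = \<one>\<^bsub>I\<^esub>"
proof -
  have c: "c 0 \<in> carrier (cochain_group H I 0 2)" "c 1 \<in> carrier (cochain_group H I 1 1)"
    using assms(1) unfolding carrier_Tot_2 by blast+
  show "beta c a b \<in> carrier I" "gamma c a b \<in> carrier I" "beta c a b = beta c b a"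
    unfolding beta_def gamma_def
    using cval_closed_02[OF c(1) assms(2,3)] cval_closed_11[OF c(2) assms(2,3)] cval_commute_02[OF c(1) assms(2,3)] .
qed (simp_all add: beta_def gamma_def cval_zero)

text \<open>Each component of the differential vanishes exactly when its values on nonzero tuples
  do, which gives \<open>e0\<close>, \<open>e1\<close>, \<open>e2\<close>. Normalization then
  extends these equations to zero entries.\<close>

lemma Tot_d_2_eq_one_iff:
  assumes c: "c \<in> carrier (Tot H I 2)"
  shows "Tot_d H I dia 2 c = \<one>\<^bsub>Tot H I 3\<^esub> \<longleftrightarrow> cocycle (beta c) (gamma c)"
proof -
  let ?\<beta> = "beta c" and ?\<gamma> = "gamma c"
  let ?C0 = "cochain_group H I 0 3" and ?C1 = "cochain_group H I 1 2" and ?C2 = "cochain_group H I 2 1"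
  interpret C0: group ?C0 by (rule cochain_group_group[OF I.comm_group_axioms])
  interpret C1: group ?C1 by (rule cochain_group_group[OF I.comm_group_axioms])
  interpret C2: group ?C2 by (rule cochain_group_group[OF I.comm_group_axioms])
  have c0: "c 0 \<in> carrier (cochain_group H I 0 2)" and c1: "c 1 \<in> carrier (cochain_group H I 1 1)"
    using c unfolding carrier_Tot_2 by blast+
  note clo [simp] = beta_gamma_normalized(1,2)[OF c]
  note nrm [simp] = beta_gamma_normalized(4-7)[OF c]
  note dv02 = dv_02[OF c0] note dv11 = dv_11[OF c1]
  note dh02 = dh_02[OF c0] note dh11 = dh_11[OF c1]
  have d0: "Tot_d H I dia 2 c 0 = dv H I 0 2 (c 0)"
    using dv02 C0.l_one by (simp add: Tot_d_def)
  have d1: "Tot_d H I dia 2 c 1 = dh H I dia 0 2 (c 0) \<otimes>\<^bsub>?C1\<^esub> dv H I 1 1 (c 1)"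
    by (simp add: Tot_d_def)
  have d2: "Tot_d H I dia 2 c 2 = dh H I dia 1 1 (c 1)"
    using dh11 C2.r_one by (simp add: Tot_d_def)
  have ext: "Tot_d H I dia 2 c \<in> extensional {..<3}" "\<one>\<^bsub>Tot H I 3\<^esub> \<in> extensional {..<3}"
    by (auto simp: Tot_d_def Tot_def)
  have one: "\<one>\<^bsub>Tot H I 3\<^esub> 0 = \<one>\<^bsub>?C0\<^esub>" "\<one>\<^bsub>Tot H I 3\<^esub> 1 = \<one>\<^bsub>?C1\<^esub>" "\<one>\<^bsub>Tot H I 3\<^esub> 2 = \<one>\<^bsub>?C2\<^esub>"
    by (auto simp: Tot_def)
  have "{..<3} = {0, 1, 2::nat}" by auto
  then have split: "Tot_d H I dia 2 c = \<one>\<^bsub>Tot H I 3\<^esub> \<longleftrightarrow> dv H I 0 2 (c 0) = \<one>\<^bsub>?C0\<^esub> \<and>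
      dh H I dia 0 2 (c 0) \<otimes>\<^bsub>?C1\<^esub> dv H I 1 1 (c 1) = \<one>\<^bsub>?C1\<^esub> \<and> dh H I dia 1 1 (c 1) = \<one>\<^bsub>?C2\<^esub>"
    unfolding d0[symmetric] d1[symmetric] d2[symmetric] one[symmetric]
    by (intro iffI extensionalityI[OF ext]) (simp_all only: insert_iff empty_iff, blast)
  have eq_one: "f = \<one>\<^bsub>cochain_group H I r s\<^esub> \<longleftrightarrow> (\<forall>hs\<in>tuples H r. \<forall>ks\<in>tuples H s. cval H I f hs ks = \<one>\<^bsub>I\<^esub>)"
    if "f \<in> carrier (cochain_group H I r s)" for f r s
  proof
    show "f = \<one>\<^bsub>cochain_group H I r s\<^esub>" if "\<forall>hs\<in>tuples H r. \<forall>ks\<in>tuples H s. cval H I f hs ks = \<one>\<^bsub>I\<^esub>"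
      using that \<open>f \<in> carrier (cochain_group H I r s)\<close>
      by (intro cochain_eqI[OF I.is_group _ cochain_one_closed[OF I.is_group]]) (simp_all add: cval_one)
  qed (simp add: cval_one)
  let ?H' = "carrier H - {\<one>\<^bsub>H\<^esub>}"
  have e0: "dv H I 0 2 (c 0) = \<one>\<^bsub>?C0\<^esub> \<longleftrightarrow> (\<forall>x\<in>?H'. \<forall>y\<in>?H'. \<forall>z\<in>?H'.
      ?\<beta> y z \<otimes>\<^bsub>I\<^esub> ?\<beta> x (y \<otimes>\<^bsub>H\<^esub> z) = ?\<beta> (x \<otimes>\<^bsub>H\<^esub> y) z \<otimes>\<^bsub>I\<^esub> ?\<beta> x y)"
  proof -
    have iff: "u \<otimes>\<^bsub>I\<^esub> (inv\<^bsub>I\<^esub> v \<otimes>\<^bsub>I\<^esub> w) \<otimes>\<^bsub>I\<^esub> inv\<^bsub>I\<^esub> x = \<one>\<^bsub>I\<^esub> \<longleftrightarrow> u \<otimes>\<^bsub>I\<^esub> w = v \<otimes>\<^bsub>I\<^esub> x"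
      if "u \<in> carrier I" "v \<in> carrier I" "w \<in> carrier I" "x \<in> carrier I" for u v w x
      using that I.mult_inv_eq_one_iff[of "u \<otimes>\<^bsub>I\<^esub> w" "v \<otimes>\<^bsub>I\<^esub> x"] by (simp add: I.inv_mult I.m_ac)
    have val: "cval H I (dv H I 0 2 (c 0)) [] [x, y, z] = ?\<beta> y z \<otimes>\<^bsub>I\<^esub>
        (inv\<^bsub>I\<^esub> ?\<beta> (x \<otimes>\<^bsub>H\<^esub> y) z \<otimes>\<^bsub>I\<^esub> ?\<beta> x (y \<otimes>\<^bsub>H\<^esub> z)) \<otimes>\<^bsub>I\<^esub> inv\<^bsub>I\<^esub> ?\<beta> x y"
      if "x \<in> ?H'" "y \<in> ?H'" "z \<in> ?H'" for x y z
      using dv02[unfolded ball_tuples] that dv_formula_02[OF c0, of x y z] unfolding beta_def by auto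
    show ?thesis
      unfolding eq_one[OF conjunct1[OF dv02]] ball_tuples by (intro ball_cong refl) (simp add: val iff)
  qed
  have e1: "dh H I dia 0 2 (c 0) \<otimes>\<^bsub>?C1\<^esub> dv H I 1 1 (c 1) = \<one>\<^bsub>?C1\<^esub> \<longleftrightarrow> (\<forall>x\<in>?H'. \<forall>y\<in>?H'. \<forall>z\<in>?H'.
      dia x (?\<beta> y z) \<otimes>\<^bsub>I\<^esub> (?\<gamma> x y \<otimes>\<^bsub>I\<^esub> ?\<gamma> x z) = ?\<beta> (x \<cdot>\<^bsub>H\<^esub> y) (x \<cdot>\<^bsub>H\<^esub> z) \<otimes>\<^bsub>I\<^esub> ?\<gamma> x (y \<otimes>\<^bsub>H\<^esub> z))"
  proof -
    have iff: "(p \<otimes>\<^bsub>I\<^esub> inv\<^bsub>I\<^esub> q) \<otimes>\<^bsub>I\<^esub> (inv\<^bsub>I\<^esub> u \<otimes>\<^bsub>I\<^esub> v \<otimes>\<^bsub>I\<^esub> inv\<^bsub>I\<^esub> w) = \<one>\<^bsub>I\<^esub> \<longleftrightarrow> q \<otimes>\<^bsub>I\<^esub> (w \<otimes>\<^bsub>I\<^esub> u) = p \<otimes>\<^bsub>I\<^esub> v"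
      if "p \<in> carrier I" "q \<in> carrier I" "u \<in> carrier I" "v \<in> carrier I" "w \<in> carrier I" for p q u v w
      using that I.mult_inv_eq_one_iff[of "p \<otimes>\<^bsub>I\<^esub> v" "q \<otimes>\<^bsub>I\<^esub> (w \<otimes>\<^bsub>I\<^esub> u)"]
      by (simp add: I.inv_mult I.m_ac eq_commute[of "p \<otimes>\<^bsub>I\<^esub> v"])
    have val: "cval H I (dh H I dia 0 2 (c 0) \<otimes>\<^bsub>?C1\<^esub> dv H I 1 1 (c 1)) [x] [y, z] =
       (?\<beta> (x \<cdot>\<^bsub>H\<^esub> y) (x \<cdot>\<^bsub>H\<^esub> z) \<otimes>\<^bsub>I\<^esub> inv\<^bsub>I\<^esub> dia x (?\<beta> y z)) \<otimes>\<^bsub>I\<^esub>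
       (inv\<^bsub>I\<^esub> ?\<gamma> x z \<otimes>\<^bsub>I\<^esub> ?\<gamma> x (y \<otimes>\<^bsub>H\<^esub> z) \<otimes>\<^bsub>I\<^esub> inv\<^bsub>I\<^esub> ?\<gamma> x y)"
      if "x \<in> ?H'" "y \<in> ?H'" "z \<in> ?H'" for x y z
    proof -
      have t: "[x] \<in> tuples H 1" "[y, z] \<in> tuples H 2"
        using that by (auto simp: tuples_1_2_3_iff simp del: One_nat_def)
      show ?thesis
        using dh02 dv11 t that dh_formula_02[OF c0, of x y z] dv_formula_11[OF c1, of x y z]
        unfolding cval_mult[OF t] beta_def gamma_def by (simp del: One_nat_def)
    qed
    have "dh H I dia 0 2 (c 0) \<otimes>\<^bsub>?C1\<^esub> dv H I 1 1 (c 1) \<in> carrier ?C1"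
      using dh02 dv11 by (intro C1.m_closed) auto
    then show ?thesis
      by (simp only: eq_one ball_tuples) (intro ball_cong refl, simp add: val iff del: One_nat_def)
  qed
  have e2: "dh H I dia 1 1 (c 1) = \<one>\<^bsub>?C2\<^esub> \<longleftrightarrow> (\<forall>x\<in>?H'. \<forall>y\<in>?H'. \<forall>z\<in>?H'.
      ?\<gamma> (x \<cdot>\<^bsub>H\<^esub> y) (x \<cdot>\<^bsub>H\<^esub> z) \<otimes>\<^bsub>I\<^esub> dia (x \<cdot>\<^bsub>H\<^esub> y) (?\<gamma> x z) = ?\<gamma> (x \<otimes>\<^bsub>H\<^esub> y) z)"
  proof -
    have iff: "u \<otimes>\<^bsub>I\<^esub> inv\<^bsub>I\<^esub> v \<otimes>\<^bsub>I\<^esub> w = \<one>\<^bsub>I\<^esub> \<longleftrightarrow> u \<otimes>\<^bsub>I\<^esub> w = v"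
      if "u \<in> carrier I" "v \<in> carrier I" "w \<in> carrier I" for u v w
      using that I.mult_inv_eq_one_iff[of "u \<otimes>\<^bsub>I\<^esub> w" v] by (simp add: I.m_ac)
    have val: "cval H I (dh H I dia 1 1 (c 1)) [x, y] [z] = ?\<gamma> (x \<cdot>\<^bsub>H\<^esub> y) (x \<cdot>\<^bsub>H\<^esub> z) \<otimes>\<^bsub>I\<^esub>
        inv\<^bsub>I\<^esub> ?\<gamma> (x \<otimes>\<^bsub>H\<^esub> y) z \<otimes>\<^bsub>I\<^esub> dia (x \<cdot>\<^bsub>H\<^esub> y) (?\<gamma> x z)"
      if "x \<in> ?H'" "y \<in> ?H'" "z \<in> ?H'" for x y z
      using dh11[unfolded ball_tuples] that dh_formula_11[OF c1, of x y z] unfolding gamma_def by auto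
    show ?thesis
      unfolding eq_one[OF conjunct1[OF dh11]] ball_tuples
      by (intro ball_cong refl) (simp add: val iff del: One_nat_def)
  qed
  have "cocycle ?\<beta> ?\<gamma> \<longleftrightarrow> (\<forall>x\<in>?H'. \<forall>y\<in>?H'. \<forall>z\<in>?H'.
      ?\<beta> y z \<otimes>\<^bsub>I\<^esub> ?\<beta> x (y \<otimes>\<^bsub>H\<^esub> z) = ?\<beta> (x \<otimes>\<^bsub>H\<^esub> y) z \<otimes>\<^bsub>I\<^esub> ?\<beta> x y \<and>
      dia x (?\<beta> y z) \<otimes>\<^bsub>I\<^esub> (?\<gamma> x y \<otimes>\<^bsub>I\<^esub> ?\<gamma> x z) = ?\<beta> (x \<cdot>\<^bsub>H\<^esub> y) (x \<cdot>\<^bsub>H\<^esub> z) \<otimes>\<^bsub>I\<^esub> ?\<gamma> x (y \<otimes>\<^bsub>H\<^esub> z) \<and>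
      ?\<gamma> (x \<cdot>\<^bsub>H\<^esub> y) (x \<cdot>\<^bsub>H\<^esub> z) \<otimes>\<^bsub>I\<^esub> dia (x \<cdot>\<^bsub>H\<^esub> y) (?\<gamma> x z) = ?\<gamma> (x \<otimes>\<^bsub>H\<^esub> y) z)"
    (is "_ \<longleftrightarrow> (\<forall>x\<in>?H'. \<forall>y\<in>?H'. \<forall>z\<in>?H'. ?P x y z)")
  proof
    assume R: "\<forall>x\<in>?H'. \<forall>y\<in>?H'. \<forall>z\<in>?H'. ?P x y z"
    \<comment> \<open>When an argument is zero the three equations follow from normalization; for
      \<open>x\<close> zero this also uses that \<open>dia\<close> at zero is the identity.\<close>
    have "?P x y z" if "x \<in> carrier H" "y \<in> carrier H" "z \<in> carrier H" for x y z
    proof (cases "x = \<one>\<^bsub>H\<^esub> \<or> y = \<one>\<^bsub>H\<^esub> \<or> z = \<one>\<^bsub>H\<^esub>")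
      case True
      then show ?thesis using that by (elim disjE) (simp_all add: dia_zero)
    next
      case False
      then have "x \<in> ?H'" "y \<in> ?H'" "z \<in> ?H'" using that by auto
      with R show ?thesis by blast
    qed
    moreover have "?\<beta> a b = ?\<beta> b a" if "a \<in> carrier H" "b \<in> carrier H" for a b
      using beta_gamma_normalized(3)[OF c that] .
    ultimately show "cocycle ?\<beta> ?\<gamma>" unfolding cocycle_def by simp
  next
    assume "cocycle ?\<beta> ?\<gamma>"
    then show "\<forall>x\<in>?H'. \<forall>y\<in>?H'. \<forall>z\<in>?H'. ?P x y z"
      unfolding cocycle_def by (meson DiffD1)
  qed
  then show ?thesis unfolding split e0 e1 e2 by blast
qed

end

section \<open>Being cohomologous is an equivalence relation\<close>

context comm_group
begin

text \<open>The bridge between differences, as they occur in coboundaries and coordinates, and the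
  inverse-free equations of \<open>cocycle\<close> and \<open>cohomologous\<close>.\<close>

lemma inv_cross_eq_iff:
  assumes "x \<in> carrier G" "y \<in> carrier G" "p \<in> carrier G" "q \<in> carrier G"
  shows "x \<otimes> inv p = y \<otimes> inv q \<longleftrightarrow> x \<otimes> q = y \<otimes> p"
proof -
  have "x \<otimes> inv p = y \<otimes> inv q \<longleftrightarrow> y \<otimes> inv q \<otimes> p = x"
    using assms inv_solve_right'[of "y \<otimes> inv q" x p] by (metis inv_closed m_closed)
  also have "y \<otimes> inv q \<otimes> p = y \<otimes> p \<otimes> inv q" using assms by (simp add: m_ac)
  also have "y \<otimes> p \<otimes> inv q = x \<longleftrightarrow> x \<otimes> q = y \<otimes> p"
    using assms inv_solve_right[of x "y \<otimes> p" q] by (metis m_closed)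
  finally show ?thesis .
qed

text \<open>Chains two comparisons through \<open>y\<close>. For transitivity this shows that the
  sum of the two functions \<theta> is a witness.\<close>

lemma eq_mult_trans:
  assumes "x \<otimes> q = y \<otimes> p" "y \<otimes> q' = z \<otimes> p'"
    and "x \<in> carrier G" "y \<in> carrier G" "z \<in> carrier G"
      "p \<in> carrier G" "q \<in> carrier G" "p' \<in> carrier G" "q' \<in> carrier G"
  shows "x \<otimes> (q \<otimes> q') = z \<otimes> (p \<otimes> p')"
proof -
  have "x \<otimes> (q \<otimes> q') = (x \<otimes> q) \<otimes> q'" using assms(3-) by (simp add: m_assoc)
  also have "\<dots> = (y \<otimes> q') \<otimes> p" unfolding assms(1) using assms(3-) by (simp add: m_ac)
  also have "\<dots> = z \<otimes> (p \<otimes> p')" unfolding assms(2) using assms(3-) by (simp add: m_ac)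
  finally show ?thesis .
qed

end

context lcs_action
begin

lemma cohomologous_refl:
  assumes "\<And>a b. \<lbrakk>a \<in> carrier H; b \<in> carrier H\<rbrakk> \<Longrightarrow> \<beta> a b \<in> carrier I \<and> \<gamma> a b \<in> carrier I"
  shows "cohomologous \<beta> \<gamma> \<beta> \<gamma>"
  unfolding cohomologous_def by (rule bexI[of _ "\<lambda>_. \<one>\<^bsub>I\<^esub>"]) (use assms in auto)

lemma cohomologous_sym:
  assumes "\<And>a b. \<lbrakk>a \<in> carrier H; b \<in> carrier H\<rbrakk> \<Longrightarrow> \<beta> a b \<in> carrier I \<and> \<gamma> a b \<in> carrier I"
    "\<And>a b. \<lbrakk>a \<in> carrier H; b \<in> carrier H\<rbrakk> \<Longrightarrow> \<beta>' a b \<in> carrier I \<and> \<gamma>' a b \<in> carrier I"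
    "cohomologous \<beta> \<gamma> \<beta>' \<gamma>'"
  shows "cohomologous \<beta>' \<gamma>' \<beta> \<gamma>"
proof -
  obtain \<theta> where t: "\<theta> \<in> carrier H \<rightarrow> carrier I" "\<theta> \<one>\<^bsub>H\<^esub> = \<one>\<^bsub>I\<^esub>"
    and e: "\<And>a b. \<lbrakk>a \<in> carrier H; b \<in> carrier H\<rbrakk> \<Longrightarrow>
      \<beta> a b \<otimes>\<^bsub>I\<^esub> \<theta> (a \<otimes>\<^bsub>H\<^esub> b) = \<beta>' a b \<otimes>\<^bsub>I\<^esub> (\<theta> a \<otimes>\<^bsub>I\<^esub> \<theta> b) \<and>
      \<gamma> a b \<otimes>\<^bsub>I\<^esub> dia a (\<theta> b) = \<gamma>' a b \<otimes>\<^bsub>I\<^esub> \<theta> (a \<cdot>\<^bsub>H\<^esub> b)"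
    using assms(3) unfolding cohomologous_def by blast
  have tc: "\<theta> a \<in> carrier I" if "a \<in> carrier H" for a using t(1) that by blast
  show ?thesis
    unfolding cohomologous_def
  proof (intro bexI[of _ "\<lambda>a. inv\<^bsub>I\<^esub> \<theta> a"] conjI ballI)
    fix a b assume ab: "a \<in> carrier H" "b \<in> carrier H"
    show "\<beta>' a b \<otimes>\<^bsub>I\<^esub> inv\<^bsub>I\<^esub> \<theta> (a \<otimes>\<^bsub>H\<^esub> b) = \<beta> a b \<otimes>\<^bsub>I\<^esub> (inv\<^bsub>I\<^esub> \<theta> a \<otimes>\<^bsub>I\<^esub> inv\<^bsub>I\<^esub> \<theta> b)"
      using I.inv_cross_eq_iff[of "\<beta>' a b" "\<beta> a b" "\<theta> (a \<otimes>\<^bsub>H\<^esub> b)" "\<theta> a \<otimes>\<^bsub>I\<^esub> \<theta> b"] e[OF ab] assms(1,2)[OF ab] tc ab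
      by (simp add: I.inv_mult)
    show "\<gamma>' a b \<otimes>\<^bsub>I\<^esub> dia a (inv\<^bsub>I\<^esub> \<theta> b) = \<gamma> a b \<otimes>\<^bsub>I\<^esub> inv\<^bsub>I\<^esub> \<theta> (a \<cdot>\<^bsub>H\<^esub> b)"
      using I.inv_cross_eq_iff[of "\<gamma>' a b" "\<gamma> a b" "dia a (\<theta> b)" "\<theta> (a \<cdot>\<^bsub>H\<^esub> b)"] e[OF ab] assms(1,2)[OF ab] tc ab
      by (simp add: dia_inv)
  qed (use t tc in auto)
qed

lemma cohomologous_trans:
  assumes "\<And>a b. \<lbrakk>a \<in> carrier H; b \<in> carrier H\<rbrakk> \<Longrightarrow> \<beta> a b \<in> carrier I \<and> \<gamma> a b \<in> carrier I"
    "\<And>a b. \<lbrakk>a \<in> carrier H; b \<in> carrier H\<rbrakk> \<Longrightarrow> \<beta>' a b \<in> carrier I \<and> \<gamma>' a b \<in> carrier I"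
    "\<And>a b. \<lbrakk>a \<in> carrier H; b \<in> carrier H\<rbrakk> \<Longrightarrow> \<beta>'' a b \<in> carrier I \<and> \<gamma>'' a b \<in> carrier I"
    "cohomologous \<beta> \<gamma> \<beta>' \<gamma>'" "cohomologous \<beta>' \<gamma>' \<beta>'' \<gamma>''"
  shows "cohomologous \<beta> \<gamma> \<beta>'' \<gamma>''"
proof -
  obtain \<theta> where t: "\<theta> \<in> carrier H \<rightarrow> carrier I" "\<theta> \<one>\<^bsub>H\<^esub> = \<one>\<^bsub>I\<^esub>"
    and e: "\<And>a b. \<lbrakk>a \<in> carrier H; b \<in> carrier H\<rbrakk> \<Longrightarrow>
      \<beta> a b \<otimes>\<^bsub>I\<^esub> \<theta> (a \<otimes>\<^bsub>H\<^esub> b) = \<beta>' a b \<otimes>\<^bsub>I\<^esub> (\<theta> a \<otimes>\<^bsub>I\<^esub> \<theta> b) \<and>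
      \<gamma> a b \<otimes>\<^bsub>I\<^esub> dia a (\<theta> b) = \<gamma>' a b \<otimes>\<^bsub>I\<^esub> \<theta> (a \<cdot>\<^bsub>H\<^esub> b)"
    using assms(4) unfolding cohomologous_def by blast
  obtain \<theta>' where t': "\<theta>' \<in> carrier H \<rightarrow> carrier I" "\<theta>' \<one>\<^bsub>H\<^esub> = \<one>\<^bsub>I\<^esub>"
    and e': "\<And>a b. \<lbrakk>a \<in> carrier H; b \<in> carrier H\<rbrakk> \<Longrightarrow>
      \<beta>' a b \<otimes>\<^bsub>I\<^esub> \<theta>' (a \<otimes>\<^bsub>H\<^esub> b) = \<beta>'' a b \<otimes>\<^bsub>I\<^esub> (\<theta>' a \<otimes>\<^bsub>I\<^esub> \<theta>' b) \<and>
      \<gamma>' a b \<otimes>\<^bsub>I\<^esub> dia a (\<theta>' b) = \<gamma>'' a b \<otimes>\<^bsub>I\<^esub> \<theta>' (a \<cdot>\<^bsub>H\<^esub> b)"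
    using assms(5) unfolding cohomologous_def by blast
  have tc: "\<theta> a \<in> carrier I" "\<theta>' a \<in> carrier I" if "a \<in> carrier H" for a using t(1) t'(1) that by blast+
  show ?thesis
    unfolding cohomologous_def
  proof (intro bexI[of _ "\<lambda>a. \<theta> a \<otimes>\<^bsub>I\<^esub> \<theta>' a"] conjI ballI)
    fix a b assume ab: "a \<in> carrier H" "b \<in> carrier H"
    have "\<beta> a b \<otimes>\<^bsub>I\<^esub> (\<theta> (a \<otimes>\<^bsub>H\<^esub> b) \<otimes>\<^bsub>I\<^esub> \<theta>' (a \<otimes>\<^bsub>H\<^esub> b)) =
        \<beta>'' a b \<otimes>\<^bsub>I\<^esub> ((\<theta> a \<otimes>\<^bsub>I\<^esub> \<theta> b) \<otimes>\<^bsub>I\<^esub> (\<theta>' a \<otimes>\<^bsub>I\<^esub> \<theta>' b))"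
      using e[OF ab] e'[OF ab] assms(1-3)[OF ab] tc ab by (intro I.eq_mult_trans[of _ _ "\<beta>' a b"]) auto
    then show "\<beta> a b \<otimes>\<^bsub>I\<^esub> (\<theta> (a \<otimes>\<^bsub>H\<^esub> b) \<otimes>\<^bsub>I\<^esub> \<theta>' (a \<otimes>\<^bsub>H\<^esub> b)) =
        \<beta>'' a b \<otimes>\<^bsub>I\<^esub> (\<theta> a \<otimes>\<^bsub>I\<^esub> \<theta>' a \<otimes>\<^bsub>I\<^esub> (\<theta> b \<otimes>\<^bsub>I\<^esub> \<theta>' b))"
      using tc ab by (simp add: I.m_ac)
    have "\<gamma> a b \<otimes>\<^bsub>I\<^esub> (dia a (\<theta> b) \<otimes>\<^bsub>I\<^esub> dia a (\<theta>' b)) = \<gamma>'' a b \<otimes>\<^bsub>I\<^esub> (\<theta> (a \<cdot>\<^bsub>H\<^esub> b) \<otimes>\<^bsub>I\<^esub> \<theta>' (a \<cdot>\<^bsub>H\<^esub> b))"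
      using e[OF ab] e'[OF ab] assms(1-3)[OF ab] tc ab by (intro I.eq_mult_trans[of _ _ "\<gamma>' a b"]) auto
    then show "\<gamma> a b \<otimes>\<^bsub>I\<^esub> dia a (\<theta> b \<otimes>\<^bsub>I\<^esub> \<theta>' b) = \<gamma>'' a b \<otimes>\<^bsub>I\<^esub> (\<theta> (a \<cdot>\<^bsub>H\<^esub> b) \<otimes>\<^bsub>I\<^esub> \<theta>' (a \<cdot>\<^bsub>H\<^esub> b))"
      using tc ab by (simp add: dia_add)
  qed (use t t' tc in auto)
qed

section \<open>Cohomology classes of degree two\<close>

abbreviation tot_cohomologous :: "(nat \<Rightarrow> ('h, 'i) cochain) \<Rightarrow> (nat \<Rightarrow> ('h, 'i) cochain) \<Rightarrow> bool" where
  "tot_cohomologous c c' \<equiv> cohomologous (beta c) (gamma c) (beta c') (gamma c')"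

text \<open>A degree-one cochain is the same as a normalized function \<theta> on \<open>H\<close>,
  as weight one carries no shuffle condition. Testing the coset equation on \<open>beta\<close> and
  \<open>gamma\<close> and clearing inverses leaves the two equations of
  \<open>cohomologous\<close>.\<close>

lemma mem_coboundary_coset_iff:
  assumes c: "c \<in> carrier (Tot H I 2)" and x: "x \<in> carrier (Tot H I 2)"
  shows "(\<exists>f\<in>carrier (Tot H I 1). x = Tot_d H I dia 1 f \<otimes>\<^bsub>Tot H I 2\<^esub> c) \<longleftrightarrow> tot_cohomologous x c"
proof -
  have iff1: "u = (p \<otimes>\<^bsub>I\<^esub> inv\<^bsub>I\<^esub> q \<otimes>\<^bsub>I\<^esub> r) \<otimes>\<^bsub>I\<^esub> v \<longleftrightarrow> u \<otimes>\<^bsub>I\<^esub> q = v \<otimes>\<^bsub>I\<^esub> (r \<otimes>\<^bsub>I\<^esub> p)"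
    if "u \<in> carrier I" "v \<in> carrier I" "p \<in> carrier I" "q \<in> carrier I" "r \<in> carrier I" for u v p q r
    using that I.inv_cross_eq_iff[of u "v \<otimes>\<^bsub>I\<^esub> (r \<otimes>\<^bsub>I\<^esub> p)" "\<one>\<^bsub>I\<^esub>" q] by (simp add: I.m_ac)
  have iff2: "u = (q \<otimes>\<^bsub>I\<^esub> inv\<^bsub>I\<^esub> d) \<otimes>\<^bsub>I\<^esub> v \<longleftrightarrow> u \<otimes>\<^bsub>I\<^esub> d = v \<otimes>\<^bsub>I\<^esub> q"
    if "u \<in> carrier I" "v \<in> carrier I" "q \<in> carrier I" "d \<in> carrier I" for u v q d
    using that I.inv_cross_eq_iff[of u "v \<otimes>\<^bsub>I\<^esub> q" "\<one>\<^bsub>I\<^esub>" d] by (simp add: I.m_ac)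
  note clo = beta_gamma_normalized(1,2)[OF c] beta_gamma_normalized(1,2)[OF x]
  have eq: "x = Tot_d H I dia 1 f \<otimes>\<^bsub>Tot H I 2\<^esub> c \<longleftrightarrow> (\<forall>a\<in>carrier H. \<forall>b\<in>carrier H.
      beta x a b \<otimes>\<^bsub>I\<^esub> \<theta> (a \<otimes>\<^bsub>H\<^esub> b) = beta c a b \<otimes>\<^bsub>I\<^esub> (\<theta> a \<otimes>\<^bsub>I\<^esub> \<theta> b) \<and>
      gamma x a b \<otimes>\<^bsub>I\<^esub> dia a (\<theta> b) = gamma c a b \<otimes>\<^bsub>I\<^esub> \<theta> (a \<cdot>\<^bsub>H\<^esub> b))"
    if f: "f \<in> carrier (Tot H I 1)" and \<theta>: "\<And>a. a \<in> carrier H \<Longrightarrow> \<theta> a = cval H I (f 0) [] [a]" for f \<theta>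
  proof -
    have tc: "\<theta> a \<in> carrier I" if "a \<in> carrier H" for a
      unfolding \<theta>[OF that] using f that unfolding carrier_Tot_1 by (intro cval_closed_01) auto
    have d: "Tot_d H I dia 1 f \<in> carrier (Tot H I 2)" by (rule Tot_d_1(1)[OF f])
    have "x = Tot_d H I dia 1 f \<otimes>\<^bsub>Tot H I 2\<^esub> c \<longleftrightarrow> (\<forall>a\<in>carrier H. \<forall>b\<in>carrier H.
        beta x a b = beta (Tot_d H I dia 1 f \<otimes>\<^bsub>Tot H I 2\<^esub> c) a b \<and>
        gamma x a b = gamma (Tot_d H I dia 1 f \<otimes>\<^bsub>Tot H I 2\<^esub> c) a b)"
      using Tot_2_eqI[OF x Tot_2_mult(1)[OF d c]] by auto
    also have "\<dots> \<longleftrightarrow> (\<forall>a\<in>carrier H. \<forall>b\<in>carrier H.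
        beta x a b \<otimes>\<^bsub>I\<^esub> \<theta> (a \<otimes>\<^bsub>H\<^esub> b) = beta c a b \<otimes>\<^bsub>I\<^esub> (\<theta> a \<otimes>\<^bsub>I\<^esub> \<theta> b) \<and>
        gamma x a b \<otimes>\<^bsub>I\<^esub> dia a (\<theta> b) = gamma c a b \<otimes>\<^bsub>I\<^esub> \<theta> (a \<cdot>\<^bsub>H\<^esub> b))"
      by (intro ball_cong refl)
        (simp add: Tot_2_mult(2,3)[OF d c] Tot_d_1(2,3)[OF f] tc clo iff1 iff2 del: One_nat_def flip: \<theta>)
    finally show ?thesis .
  qed
  show ?thesis
  proof
    assume "\<exists>f\<in>carrier (Tot H I 1). x = Tot_d H I dia 1 f \<otimes>\<^bsub>Tot H I 2\<^esub> c"
    then obtain f where f: "f \<in> carrier (Tot H I 1)" "x = Tot_d H I dia 1 f \<otimes>\<^bsub>Tot H I 2\<^esub> c" by blast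
    show "tot_cohomologous x c"
      unfolding cohomologous_def
    proof (intro bexI[of _ "\<lambda>a. cval H I (f 0) [] [a]"] conjI)
      show "(\<lambda>a. cval H I (f 0) [] [a]) \<in> carrier H \<rightarrow> carrier I"
        using f(1) unfolding carrier_Tot_1 by (intro funcsetI cval_closed_01) auto
    qed (use eq[OF f(1) refl] f(2) in \<open>simp_all add: cval_zero\<close>)
  next
    assume "tot_cohomologous x c"
    then obtain \<theta> where t: "\<theta> \<in> carrier H \<rightarrow> carrier I" "\<theta> \<one>\<^bsub>H\<^esub> = \<one>\<^bsub>I\<^esub>"
      and e: "\<forall>a\<in>carrier H. \<forall>b\<in>carrier H.
        beta x a b \<otimes>\<^bsub>I\<^esub> \<theta> (a \<otimes>\<^bsub>H\<^esub> b) = beta c a b \<otimes>\<^bsub>I\<^esub> (\<theta> a \<otimes>\<^bsub>I\<^esub> \<theta> b) \<and>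
        gamma x a b \<otimes>\<^bsub>I\<^esub> dia a (\<theta> b) = gamma c a b \<otimes>\<^bsub>I\<^esub> \<theta> (a \<cdot>\<^bsub>H\<^esub> b)"
      unfolding cohomologous_def by blast
    have "\<exists>g\<in>carrier (cochain_group H I 0 1). \<forall>hs\<in>tuples H 0. \<forall>ks\<in>tuples H 1.
        cval H I g hs ks = \<theta> (hd ks)"
      by (rule cochain_exists[OF I.comm_group_axioms])
        (use t(1) in \<open>auto simp: tuples_1_2_3_iff simp del: One_nat_def elim: no_shuffles_1\<close>)
    then obtain g where g: "g \<in> carrier (cochain_group H I 0 1)"
      "\<And>ks. ks \<in> tuples H 1 \<Longrightarrow> cval H I g [] ks = \<theta> (hd ks)" by auto
    let ?f = "\<lambda>r\<in>{..<1::nat}. g"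
    have f: "?f \<in> carrier (Tot H I 1)" using g(1) unfolding carrier_Tot_1 by simp
    have "\<theta> a = cval H I (?f 0) [] [a]" if "a \<in> carrier H" for a
    proof (cases "a = \<one>\<^bsub>H\<^esub>")
      case True
      then show ?thesis using t(2) by (simp add: cval_zero)
    next
      case False
      then have "[a] \<in> tuples H 1" using that by (auto simp: tuples_1_2_3_iff simp del: One_nat_def)
      then show ?thesis by (simp add: g(2))
    qed
    from eq[OF f this] e f show "\<exists>f\<in>carrier (Tot H I 1). x = Tot_d H I dia 1 f \<otimes>\<^bsub>Tot H I 2\<^esub> c" by blast
  qed
qed

abbreviation Z2 :: "(nat \<Rightarrow> ('h, 'i) cochain) set" where
  "Z2 \<equiv> {c \<in> carrier (Tot H I 2). cocycle (beta c) (gamma c)}"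

text \<open>The quotient consists of right cosets of the image of the differential, one for each
  cocycle \<open>c\<close>; \<open>mem_coboundary_coset_iff\<close> identifies such a coset inside
  \<open>Tot H I 2\<close>.\<close>

lemma carrier_cohomology_2:
  "carrier (cohomology H I dia 2) = (\<lambda>c. {x \<in> carrier (Tot H I 2). tot_cohomologous x c}) ` Z2"
proof -
  let ?K = "kernel (Tot H I 2) (Tot H I (2 + 1)) (Tot_d H I dia 2)"
  let ?N = "Tot_d H I dia (2 - 1) ` carrier (Tot H I (2 - 1))"
  let ?G = "(Tot H I 2)\<lparr>carrier := ?K\<rparr>"
  have K: "?K = Z2"
    unfolding kernel_def using Tot_d_2_eq_one_iff by auto
  have "?N #>\<^bsub>?G\<^esub> c = {x \<in> carrier (Tot H I 2). tot_cohomologous x c}" if "c \<in> carrier (Tot H I 2)" for c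
  proof -
    have "2 - 1 = (1::nat)" by simp
    then have "?N #>\<^bsub>?G\<^esub> c = {x. \<exists>f\<in>carrier (Tot H I 1). x = Tot_d H I dia 1 f \<otimes>\<^bsub>Tot H I 2\<^esub> c}"
      by (simp only: r_coset_def) auto
    also have "\<dots> = {x \<in> carrier (Tot H I 2). tot_cohomologous x c}"
      using mem_coboundary_coset_iff[OF that] Tot_2_mult(1)[OF Tot_d_1(1) that] by blast
    finally show ?thesis .
  qed
  then show ?thesis
    unfolding cohomology_def carrier_FactGroup K by (auto simp: image_iff)
qed

end

section \<open>Extensions and their cocycles\<close>

text \<open>\<open>P\<close> is a correspondence, total on both sides, under which \<open>r\<close>
  matches equality of \<open>g\<close>. After choosing a partner \<open>q x\<close> for each
  \<open>x\<close>, the relation \<open>r\<close> is the kernel of \<open>g\<close> composed with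
  \<open>q\<close>; hence it is an equivalence, its classes are fibres, and the induced map is
  injective. For extensions, \<open>q\<close> amounts to choosing a section and its cocycle.\<close>

lemma bij_betw_quotient:
  assumes "\<And>x. x \<in> X \<Longrightarrow> \<exists>y\<in>Y. P x y" "\<And>y. y \<in> Y \<Longrightarrow> \<exists>x\<in>X. P x y"
    and iff: "\<And>x y x' y'. \<lbrakk>x \<in> X; y \<in> Y; x' \<in> X; y' \<in> Y; P x y; P x' y'\<rbrakk> \<Longrightarrow> (x, x') \<in> r \<longleftrightarrow> g y = g y'"
    and r: "r \<subseteq> X \<times> X"
  shows "\<exists>\<Phi>. bij_betw \<Phi> (X // r) (g ` Y)"
proof -
  obtain q where q: "\<And>x. x \<in> X \<Longrightarrow> q x \<in> Y \<and> P x (q x)" using assms(1) by metis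
  have rq: "(x, x') \<in> r \<longleftrightarrow> g (q x) = g (q x')" if "x \<in> X" "x' \<in> X" for x x'
    using iff[of x "q x" x' "q x'"] q that by blast
  have cls: "r `` {x} = {x' \<in> X. g (q x') = g (q x)}" if "x \<in> X" for x
    using r rq[OF that] by auto
  let ?\<Phi> = "\<lambda>C. g (q (SOME x. x \<in> C))"
  have \<Phi>: "?\<Phi> (r `` {x}) = g (q x)" if "x \<in> X" for x
  proof -
    have "x \<in> r `` {x}" using that cls by simp
    then have "(SOME x'. x' \<in> r `` {x}) \<in> r `` {x}" by (rule someI)
    then show ?thesis unfolding cls[OF that] by blast
  qed
  have "bij_betw ?\<Phi> (X // r) (g ` Y)"
    unfolding bij_betw_def
  proof
    show "inj_on ?\<Phi> (X // r)"
    proof (rule inj_onI)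
      fix C D assume "C \<in> X // r" "D \<in> X // r" and eq: "?\<Phi> C = ?\<Phi> D"
      then obtain x y where xy: "x \<in> X" "C = r `` {x}" "y \<in> X" "D = r `` {y}"
        by (auto elim!: quotientE)
      then have "g (q x) = g (q y)" using \<Phi>[OF xy(1)] \<Phi>[OF xy(3)] eq by (simp only: xy)
      then show "C = D" unfolding xy(2,4) cls[OF xy(1)] cls[OF xy(3)] by simp
    qed
    have "?\<Phi> ` (X // r) = (\<lambda>x. g (q x)) ` X"
      unfolding quotient_def using \<Phi> by (auto simp: image_iff)
    also have "\<dots> = g ` Y"
    proof
      show "g ` Y \<subseteq> (\<lambda>x. g (q x)) ` X"
      proof
        fix z assume "z \<in> g ` Y"
        then obtain y x where "y \<in> Y" "z = g y" "x \<in> X" "P x y" using assms(2) by blast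
        \<comment> \<open>Both \<open>y\<close> and \<open>q x\<close> are partners of
          \<open>x\<close>, so reflexivity of \<open>r\<close> at \<open>x\<close> forces their
          images under \<open>g\<close> to agree.\<close>
        moreover from this have "g (q x) = g y" using iff[of x "q x" x y] rq[of x x] q by blast
        ultimately show "z \<in> (\<lambda>x. g (q x)) ` X" by (intro image_eqI[of _ _ x]) simp_all
      qed
    qed (use q in auto)
    finally show "?\<Phi> ` (X // r) = g ` Y" .
  qed
  then show ?thesis by blast
qed

section \<open>An extension in the coordinates given by a section\<close>

context lcs_action
begin

text \<open>The section is existentially quantified, so one extension is related to the pairs of all
  its normalized sections. Keeping \<gamma> on the left of its equation absorbs the minus sign and
  avoids inverses.\<close>

definition represents ::
    "('h, 'i, 'b) extension \<Rightarrow> ('h \<Rightarrow> 'h \<Rightarrow> 'i) \<Rightarrow> ('h \<Rightarrow> 'h \<Rightarrow> 'i) \<Rightarrow> bool" where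
  "represents = (\<lambda>(\<iota>, B, \<pi>) \<beta> \<gamma>. \<exists>s. normalized_section H B \<pi> s \<and>
     (\<forall>a\<in>carrier H. \<forall>b\<in>carrier H. \<beta> a b \<in> carrier I \<and> \<gamma> a b \<in> carrier I \<and>
        s a \<otimes>\<^bsub>B\<^esub> s b = \<iota> (\<beta> a b) \<otimes>\<^bsub>B\<^esub> s (a \<otimes>\<^bsub>H\<^esub> b) \<and>
        \<iota> (\<gamma> a b) \<otimes>\<^bsub>B\<^esub> (s a \<cdot>\<^bsub>B\<^esub> s b) = s (a \<cdot>\<^bsub>H\<^esub> b)))"

end

locale sectioned_extension = lcs_action H I dia
  for H :: "'h lcs" and I :: "'i lcs" and dia +
  fixes \<iota> :: "'i \<Rightarrow> 'b" and B :: "'b lcs" and \<pi> :: "'b \<Rightarrow> 'h" and s :: "'h \<Rightarrow> 'b"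
  assumes ext: "(\<iota>, B, \<pi>) \<in> extensions H I dia" and sec: "normalized_section H B \<pi> s"
begin

sublocale B: linear_cycle_set B
  using ext by (simp add: extensions_def is_extension_def)

lemma iota_hom: "\<iota> \<in> hom I B" and pi_hom: "\<pi> \<in> hom B H"
  using ext by (auto simp: extensions_def is_extension_def lcs_hom_def)

sublocale iota: group_hom I B \<iota>
  using iota_hom by unfold_locales

sublocale pi: group_hom B H \<pi>
  using pi_hom by unfold_locales

lemma pi_dot [simp]: "\<lbrakk>x \<in> carrier B; x' \<in> carrier B\<rbrakk> \<Longrightarrow> \<pi> (x \<cdot>\<^bsub>B\<^esub> x') = \<pi> x \<cdot>\<^bsub>H\<^esub> \<pi> x'"
  using ext by (auto simp: extensions_def is_extension_def lcs_hom_def)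

lemma iota_eq_iff [simp]: "\<lbrakk>y \<in> carrier I; y' \<in> carrier I\<rbrakk> \<Longrightarrow> \<iota> y = \<iota> y' \<longleftrightarrow> y = y'"
  using ext by (auto simp: extensions_def is_extension_def dest: inj_onD)

lemma image_iota: "\<iota> ` carrier I = kernel B H \<pi>"
  using ext by (auto simp: extensions_def is_extension_def)

lemma pi_iota [simp]: "y \<in> carrier I \<Longrightarrow> \<pi> (\<iota> y) = \<one>\<^bsub>H\<^esub>"
  using image_iota by (auto simp: kernel_def)

lemma iota_dot_iota [simp]: "\<lbrakk>y \<in> carrier I; y' \<in> carrier I\<rbrakk> \<Longrightarrow> \<iota> y \<cdot>\<^bsub>B\<^esub> \<iota> y' = \<iota> y'"
  using ext I_trivial by (auto simp: extensions_def is_extension_def lcs_hom_def lcs_trivial_def)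

lemma s_closed [simp]: "h \<in> carrier H \<Longrightarrow> s h \<in> carrier B"
  and pi_s [simp]: "h \<in> carrier H \<Longrightarrow> \<pi> (s h) = h"
  and s_one [simp]: "s \<one>\<^bsub>H\<^esub> = \<one>\<^bsub>B\<^esub>"
  using sec by (auto simp: normalized_section_def)

lemma s_dot_iota [simp]: "\<lbrakk>h \<in> carrier H; y \<in> carrier I\<rbrakk> \<Longrightarrow> s h \<cdot>\<^bsub>B\<^esub> \<iota> y = \<iota> (dia h y)"
  using ext sec by (auto simp: extensions_def)

lemma iota_dot_s [simp]: "\<lbrakk>h \<in> carrier H; y \<in> carrier I\<rbrakk> \<Longrightarrow> \<iota> y \<cdot>\<^bsub>B\<^esub> s h = s h"
  using ext sec B.mult_inv_eq_one_iff[of "\<iota> y \<cdot>\<^bsub>B\<^esub> s h" "s h"] by (auto simp: extensions_def)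

text \<open>Subtracting \<open>s (\<pi> x)\<close> lands in the kernel of \<pi>, which is the image
  of \<iota>. Together with \<open>coords_eq_iff\<close> this gives coordinates in I \<times> H, in
  which identities of \<open>B\<close> are compared.\<close>

lemma coords_exist:
  assumes x: "x \<in> carrier B"
  shows "\<exists>y\<in>carrier I. x = \<iota> y \<otimes>\<^bsub>B\<^esub> s (\<pi> x)"
proof -
  have "x \<otimes>\<^bsub>B\<^esub> inv\<^bsub>B\<^esub> s (\<pi> x) \<in> kernel B H \<pi>"
    using x by (simp add: kernel_def)
  then obtain y where "y \<in> carrier I" "\<iota> y = x \<otimes>\<^bsub>B\<^esub> inv\<^bsub>B\<^esub> s (\<pi> x)"
    unfolding image_iota[symmetric] by auto
  then show ?thesis using x by (intro bexI[of _ y]) (simp_all add: B.m_assoc)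
qed

lemma coords_eq_iff:
  assumes "y \<in> carrier I" "y' \<in> carrier I" "a \<in> carrier H" "b \<in> carrier H"
  shows "\<iota> y \<otimes>\<^bsub>B\<^esub> s a = \<iota> y' \<otimes>\<^bsub>B\<^esub> s b \<longleftrightarrow> y = y' \<and> a = b"
proof
  assume eq: "\<iota> y \<otimes>\<^bsub>B\<^esub> s a = \<iota> y' \<otimes>\<^bsub>B\<^esub> s b"
  have "\<pi> (\<iota> y \<otimes>\<^bsub>B\<^esub> s a) = \<pi> (\<iota> y' \<otimes>\<^bsub>B\<^esub> s b)" by (simp only: eq)
  then have "a = b" using assms by simp
  moreover have "y = y'" using eq assms unfolding \<open>a = b\<close> by simp
  ultimately show "y = y' \<and> a = b" by simp
qed simp

text \<open>Adding \<open>\<iota> y\<close> does not change the action, since \<open>(\<iota> y + x) \<cdot> z = (\<iota> y \<cdot> x) \<cdot> (\<iota> y \<cdot> z)\<close>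
  and \<open>\<iota> y\<close> acts trivially.\<close>

lemma iota_mult_dot:
  assumes "y \<in> carrier I" "y' \<in> carrier I" "a \<in> carrier H" "b \<in> carrier H"
  shows "(\<iota> y \<otimes>\<^bsub>B\<^esub> s a) \<cdot>\<^bsub>B\<^esub> (\<iota> y' \<otimes>\<^bsub>B\<^esub> s b) = \<iota> (dia a y') \<otimes>\<^bsub>B\<^esub> (s a \<cdot>\<^bsub>B\<^esub> s b)"
  using assms by (simp add: B.dot_cycle B.dot_distrib)

end

locale represented_extension = sectioned_extension H I dia \<iota> B \<pi> s
  for H :: "'h lcs" and I :: "'i lcs" and dia and \<iota> :: "'i \<Rightarrow> 'b" and B \<pi> s +
  fixes \<beta> \<gamma>
  assumes beta_closed [simp]: "\<lbrakk>a \<in> carrier H; b \<in> carrier H\<rbrakk> \<Longrightarrow> \<beta> a b \<in> carrier I"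
    and gamma_closed [simp]: "\<lbrakk>a \<in> carrier H; b \<in> carrier H\<rbrakk> \<Longrightarrow> \<gamma> a b \<in> carrier I"
    and s_mult: "\<lbrakk>a \<in> carrier H; b \<in> carrier H\<rbrakk> \<Longrightarrow> s a \<otimes>\<^bsub>B\<^esub> s b = \<iota> (\<beta> a b) \<otimes>\<^bsub>B\<^esub> s (a \<otimes>\<^bsub>H\<^esub> b)"
    and s_dot_s: "\<lbrakk>a \<in> carrier H; b \<in> carrier H\<rbrakk> \<Longrightarrow> \<iota> (\<gamma> a b) \<otimes>\<^bsub>B\<^esub> (s a \<cdot>\<^bsub>B\<^esub> s b) = s (a \<cdot>\<^bsub>H\<^esub> b)"
begin

lemma s_dot: "\<lbrakk>a \<in> carrier H; b \<in> carrier H\<rbrakk> \<Longrightarrow> s a \<cdot>\<^bsub>B\<^esub> s b = \<iota> (inv\<^bsub>I\<^esub> \<gamma> a b) \<otimes>\<^bsub>B\<^esub> s (a \<cdot>\<^bsub>H\<^esub> b)"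
  by (simp flip: s_dot_s B.m_assoc)

lemma mult_coords:
  assumes "y \<in> carrier I" "y' \<in> carrier I" "a \<in> carrier H" "b \<in> carrier H"
  shows "(\<iota> y \<otimes>\<^bsub>B\<^esub> s a) \<otimes>\<^bsub>B\<^esub> (\<iota> y' \<otimes>\<^bsub>B\<^esub> s b) =
    \<iota> (y \<otimes>\<^bsub>I\<^esub> y' \<otimes>\<^bsub>I\<^esub> \<beta> a b) \<otimes>\<^bsub>B\<^esub> s (a \<otimes>\<^bsub>H\<^esub> b)"
proof -
  have "(\<iota> y \<otimes>\<^bsub>B\<^esub> s a) \<otimes>\<^bsub>B\<^esub> (\<iota> y' \<otimes>\<^bsub>B\<^esub> s b) = (\<iota> y \<otimes>\<^bsub>B\<^esub> \<iota> y') \<otimes>\<^bsub>B\<^esub> (s a \<otimes>\<^bsub>B\<^esub> s b)"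
    using assms by (simp add: B.m_ac)
  then show ?thesis using assms by (simp add: s_mult B.m_assoc)
qed

lemma dot_coords:
  assumes "y \<in> carrier I" "y' \<in> carrier I" "a \<in> carrier H" "b \<in> carrier H"
  shows "(\<iota> y \<otimes>\<^bsub>B\<^esub> s a) \<cdot>\<^bsub>B\<^esub> (\<iota> y' \<otimes>\<^bsub>B\<^esub> s b) =
    \<iota> (dia a y' \<otimes>\<^bsub>I\<^esub> inv\<^bsub>I\<^esub> \<gamma> a b) \<otimes>\<^bsub>B\<^esub> s (a \<cdot>\<^bsub>H\<^esub> b)"
  using assms by (simp add: iota_mult_dot s_dot B.m_assoc)

lemma represents: "represents (\<iota>, B, \<pi>) \<beta> \<gamma>"
  unfolding represents_def using sec s_mult s_dot_s by (auto intro!: exI[of _ s])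

text \<open>Both sides of an axiom of \<open>B\<close> at values of \<open>s\<close> are put into
  coordinates, and their components in \<open>I\<close> are compared. Normalization comes from
  \<open>s\<close> sending zero to zero, symmetry from commutativity of \<open>B\<close>.\<close>

lemma cocycle: "cocycle \<beta> \<gamma>"
proof -
  have coordsI: "y = y'" if "\<iota> y \<otimes>\<^bsub>B\<^esub> s a = \<iota> y' \<otimes>\<^bsub>B\<^esub> s b" "y \<in> carrier I" "y' \<in> carrier I"
    "a \<in> carrier H" "b \<in> carrier H" for y y' a b
    using that coords_eq_iff by blast
  have s1: "s a = \<iota> \<one>\<^bsub>I\<^esub> \<otimes>\<^bsub>B\<^esub> s a" if "a \<in> carrier H" for a using that by simp
  have comm: "\<beta> a b = \<beta> b a" if "a \<in> carrier H" "b \<in> carrier H" for a b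
    using that s_mult[of a b] s_mult[of b a] B.m_comm[of "s a" "s b"]
    by (intro coordsI[of "\<beta> a b" "a \<otimes>\<^bsub>H\<^esub> b" "\<beta> b a" "b \<otimes>\<^bsub>H\<^esub> a"]) auto
  have zero: "\<beta> \<one>\<^bsub>H\<^esub> a = \<one>\<^bsub>I\<^esub>" "\<gamma> \<one>\<^bsub>H\<^esub> a = \<one>\<^bsub>I\<^esub>" "\<gamma> a \<one>\<^bsub>H\<^esub> = \<one>\<^bsub>I\<^esub>" if "a \<in> carrier H" for a
  proof -
    show "\<beta> \<one>\<^bsub>H\<^esub> a = \<one>\<^bsub>I\<^esub>"
      using that s_mult[of "\<one>\<^bsub>H\<^esub>" a] by (intro coordsI[of _ a _ a]) auto
    show "\<gamma> \<one>\<^bsub>H\<^esub> a = \<one>\<^bsub>I\<^esub>"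
      using that s_dot_s[of "\<one>\<^bsub>H\<^esub>" a] by (intro coordsI[of _ a _ a]) auto
    show "\<gamma> a \<one>\<^bsub>H\<^esub> = \<one>\<^bsub>I\<^esub>"
      using that s_dot_s[of a "\<one>\<^bsub>H\<^esub>"] by (intro coordsI[of _ "\<one>\<^bsub>H\<^esub>" _ "\<one>\<^bsub>H\<^esub>"]) auto
  qed
  have A: "\<beta> b c \<otimes>\<^bsub>I\<^esub> \<beta> a (b \<otimes>\<^bsub>H\<^esub> c) = \<beta> (a \<otimes>\<^bsub>H\<^esub> b) c \<otimes>\<^bsub>I\<^esub> \<beta> a b"
    if "a \<in> carrier H" "b \<in> carrier H" "c \<in> carrier H" for a b c
  proof (rule coordsI)
    have "\<iota> (\<beta> b c \<otimes>\<^bsub>I\<^esub> \<beta> a (b \<otimes>\<^bsub>H\<^esub> c)) \<otimes>\<^bsub>B\<^esub> s (a \<otimes>\<^bsub>H\<^esub> (b \<otimes>\<^bsub>H\<^esub> c)) = s a \<otimes>\<^bsub>B\<^esub> (s b \<otimes>\<^bsub>B\<^esub> s c)"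
      using that mult_coords[of "\<one>\<^bsub>I\<^esub>" "\<beta> b c" a "b \<otimes>\<^bsub>H\<^esub> c"] by (simp add: s_mult)
    also have "\<dots> = (s a \<otimes>\<^bsub>B\<^esub> s b) \<otimes>\<^bsub>B\<^esub> s c" using that by (simp add: B.m_assoc)
    also have "\<dots> = \<iota> (\<beta> (a \<otimes>\<^bsub>H\<^esub> b) c \<otimes>\<^bsub>I\<^esub> \<beta> a b) \<otimes>\<^bsub>B\<^esub> s (a \<otimes>\<^bsub>H\<^esub> b \<otimes>\<^bsub>H\<^esub> c)"
      using that mult_coords[of "\<beta> a b" "\<one>\<^bsub>I\<^esub>" "a \<otimes>\<^bsub>H\<^esub> b" c] I.m_comm[of "\<beta> a b" "\<beta> (a \<otimes>\<^bsub>H\<^esub> b) c"]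
      by (simp add: s_mult)
    finally show "\<iota> (\<beta> b c \<otimes>\<^bsub>I\<^esub> \<beta> a (b \<otimes>\<^bsub>H\<^esub> c)) \<otimes>\<^bsub>B\<^esub> s (a \<otimes>\<^bsub>H\<^esub> (b \<otimes>\<^bsub>H\<^esub> c)) =
      \<iota> (\<beta> (a \<otimes>\<^bsub>H\<^esub> b) c \<otimes>\<^bsub>I\<^esub> \<beta> a b) \<otimes>\<^bsub>B\<^esub> s (a \<otimes>\<^bsub>H\<^esub> b \<otimes>\<^bsub>H\<^esub> c)" .
  qed (use that in simp_all)
  have Bq: "dia a (\<beta> b c) \<otimes>\<^bsub>I\<^esub> (\<gamma> a b \<otimes>\<^bsub>I\<^esub> \<gamma> a c) = \<beta> (a \<cdot>\<^bsub>H\<^esub> b) (a \<cdot>\<^bsub>H\<^esub> c) \<otimes>\<^bsub>I\<^esub> \<gamma> a (b \<otimes>\<^bsub>H\<^esub> c)"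
    if "a \<in> carrier H" "b \<in> carrier H" "c \<in> carrier H" for a b c
  proof -
    \<comment> \<open>The dot of two section values has coordinate - \<gamma>, so distributivity
      first appears with differences; clearing them gives the second cocycle equation.\<close>
    have "dia a (\<beta> b c) \<otimes>\<^bsub>I\<^esub> inv\<^bsub>I\<^esub> \<gamma> a (b \<otimes>\<^bsub>H\<^esub> c) =
        \<beta> (a \<cdot>\<^bsub>H\<^esub> b) (a \<cdot>\<^bsub>H\<^esub> c) \<otimes>\<^bsub>I\<^esub> inv\<^bsub>I\<^esub> (\<gamma> a b \<otimes>\<^bsub>I\<^esub> \<gamma> a c)"
    proof (rule coordsI)
      have "\<iota> (dia a (\<beta> b c) \<otimes>\<^bsub>I\<^esub> inv\<^bsub>I\<^esub> \<gamma> a (b \<otimes>\<^bsub>H\<^esub> c)) \<otimes>\<^bsub>B\<^esub> s (a \<cdot>\<^bsub>H\<^esub> (b \<otimes>\<^bsub>H\<^esub> c)) =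
          s a \<cdot>\<^bsub>B\<^esub> (s b \<otimes>\<^bsub>B\<^esub> s c)"
        using that dot_coords[of "\<one>\<^bsub>I\<^esub>" "\<beta> b c" a "b \<otimes>\<^bsub>H\<^esub> c"] by (simp add: s_mult)
      also have "\<dots> = (s a \<cdot>\<^bsub>B\<^esub> s b) \<otimes>\<^bsub>B\<^esub> (s a \<cdot>\<^bsub>B\<^esub> s c)" using that by (simp add: B.dot_distrib)
      also have "\<dots> = \<iota> (inv\<^bsub>I\<^esub> \<gamma> a b \<otimes>\<^bsub>I\<^esub> inv\<^bsub>I\<^esub> \<gamma> a c \<otimes>\<^bsub>I\<^esub> \<beta> (a \<cdot>\<^bsub>H\<^esub> b) (a \<cdot>\<^bsub>H\<^esub> c)) \<otimes>\<^bsub>B\<^esub>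
          s ((a \<cdot>\<^bsub>H\<^esub> b) \<otimes>\<^bsub>H\<^esub> (a \<cdot>\<^bsub>H\<^esub> c))"
        using that mult_coords[of "inv\<^bsub>I\<^esub> \<gamma> a b" "inv\<^bsub>I\<^esub> \<gamma> a c" "a \<cdot>\<^bsub>H\<^esub> b" "a \<cdot>\<^bsub>H\<^esub> c"] by (simp add: s_dot)
      also have "inv\<^bsub>I\<^esub> \<gamma> a b \<otimes>\<^bsub>I\<^esub> inv\<^bsub>I\<^esub> \<gamma> a c \<otimes>\<^bsub>I\<^esub> \<beta> (a \<cdot>\<^bsub>H\<^esub> b) (a \<cdot>\<^bsub>H\<^esub> c) =
          \<beta> (a \<cdot>\<^bsub>H\<^esub> b) (a \<cdot>\<^bsub>H\<^esub> c) \<otimes>\<^bsub>I\<^esub> inv\<^bsub>I\<^esub> (\<gamma> a b \<otimes>\<^bsub>I\<^esub> \<gamma> a c)"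
        using that by (simp add: I.inv_mult I.m_ac)
      finally show "\<iota> (dia a (\<beta> b c) \<otimes>\<^bsub>I\<^esub> inv\<^bsub>I\<^esub> \<gamma> a (b \<otimes>\<^bsub>H\<^esub> c)) \<otimes>\<^bsub>B\<^esub> s (a \<cdot>\<^bsub>H\<^esub> (b \<otimes>\<^bsub>H\<^esub> c)) =
          \<iota> (\<beta> (a \<cdot>\<^bsub>H\<^esub> b) (a \<cdot>\<^bsub>H\<^esub> c) \<otimes>\<^bsub>I\<^esub> inv\<^bsub>I\<^esub> (\<gamma> a b \<otimes>\<^bsub>I\<^esub> \<gamma> a c)) \<otimes>\<^bsub>B\<^esub>
          s ((a \<cdot>\<^bsub>H\<^esub> b) \<otimes>\<^bsub>H\<^esub> (a \<cdot>\<^bsub>H\<^esub> c))" .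
    qed (use that in simp_all)
    then show ?thesis using that by (subst (asm) I.inv_cross_eq_iff) simp_all
  qed
  have C: "\<gamma> (a \<cdot>\<^bsub>H\<^esub> b) (a \<cdot>\<^bsub>H\<^esub> c) \<otimes>\<^bsub>I\<^esub> dia (a \<cdot>\<^bsub>H\<^esub> b) (\<gamma> a c) = \<gamma> (a \<otimes>\<^bsub>H\<^esub> b) c"
    if "a \<in> carrier H" "b \<in> carrier H" "c \<in> carrier H" for a b c
  proof -
    \<comment> \<open>The cycle law at \<open>s a\<close>, \<open>s b\<close>, \<open>s c\<close>
      yields the negative of the third cocycle equation, which is inverted afterwards.\<close>
    have "dia (a \<cdot>\<^bsub>H\<^esub> b) (inv\<^bsub>I\<^esub> \<gamma> a c) \<otimes>\<^bsub>I\<^esub> inv\<^bsub>I\<^esub> \<gamma> (a \<cdot>\<^bsub>H\<^esub> b) (a \<cdot>\<^bsub>H\<^esub> c) = inv\<^bsub>I\<^esub> \<gamma> (a \<otimes>\<^bsub>H\<^esub> b) c"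
    proof (rule coordsI)
      have "\<iota> (dia (a \<cdot>\<^bsub>H\<^esub> b) (inv\<^bsub>I\<^esub> \<gamma> a c) \<otimes>\<^bsub>I\<^esub> inv\<^bsub>I\<^esub> \<gamma> (a \<cdot>\<^bsub>H\<^esub> b) (a \<cdot>\<^bsub>H\<^esub> c)) \<otimes>\<^bsub>B\<^esub>
          s ((a \<cdot>\<^bsub>H\<^esub> b) \<cdot>\<^bsub>H\<^esub> (a \<cdot>\<^bsub>H\<^esub> c)) = (s a \<cdot>\<^bsub>B\<^esub> s b) \<cdot>\<^bsub>B\<^esub> (s a \<cdot>\<^bsub>B\<^esub> s c)"
        using that dot_coords[of "inv\<^bsub>I\<^esub> \<gamma> a b" "inv\<^bsub>I\<^esub> \<gamma> a c" "a \<cdot>\<^bsub>H\<^esub> b" "a \<cdot>\<^bsub>H\<^esub> c"] by (simp add: s_dot)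
      also have "\<dots> = (s a \<otimes>\<^bsub>B\<^esub> s b) \<cdot>\<^bsub>B\<^esub> s c" using that by (simp add: B.dot_cycle)
      also have "\<dots> = \<iota> (inv\<^bsub>I\<^esub> \<gamma> (a \<otimes>\<^bsub>H\<^esub> b) c) \<otimes>\<^bsub>B\<^esub> s ((a \<otimes>\<^bsub>H\<^esub> b) \<cdot>\<^bsub>H\<^esub> c)"
        using that dot_coords[of "\<beta> a b" "\<one>\<^bsub>I\<^esub>" "a \<otimes>\<^bsub>H\<^esub> b" c] by (simp add: s_mult)
      finally show "\<iota> (dia (a \<cdot>\<^bsub>H\<^esub> b) (inv\<^bsub>I\<^esub> \<gamma> a c) \<otimes>\<^bsub>I\<^esub> inv\<^bsub>I\<^esub> \<gamma> (a \<cdot>\<^bsub>H\<^esub> b) (a \<cdot>\<^bsub>H\<^esub> c)) \<otimes>\<^bsub>B\<^esub>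
          s ((a \<cdot>\<^bsub>H\<^esub> b) \<cdot>\<^bsub>H\<^esub> (a \<cdot>\<^bsub>H\<^esub> c)) = \<iota> (inv\<^bsub>I\<^esub> \<gamma> (a \<otimes>\<^bsub>H\<^esub> b) c) \<otimes>\<^bsub>B\<^esub> s ((a \<otimes>\<^bsub>H\<^esub> b) \<cdot>\<^bsub>H\<^esub> c)" .
    qed (use that in simp_all)
    then have "inv\<^bsub>I\<^esub> (\<gamma> (a \<cdot>\<^bsub>H\<^esub> b) (a \<cdot>\<^bsub>H\<^esub> c) \<otimes>\<^bsub>I\<^esub> dia (a \<cdot>\<^bsub>H\<^esub> b) (\<gamma> a c)) = inv\<^bsub>I\<^esub> \<gamma> (a \<otimes>\<^bsub>H\<^esub> b) c"
      using that by (simp add: dia_inv I.inv_mult I.m_comm)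
    then show ?thesis using that by (metis I.inv_inv I.m_closed H.dot_closed H.m_closed dia_closed gamma_closed)
  qed
  show ?thesis unfolding cocycle_def using comm zero A Bq C by simp
qed

end

context sectioned_extension
begin

lemma represents_exists: "\<exists>\<beta> \<gamma>. represented_extension H I dia \<iota> B \<pi> s \<beta> \<gamma>"
proof -
  have "\<exists>y\<in>carrier I. s a \<otimes>\<^bsub>B\<^esub> s b = \<iota> y \<otimes>\<^bsub>B\<^esub> s (a \<otimes>\<^bsub>H\<^esub> b)" if "a \<in> carrier H" "b \<in> carrier H" for a b
    using coords_exist[of "s a \<otimes>\<^bsub>B\<^esub> s b"] that by simp
  then obtain \<beta> where "\<And>a b. \<lbrakk>a \<in> carrier H; b \<in> carrier H\<rbrakk> \<Longrightarrow>
      \<beta> a b \<in> carrier I \<and> s a \<otimes>\<^bsub>B\<^esub> s b = \<iota> (\<beta> a b) \<otimes>\<^bsub>B\<^esub> s (a \<otimes>\<^bsub>H\<^esub> b)" by metis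
  moreover have "\<exists>y\<in>carrier I. \<iota> y \<otimes>\<^bsub>B\<^esub> (s a \<cdot>\<^bsub>B\<^esub> s b) = s (a \<cdot>\<^bsub>H\<^esub> b)"
    if ab: "a \<in> carrier H" "b \<in> carrier H" for a b
  proof -
    obtain y where "y \<in> carrier I" "s a \<cdot>\<^bsub>B\<^esub> s b = \<iota> y \<otimes>\<^bsub>B\<^esub> s (a \<cdot>\<^bsub>H\<^esub> b)"
      using coords_exist[of "s a \<cdot>\<^bsub>B\<^esub> s b"] ab by auto
    \<comment> \<open>Moving the coordinate to the other side reverses its sign: this is where
      \<gamma> becomes the negative of the coordinate of the dot.\<close>
    then show ?thesis using ab by (intro bexI[of _ "inv\<^bsub>I\<^esub> y"]) (simp_all flip: B.m_assoc)
  qed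
  then obtain \<gamma> where "\<And>a b. \<lbrakk>a \<in> carrier H; b \<in> carrier H\<rbrakk> \<Longrightarrow>
      \<gamma> a b \<in> carrier I \<and> \<iota> (\<gamma> a b) \<otimes>\<^bsub>B\<^esub> (s a \<cdot>\<^bsub>B\<^esub> s b) = s (a \<cdot>\<^bsub>H\<^esub> b)" by metis
  ultimately have "represented_extension H I dia \<iota> B \<pi> s \<beta> \<gamma>"
    by unfold_locales blast+
  then show ?thesis by blast
qed

end

section \<open>Comparing extensions with cocycles\<close>

context lcs_action
begin

lemma section_exists:
  assumes "(\<iota>, B, \<pi>) \<in> extensions H I dia"
  shows "\<exists>s. normalized_section H B \<pi> s"
proof -
  have B: "linear_cycle_set B" and \<pi>: "\<pi> \<in> hom B H" "\<pi> ` carrier B = carrier H"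
    using assms by (auto simp: extensions_def is_extension_def lcs_hom_def)
  interpret B: linear_cycle_set B by (rule B)
  have "\<forall>h\<in>carrier H. \<exists>x\<in>carrier B. \<pi> x = h" using equalityD2[OF \<pi>(2)] by blast
  then obtain s where "\<forall>h\<in>carrier H. s h \<in> carrier B \<and> \<pi> (s h) = h" by metis
  moreover have "\<pi> \<one>\<^bsub>B\<^esub> = \<one>\<^bsub>H\<^esub>" using hom_one[OF \<pi>(1) B.is_group H.is_group] .
  \<comment> \<open>An arbitrary choice of preimages is corrected at zero; it remains a section
    because \<pi> preserves zero.\<close>
  ultimately show ?thesis
    by (intro exI[of _ "s(\<one>\<^bsub>H\<^esub> := \<one>\<^bsub>B\<^esub>)"]) (auto simp: normalized_section_def)
qed

lemma cocycle_exists: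
  assumes E: "E \<in> extensions H I dia"
  shows "\<exists>\<beta> \<gamma>. cocycle \<beta> \<gamma> \<and> represents E \<beta> \<gamma>"
proof -
  obtain \<iota> B \<pi> where [simp]: "E = (\<iota>, B, \<pi>)" by (cases E)
  obtain s where s: "normalized_section H B \<pi> s" using section_exists[of \<iota> B \<pi>] E by auto
  interpret sectioned_extension H I dia \<iota> B \<pi> s using E s by unfold_locales auto
  obtain \<beta> \<gamma> where "represented_extension H I dia \<iota> B \<pi> s \<beta> \<gamma>" using represents_exists by blast
  then show ?thesis
    using represented_extension.cocycle represented_extension.represents by fastforce
qed

lemma representsE:
  assumes "(\<iota>, B, \<pi>) \<in> extensions H I dia" "represents (\<iota>, B, \<pi>) \<beta> \<gamma>"
  obtains s where "represented_extension H I dia \<iota> B \<pi> s \<beta> \<gamma>"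
proof -
  obtain s where "normalized_section H B \<pi> s" and "\<And>a b. \<lbrakk>a \<in> carrier H; b \<in> carrier H\<rbrakk> \<Longrightarrow>
      \<beta> a b \<in> carrier I \<and> \<gamma> a b \<in> carrier I \<and> s a \<otimes>\<^bsub>B\<^esub> s b = \<iota> (\<beta> a b) \<otimes>\<^bsub>B\<^esub> s (a \<otimes>\<^bsub>H\<^esub> b) \<and>
      \<iota> (\<gamma> a b) \<otimes>\<^bsub>B\<^esub> (s a \<cdot>\<^bsub>B\<^esub> s b) = s (a \<cdot>\<^bsub>H\<^esub> b)"
    using assms(2) unfolding represents_def by auto
  then have "represented_extension H I dia \<iota> B \<pi> s \<beta> \<gamma>"
    using assms(1) by unfold_locales auto
  then show ?thesis by (rule that)
qed

text \<open>A morphism \<phi> over \<open>H\<close> sends \<open>s a\<close> to an element above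
  \<open>a\<close>, which differs from \<open>s' a\<close> by a unique \<theta> a in
  \<open>I\<close>. Since \<phi> is prescribed on the image of \<iota>, the function \<theta> is its
  only freedom, and conversely \<theta> defines \<phi> in coordinates.\<close>

lemma ext_equiv_iff_cohomologous:
  assumes "represented_extension H I dia \<iota> B \<pi> s \<beta> \<gamma>"
    and "represented_extension H I dia \<iota>' B' \<pi>' s' \<beta>' \<gamma>'"
  shows "ext_equiv H I (\<iota>, B, \<pi>) (\<iota>', B', \<pi>') \<longleftrightarrow> cohomologous \<beta> \<gamma> \<beta>' \<gamma>'"
proof -
  interpret E: represented_extension H I dia \<iota> B \<pi> s \<beta> \<gamma> by fact
  interpret E': represented_extension H I dia \<iota>' B' \<pi>' s' \<beta>' \<gamma>' by fact
  text \<open>For a map given by \<open>\<iota> y + s a \<mapsto> \<iota>' (y + \<theta> a) + s' a\<close>, additivity and compatibility with the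
    dot are exactly the two equations of \<open>cohomologous\<close>.\<close>
  have add_iff: "\<iota>' (y \<otimes>\<^bsub>I\<^esub> y' \<otimes>\<^bsub>I\<^esub> \<beta> a b \<otimes>\<^bsub>I\<^esub> t) \<otimes>\<^bsub>B'\<^esub> s' (a \<otimes>\<^bsub>H\<^esub> b) =
        (\<iota>' (y \<otimes>\<^bsub>I\<^esub> u) \<otimes>\<^bsub>B'\<^esub> s' a) \<otimes>\<^bsub>B'\<^esub> (\<iota>' (y' \<otimes>\<^bsub>I\<^esub> v) \<otimes>\<^bsub>B'\<^esub> s' b) \<longleftrightarrow>
      \<beta> a b \<otimes>\<^bsub>I\<^esub> t = \<beta>' a b \<otimes>\<^bsub>I\<^esub> (u \<otimes>\<^bsub>I\<^esub> v)"
    if "a \<in> carrier H" "b \<in> carrier H" "y \<in> carrier I" "y' \<in> carrier I"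
      "t \<in> carrier I" "u \<in> carrier I" "v \<in> carrier I" for a b y y' t u v
  proof -
    have "y \<otimes>\<^bsub>I\<^esub> y' \<otimes>\<^bsub>I\<^esub> \<beta> a b \<otimes>\<^bsub>I\<^esub> t = (y \<otimes>\<^bsub>I\<^esub> y') \<otimes>\<^bsub>I\<^esub> (\<beta> a b \<otimes>\<^bsub>I\<^esub> t)"
      using that by (simp add: I.m_assoc)
    moreover have "(y \<otimes>\<^bsub>I\<^esub> u) \<otimes>\<^bsub>I\<^esub> (y' \<otimes>\<^bsub>I\<^esub> v) \<otimes>\<^bsub>I\<^esub> \<beta>' a b = (y \<otimes>\<^bsub>I\<^esub> y') \<otimes>\<^bsub>I\<^esub> (\<beta>' a b \<otimes>\<^bsub>I\<^esub> (u \<otimes>\<^bsub>I\<^esub> v))"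
      using that by (simp add: I.m_ac)
    ultimately have "y \<otimes>\<^bsub>I\<^esub> y' \<otimes>\<^bsub>I\<^esub> \<beta> a b \<otimes>\<^bsub>I\<^esub> t = (y \<otimes>\<^bsub>I\<^esub> u) \<otimes>\<^bsub>I\<^esub> (y' \<otimes>\<^bsub>I\<^esub> v) \<otimes>\<^bsub>I\<^esub> \<beta>' a b \<longleftrightarrow>
        \<beta> a b \<otimes>\<^bsub>I\<^esub> t = \<beta>' a b \<otimes>\<^bsub>I\<^esub> (u \<otimes>\<^bsub>I\<^esub> v)"
      using that by simp
    then show ?thesis
      unfolding E'.mult_coords[OF I.m_closed[OF that(3,6)] I.m_closed[OF that(4,7)] that(1,2)]
      by (subst E'.coords_eq_iff) (use that in simp_all)
  qed
  have dot_iff: "\<iota>' (dia a y' \<otimes>\<^bsub>I\<^esub> inv\<^bsub>I\<^esub> \<gamma> a b \<otimes>\<^bsub>I\<^esub> t) \<otimes>\<^bsub>B'\<^esub> s' (a \<cdot>\<^bsub>H\<^esub> b) =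
        (\<iota>' (y \<otimes>\<^bsub>I\<^esub> u) \<otimes>\<^bsub>B'\<^esub> s' a) \<cdot>\<^bsub>B'\<^esub> (\<iota>' (y' \<otimes>\<^bsub>I\<^esub> v) \<otimes>\<^bsub>B'\<^esub> s' b) \<longleftrightarrow>
      \<gamma> a b \<otimes>\<^bsub>I\<^esub> dia a v = \<gamma>' a b \<otimes>\<^bsub>I\<^esub> t"
    if "a \<in> carrier H" "b \<in> carrier H" "y \<in> carrier I" "y' \<in> carrier I"
      "t \<in> carrier I" "u \<in> carrier I" "v \<in> carrier I" for a b y y' t u v
  proof -
    have "dia a y' \<otimes>\<^bsub>I\<^esub> inv\<^bsub>I\<^esub> \<gamma> a b \<otimes>\<^bsub>I\<^esub> t = dia a y' \<otimes>\<^bsub>I\<^esub> (t \<otimes>\<^bsub>I\<^esub> inv\<^bsub>I\<^esub> \<gamma> a b)"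
      using that by (simp add: I.m_ac)
    moreover have "dia a (y' \<otimes>\<^bsub>I\<^esub> v) \<otimes>\<^bsub>I\<^esub> inv\<^bsub>I\<^esub> \<gamma>' a b = dia a y' \<otimes>\<^bsub>I\<^esub> (dia a v \<otimes>\<^bsub>I\<^esub> inv\<^bsub>I\<^esub> \<gamma>' a b)"
      using that by (simp add: dia_add I.m_assoc)
    moreover have "t \<otimes>\<^bsub>I\<^esub> inv\<^bsub>I\<^esub> \<gamma> a b = dia a v \<otimes>\<^bsub>I\<^esub> inv\<^bsub>I\<^esub> \<gamma>' a b \<longleftrightarrow> t \<otimes>\<^bsub>I\<^esub> \<gamma>' a b = dia a v \<otimes>\<^bsub>I\<^esub> \<gamma> a b"
      using that by (intro I.inv_cross_eq_iff) simp_all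
    moreover have "t \<otimes>\<^bsub>I\<^esub> \<gamma>' a b = dia a v \<otimes>\<^bsub>I\<^esub> \<gamma> a b \<longleftrightarrow> \<gamma> a b \<otimes>\<^bsub>I\<^esub> dia a v = \<gamma>' a b \<otimes>\<^bsub>I\<^esub> t"
      using that by (auto simp: I.m_comm)
    ultimately have "dia a y' \<otimes>\<^bsub>I\<^esub> inv\<^bsub>I\<^esub> \<gamma> a b \<otimes>\<^bsub>I\<^esub> t = dia a (y' \<otimes>\<^bsub>I\<^esub> v) \<otimes>\<^bsub>I\<^esub> inv\<^bsub>I\<^esub> \<gamma>' a b \<longleftrightarrow>
        \<gamma> a b \<otimes>\<^bsub>I\<^esub> dia a v = \<gamma>' a b \<otimes>\<^bsub>I\<^esub> t"
      using that by simp
    then show ?thesis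
      unfolding E'.dot_coords[OF I.m_closed[OF that(3,6)] I.m_closed[OF that(4,7)] that(1,2)]
      by (subst E'.coords_eq_iff) (use that in simp_all)
  qed
  show ?thesis
  proof
    assume "ext_equiv H I (\<iota>, B, \<pi>) (\<iota>', B', \<pi>')"
    then obtain \<phi> where \<phi>: "\<phi> \<in> lcs_hom B B'" and p: "\<And>b. b \<in> carrier B \<Longrightarrow> \<pi>' (\<phi> b) = \<pi> b"
      and i: "\<And>y. y \<in> carrier I \<Longrightarrow> \<phi> (\<iota> y) = \<iota>' y"
      unfolding ext_equiv_def by auto
    interpret phi: group_hom B B' \<phi>
      using \<phi> by unfold_locales (simp add: lcs_hom_def)
    have dot: "\<phi> (x \<cdot>\<^bsub>B\<^esub> x') = \<phi> x \<cdot>\<^bsub>B'\<^esub> \<phi> x'" if "x \<in> carrier B" "x' \<in> carrier B" for x x'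
      using \<phi> that by (simp add: lcs_hom_def)
    have "\<exists>t\<in>carrier I. \<phi> (s a) = \<iota>' t \<otimes>\<^bsub>B'\<^esub> s' a" if "a \<in> carrier H" for a
      using E'.coords_exist[of "\<phi> (s a)"] that by (simp add: p)
    then obtain \<theta> where tc: "\<And>a. a \<in> carrier H \<Longrightarrow> \<theta> a \<in> carrier I"
      and t: "\<And>a. a \<in> carrier H \<Longrightarrow> \<phi> (s a) = \<iota>' (\<theta> a) \<otimes>\<^bsub>B'\<^esub> s' a" by metis
    have t1: "\<theta> \<one>\<^bsub>H\<^esub> = \<one>\<^bsub>I\<^esub>"
      using t[of "\<one>\<^bsub>H\<^esub>"] tc[of "\<one>\<^bsub>H\<^esub>"] E'.coords_eq_iff[of "\<theta> \<one>\<^bsub>H\<^esub>" "\<one>\<^bsub>I\<^esub>" "\<one>\<^bsub>H\<^esub>" "\<one>\<^bsub>H\<^esub>"] by simp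
    have val: "\<phi> (\<iota> y \<otimes>\<^bsub>B\<^esub> s a) = \<iota>' (y \<otimes>\<^bsub>I\<^esub> \<theta> a) \<otimes>\<^bsub>B'\<^esub> s' a" if "y \<in> carrier I" "a \<in> carrier H" for y a
      using that by (simp add: i t tc E'.B.m_assoc)
    show "cohomologous \<beta> \<gamma> \<beta>' \<gamma>'"
      unfolding cohomologous_def
    proof (intro bexI[of _ \<theta>] conjI ballI)
      fix a b assume ab: "a \<in> carrier H" "b \<in> carrier H"
      \<comment> \<open>Neutral elements are left unsimplified here and below, so that
        \<open>val\<close>, \<open>add_iff\<close> and \<open>dot_iff\<close> match literally with
        the coordinates in \<open>I\<close> equal to zero.\<close>
      have m: "\<one>\<^bsub>I\<^esub> \<otimes>\<^bsub>I\<^esub> \<one>\<^bsub>I\<^esub> \<otimes>\<^bsub>I\<^esub> \<beta> a b \<in> carrier I" "a \<otimes>\<^bsub>H\<^esub> b \<in> carrier H"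
        "dia a \<one>\<^bsub>I\<^esub> \<otimes>\<^bsub>I\<^esub> inv\<^bsub>I\<^esub> \<gamma> a b \<in> carrier I" "a \<cdot>\<^bsub>H\<^esub> b \<in> carrier H" using ab by simp_all
      have sa: "\<phi> (s a) = \<iota>' (\<one>\<^bsub>I\<^esub> \<otimes>\<^bsub>I\<^esub> \<theta> a) \<otimes>\<^bsub>B'\<^esub> s' a" if "a \<in> carrier H" for a using that by (simp add: t tc)
      have "\<phi> (s a) \<otimes>\<^bsub>B'\<^esub> \<phi> (s b) = \<phi> (\<iota> (\<one>\<^bsub>I\<^esub> \<otimes>\<^bsub>I\<^esub> \<one>\<^bsub>I\<^esub> \<otimes>\<^bsub>I\<^esub> \<beta> a b) \<otimes>\<^bsub>B\<^esub> s (a \<otimes>\<^bsub>H\<^esub> b))"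
        using ab E.s_mult[OF ab] phi.hom_mult[of "s a" "s b"] by simp
      then have "\<iota>' (\<one>\<^bsub>I\<^esub> \<otimes>\<^bsub>I\<^esub> \<one>\<^bsub>I\<^esub> \<otimes>\<^bsub>I\<^esub> \<beta> a b \<otimes>\<^bsub>I\<^esub> \<theta> (a \<otimes>\<^bsub>H\<^esub> b)) \<otimes>\<^bsub>B'\<^esub> s' (a \<otimes>\<^bsub>H\<^esub> b) =
          (\<iota>' (\<one>\<^bsub>I\<^esub> \<otimes>\<^bsub>I\<^esub> \<theta> a) \<otimes>\<^bsub>B'\<^esub> s' a) \<otimes>\<^bsub>B'\<^esub> (\<iota>' (\<one>\<^bsub>I\<^esub> \<otimes>\<^bsub>I\<^esub> \<theta> b) \<otimes>\<^bsub>B'\<^esub> s' b)"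
        unfolding sa[OF ab(1)] sa[OF ab(2)] val[OF m(1,2)] by (rule sym)
      then show "\<beta> a b \<otimes>\<^bsub>I\<^esub> \<theta> (a \<otimes>\<^bsub>H\<^esub> b) = \<beta>' a b \<otimes>\<^bsub>I\<^esub> (\<theta> a \<otimes>\<^bsub>I\<^esub> \<theta> b)"
        by (subst (asm) add_iff) (use ab tc in simp_all)
      have "\<phi> (s a) \<cdot>\<^bsub>B'\<^esub> \<phi> (s b) = \<phi> (\<iota> (dia a \<one>\<^bsub>I\<^esub> \<otimes>\<^bsub>I\<^esub> inv\<^bsub>I\<^esub> \<gamma> a b) \<otimes>\<^bsub>B\<^esub> s (a \<cdot>\<^bsub>H\<^esub> b))"
        using ab E.s_dot[OF ab] dot[of "s a" "s b"] by simp
      then have "\<iota>' (dia a \<one>\<^bsub>I\<^esub> \<otimes>\<^bsub>I\<^esub> inv\<^bsub>I\<^esub> \<gamma> a b \<otimes>\<^bsub>I\<^esub> \<theta> (a \<cdot>\<^bsub>H\<^esub> b)) \<otimes>\<^bsub>B'\<^esub> s' (a \<cdot>\<^bsub>H\<^esub> b) =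
          (\<iota>' (\<one>\<^bsub>I\<^esub> \<otimes>\<^bsub>I\<^esub> \<theta> a) \<otimes>\<^bsub>B'\<^esub> s' a) \<cdot>\<^bsub>B'\<^esub> (\<iota>' (\<one>\<^bsub>I\<^esub> \<otimes>\<^bsub>I\<^esub> \<theta> b) \<otimes>\<^bsub>B'\<^esub> s' b)"
        unfolding sa[OF ab(1)] sa[OF ab(2)] val[OF m(3,4)] by (rule sym)
      then show "\<gamma> a b \<otimes>\<^bsub>I\<^esub> dia a (\<theta> b) = \<gamma>' a b \<otimes>\<^bsub>I\<^esub> \<theta> (a \<cdot>\<^bsub>H\<^esub> b)"
        by (subst (asm) dot_iff) (use ab tc in simp_all)
    qed (use t1 tc in auto)
  next
    assume "cohomologous \<beta> \<gamma> \<beta>' \<gamma>'"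
    then obtain \<theta> where \<theta>: "\<theta> \<in> carrier H \<rightarrow> carrier I" "\<theta> \<one>\<^bsub>H\<^esub> = \<one>\<^bsub>I\<^esub>"
      and e: "\<And>a b. \<lbrakk>a \<in> carrier H; b \<in> carrier H\<rbrakk> \<Longrightarrow>
        \<beta> a b \<otimes>\<^bsub>I\<^esub> \<theta> (a \<otimes>\<^bsub>H\<^esub> b) = \<beta>' a b \<otimes>\<^bsub>I\<^esub> (\<theta> a \<otimes>\<^bsub>I\<^esub> \<theta> b) \<and>
        \<gamma> a b \<otimes>\<^bsub>I\<^esub> dia a (\<theta> b) = \<gamma>' a b \<otimes>\<^bsub>I\<^esub> \<theta> (a \<cdot>\<^bsub>H\<^esub> b)"
      unfolding cohomologous_def by blast
    have tc: "\<theta> a \<in> carrier I" if "a \<in> carrier H" for a using \<theta>(1) that by blast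
    \<comment> \<open>\<open>k\<close> reads off the coordinate in \<open>I\<close>, while \<pi>
      reads off the coordinate in \<open>H\<close>; the morphism is defined from these two.\<close>
    obtain k where k: "\<And>x. x \<in> carrier B \<Longrightarrow> k x \<in> carrier I \<and> x = \<iota> (k x) \<otimes>\<^bsub>B\<^esub> s (\<pi> x)"
      using E.coords_exist by metis
    have kv: "k (\<iota> y \<otimes>\<^bsub>B\<^esub> s a) = y" if "y \<in> carrier I" "a \<in> carrier H" for y a
      using k[of "\<iota> y \<otimes>\<^bsub>B\<^esub> s a"] that E.coords_eq_iff[of y "k (\<iota> y \<otimes>\<^bsub>B\<^esub> s a)" a a] by auto
    define \<phi> where "\<phi> x = \<iota>' (k x \<otimes>\<^bsub>I\<^esub> \<theta> (\<pi> x)) \<otimes>\<^bsub>B'\<^esub> s' (\<pi> x)" for x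
    have val: "\<phi> (\<iota> y \<otimes>\<^bsub>B\<^esub> s a) = \<iota>' (y \<otimes>\<^bsub>I\<^esub> \<theta> a) \<otimes>\<^bsub>B'\<^esub> s' a" if "y \<in> carrier I" "a \<in> carrier H" for y a
      using that by (simp add: \<phi>_def kv)
    have coords: "\<exists>y a. y \<in> carrier I \<and> a \<in> carrier H \<and> x = \<iota> y \<otimes>\<^bsub>B\<^esub> s a" if "x \<in> carrier B" for x
      using k[OF that] E.pi.hom_closed[OF that] by blast
    have mult: "\<phi> (x \<otimes>\<^bsub>B\<^esub> x') = \<phi> x \<otimes>\<^bsub>B'\<^esub> \<phi> x'" and dot: "\<phi> (x \<cdot>\<^bsub>B\<^esub> x') = \<phi> x \<cdot>\<^bsub>B'\<^esub> \<phi> x'"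
      if x: "x \<in> carrier B" "x' \<in> carrier B" for x x'
    proof -
      obtain y a y' b where c: "y \<in> carrier I" "a \<in> carrier H" "x = \<iota> y \<otimes>\<^bsub>B\<^esub> s a"
        "y' \<in> carrier I" "b \<in> carrier H" "x' = \<iota> y' \<otimes>\<^bsub>B\<^esub> s b"
        using coords x by metis
      have m: "y \<otimes>\<^bsub>I\<^esub> y' \<otimes>\<^bsub>I\<^esub> \<beta> a b \<in> carrier I" "a \<otimes>\<^bsub>H\<^esub> b \<in> carrier H"
        "dia a y' \<otimes>\<^bsub>I\<^esub> inv\<^bsub>I\<^esub> \<gamma> a b \<in> carrier I" "a \<cdot>\<^bsub>H\<^esub> b \<in> carrier H" using c by simp_all
      show "\<phi> (x \<otimes>\<^bsub>B\<^esub> x') = \<phi> x \<otimes>\<^bsub>B'\<^esub> \<phi> x'"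
        unfolding c(3,6) E.mult_coords[OF c(1,4,2,5)] val[OF m(1,2)] val[OF c(1,2)] val[OF c(4,5)]
        by (subst add_iff) (use c tc e in auto)
      show "\<phi> (x \<cdot>\<^bsub>B\<^esub> x') = \<phi> x \<cdot>\<^bsub>B'\<^esub> \<phi> x'"
        unfolding c(3,6) E.dot_coords[OF c(1,4,2,5)] val[OF m(3,4)] val[OF c(1,2)] val[OF c(4,5)]
        by (subst dot_iff) (use c tc e in auto)
    qed
    show "ext_equiv H I (\<iota>, B, \<pi>) (\<iota>', B', \<pi>')"
      unfolding ext_equiv_def prod.case
    proof (intro bexI[of _ \<phi>] conjI ballI)
      show "\<phi> \<in> lcs_hom B B'"
        using mult dot k tc by (auto simp: lcs_hom_def hom_def \<phi>_def)
      show "\<pi>' (\<phi> b) = \<pi> b" if "b \<in> carrier B" for b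
        using that k tc by (simp add: \<phi>_def)
      show "\<phi> (\<iota> y) = \<iota>' y" if "y \<in> carrier I" for y
        using val[OF that H.one_closed] that \<theta>(2) by simp
    qed
  qed
qed

text \<open>By \<open>dia_dot\<close> with b = - a, the element a \<cdot> (- a) acts as a left
  inverse of a. Applying this twice turns the left inverse into a two-sided one. It supplies the
  bijectivity of the dot in the extension built from a cocycle.\<close>

lemma dia_bij:
  assumes h: "h \<in> carrier H"
  shows "bij_betw (dia h) (carrier I) (carrier I)"
proof -
  \<comment> \<open>\<open>g h\<close> is the inverse of \<open>h\<close> for the multiplication of
    \<open>H\<close>: acting by h on h \<cdot> (- h) gives - h, so the product of \<open>h\<close>
    and \<open>g h\<close> is 0.\<close>
  define g where "g h = h \<cdot>\<^bsub>H\<^esub> inv\<^bsub>H\<^esub> h" for h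
  have gc: "g h \<in> carrier H" if "h \<in> carrier H" for h using that by (simp add: g_def)
  have left: "dia (g h) (dia h y) = y" if "h \<in> carrier H" "y \<in> carrier I" for h y
    using that dia_dot[of h "inv\<^bsub>H\<^esub> h" y] by (simp add: g_def dia_zero)
  \<comment> \<open>\<open>dia (g h)\<close> has \<open>dia (g (g h))\<close> as a left inverse and
    \<open>dia h\<close> as a right inverse, so these two agree. Hence \<open>dia (g h) y\<close> is
    a preimage of \<open>y\<close> under \<open>dia h\<close>.\<close>
  have surj: "\<exists>x\<in>carrier I. y = dia h x" if y: "y \<in> carrier I" for y
  proof -
    have "dia (g (g h)) y = dia (g (g h)) (dia (g h) (dia h y))" using left h y by simp
    also have "\<dots> = dia h y" using left[OF gc[OF h], of "dia h y"] h y by simp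
    finally have gg: "dia (g (g h)) y = dia h y" .
    have "dia (g (g h)) (dia (g h) y) = y" using left[OF gc[OF h] y] .
    moreover have "dia (g (g h)) (dia (g h) y) = dia h (dia (g h) y)"
    proof -
      have "dia (g (g h)) z = dia h z" if "z \<in> carrier I" for z
        using left[OF gc[OF h], of "dia h z"] left[OF h that] h that by simp
      then show ?thesis using gc[OF h] y by simp
    qed
    ultimately show ?thesis using gc[OF h] y by (intro bexI[of _ "dia (g h) y"]) simp_all
  qed
  show ?thesis
    unfolding bij_betw_def
  proof
    show "inj_on (dia h) (carrier I)"
      by (rule inj_on_inverseI[of _ "dia (g h)"]) (use left h in simp)
    show "dia h ` carrier I = carrier I"
      using surj h by (auto simp: image_iff)
  qed
qed

text \<open>The middle term has underlying set \<open>H \<times> I\<close>, with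
  \<open>(a, y) + (b, y') = (a + b, y + y' + \<beta> a b)\<close> and \<open>(a, y) \<cdot> (b, y') = (a \<cdot> b, a \<diamondop> y' - \<gamma> a b)\<close>;
  it is carried over to the type of \<open>emb\<close>.\<close>

definition cocycle_extension ::
    "('h \<times> 'i \<Rightarrow> 'b) \<Rightarrow> ('h \<Rightarrow> 'h \<Rightarrow> 'i) \<Rightarrow> ('h \<Rightarrow> 'h \<Rightarrow> 'i) \<Rightarrow> ('h, 'i, 'b) extension" where
  "cocycle_extension emb \<beta> \<gamma> =
    (let pr = inv_into (carrier H \<times> carrier I) emb in
     (\<lambda>y. emb (\<one>\<^bsub>H\<^esub>, y),
      \<lparr>carrier = emb ` (carrier H \<times> carrier I),
       mult = (\<lambda>x x'. emb (fst (pr x) \<otimes>\<^bsub>H\<^esub> fst (pr x'),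
         snd (pr x) \<otimes>\<^bsub>I\<^esub> snd (pr x') \<otimes>\<^bsub>I\<^esub> \<beta> (fst (pr x)) (fst (pr x')))),
       one = emb (\<one>\<^bsub>H\<^esub>, \<one>\<^bsub>I\<^esub>),
       lcs_dot = (\<lambda>x x'. emb (fst (pr x) \<cdot>\<^bsub>H\<^esub> fst (pr x'),
         dia (fst (pr x)) (snd (pr x')) \<otimes>\<^bsub>I\<^esub> inv\<^bsub>I\<^esub> \<gamma> (fst (pr x)) (fst (pr x'))))\<rparr>,
      \<lambda>x. fst (pr x)))"

text \<open>The first cocycle equation and symmetry make the sum an abelian group law, the second
  gives distributivity, and the third together with \<open>dia_dot\<close> gives the cycle law.
  Bijectivity of the dot combines \<open>dot_bij\<close> in \<open>H\<close> with
  \<open>dia_bij\<close>.\<close>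

lemma cocycle_extension:
  fixes emb :: "'h \<times> 'i \<Rightarrow> 'b"
  assumes emb: "inj_on emb (carrier H \<times> carrier I)" and cocycle: "cocycle \<beta> \<gamma>"
  shows "cocycle_extension emb \<beta> \<gamma> \<in> extensions H I dia"
    and "represents (cocycle_extension emb \<beta> \<gamma>) \<beta> \<gamma>"
proof -
  obtain \<iota> B \<pi> where E: "cocycle_extension emb \<beta> \<gamma> = (\<iota>, B, \<pi>)" by (cases "cocycle_extension emb \<beta> \<gamma>")
  note defs = E[symmetric, unfolded cocycle_extension_def Let_def, simplified]
  note [simp] = cocycleD(1,2)[OF cocycle] cocycleD(4-7)[OF cocycle _ H.one_closed]
  have pr [simp]: "inv_into (carrier H \<times> carrier I) emb (emb (a, y)) = (a, y)"
    if "a \<in> carrier H" "y \<in> carrier I" for a y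
    using that emb by (intro inv_into_f_f) auto
  have emb_eq [simp]: "emb (a, y) = emb (b, y') \<longleftrightarrow> a = b \<and> y = y'"
    if "a \<in> carrier H" "y \<in> carrier I" "b \<in> carrier H" "y' \<in> carrier I" for a y b y'
    using inj_on_eq_iff[OF emb, of "(a, y)" "(b, y')"] that by simp
  have carrier: "x \<in> carrier B \<longleftrightarrow> (\<exists>a\<in>carrier H. \<exists>y\<in>carrier I. x = emb (a, y))" for x
    by (auto simp: defs)
  have mult [simp]: "emb (a, y) \<otimes>\<^bsub>B\<^esub> emb (b, y') = emb (a \<otimes>\<^bsub>H\<^esub> b, y \<otimes>\<^bsub>I\<^esub> y' \<otimes>\<^bsub>I\<^esub> \<beta> a b)"
    and dot [simp]: "emb (a, y) \<cdot>\<^bsub>B\<^esub> emb (b, y') = emb (a \<cdot>\<^bsub>H\<^esub> b, dia a y' \<otimes>\<^bsub>I\<^esub> inv\<^bsub>I\<^esub> \<gamma> a b)"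
    if "a \<in> carrier H" "y \<in> carrier I" "b \<in> carrier H" "y' \<in> carrier I" for a y b y'
    using that by (simp_all add: defs)
  have emb_closed [simp]: "emb (a, y) \<in> carrier B" if "a \<in> carrier H" "y \<in> carrier I" for a y
    using that carrier by blast
  have one: "\<one>\<^bsub>B\<^esub> = emb (\<one>\<^bsub>H\<^esub>, \<one>\<^bsub>I\<^esub>)" by (simp add: defs)
  have \<pi> [simp]: "\<pi> (emb (a, y)) = a" if "a \<in> carrier H" "y \<in> carrier I" for a y
    using that by (simp add: defs)
  have \<iota>: "\<iota> y = emb (\<one>\<^bsub>H\<^esub>, y)" for y by (simp add: defs)
  have sym: "\<beta> a b = \<beta> b a" if "a \<in> carrier H" "b \<in> carrier H" for a b
    using cocycleD(3)[OF cocycle that] .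
  interpret B: comm_group B
  proof (rule comm_groupI)
    fix x y z assume "x \<in> carrier B" "y \<in> carrier B" "z \<in> carrier B"
    then obtain a u b v c w where c: "a \<in> carrier H" "u \<in> carrier I" "x = emb (a, u)"
      "b \<in> carrier H" "v \<in> carrier I" "y = emb (b, v)" "c \<in> carrier H" "w \<in> carrier I" "z = emb (c, w)"
      unfolding carrier by blast
    have "u \<otimes>\<^bsub>I\<^esub> v \<otimes>\<^bsub>I\<^esub> \<beta> a b \<otimes>\<^bsub>I\<^esub> w \<otimes>\<^bsub>I\<^esub> \<beta> (a \<otimes>\<^bsub>H\<^esub> b) c =
        u \<otimes>\<^bsub>I\<^esub> v \<otimes>\<^bsub>I\<^esub> w \<otimes>\<^bsub>I\<^esub> (\<beta> (a \<otimes>\<^bsub>H\<^esub> b) c \<otimes>\<^bsub>I\<^esub> \<beta> a b)"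
      using c by (simp add: I.m_ac)
    also have "\<dots> = u \<otimes>\<^bsub>I\<^esub> v \<otimes>\<^bsub>I\<^esub> w \<otimes>\<^bsub>I\<^esub> (\<beta> b c \<otimes>\<^bsub>I\<^esub> \<beta> a (b \<otimes>\<^bsub>H\<^esub> c))"
      using c by (simp only: cocycleD(8)[OF cocycle])
    also have "\<dots> = u \<otimes>\<^bsub>I\<^esub> (v \<otimes>\<^bsub>I\<^esub> w \<otimes>\<^bsub>I\<^esub> \<beta> b c) \<otimes>\<^bsub>I\<^esub> \<beta> a (b \<otimes>\<^bsub>H\<^esub> c)"
      using c by (simp add: I.m_ac)
    finally show "x \<otimes>\<^bsub>B\<^esub> y \<otimes>\<^bsub>B\<^esub> z = x \<otimes>\<^bsub>B\<^esub> (y \<otimes>\<^bsub>B\<^esub> z)"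
      using c by (simp add: H.m_assoc)
  next
    fix x y assume "x \<in> carrier B" "y \<in> carrier B"
    then show "x \<otimes>\<^bsub>B\<^esub> y \<in> carrier B" "x \<otimes>\<^bsub>B\<^esub> y = y \<otimes>\<^bsub>B\<^esub> x"
      unfolding carrier using sym by (auto simp: H.m_comm I.m_comm)
  next
    fix x assume "x \<in> carrier B"
    then obtain a u where x: "a \<in> carrier H" "u \<in> carrier I" "x = emb (a, u)" unfolding carrier by blast
    then show "\<one>\<^bsub>B\<^esub> \<otimes>\<^bsub>B\<^esub> x = x" by (simp add: one)
    \<comment> \<open>The inverse of (a, u) lies over - a; its second coordinate must also cancel
      the term \<beta>(- a, a) produced by the addition.\<close>
    let ?v = "inv\<^bsub>I\<^esub> (u \<otimes>\<^bsub>I\<^esub> \<beta> (inv\<^bsub>H\<^esub> a) a)"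
    have "?v \<otimes>\<^bsub>I\<^esub> u \<otimes>\<^bsub>I\<^esub> \<beta> (inv\<^bsub>H\<^esub> a) a = \<one>\<^bsub>I\<^esub>"
      using x by (subst I.m_assoc) simp_all
    then show "\<exists>y\<in>carrier B. y \<otimes>\<^bsub>B\<^esub> x = \<one>\<^bsub>B\<^esub>"
      using x by (intro bexI[of _ "emb (inv\<^bsub>H\<^esub> a, ?v)"]) (simp_all add: one)
  qed (simp add: one)
  have B: "linear_cycle_set B"
  proof
    fix x assume "x \<in> carrier B"
    then obtain a u where x: "a \<in> carrier H" "u \<in> carrier I" "x = emb (a, u)" unfolding carrier by blast
    have dia_inj: "dia a y = dia a y' \<longleftrightarrow> y = y'" if "y \<in> carrier I" "y' \<in> carrier I" for y y'
      using dia_bij[OF x(1)] that by (auto simp: bij_betw_def dest: inj_onD)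
    show "bij_betw (\<lambda>z. x \<cdot>\<^bsub>B\<^esub> z) (carrier B) (carrier B)"
      unfolding bij_betw_def
    proof
      show "inj_on (\<lambda>z. x \<cdot>\<^bsub>B\<^esub> z) (carrier B)"
      proof (rule inj_onI)
        fix z z' assume "z \<in> carrier B" "z' \<in> carrier B" and eq: "x \<cdot>\<^bsub>B\<^esub> z = x \<cdot>\<^bsub>B\<^esub> z'"
        then obtain b v c w where z: "b \<in> carrier H" "v \<in> carrier I" "z = emb (b, v)"
          "c \<in> carrier H" "w \<in> carrier I" "z' = emb (c, w)" unfolding carrier by blast
        have ab: "a \<cdot>\<^bsub>H\<^esub> b = a \<cdot>\<^bsub>H\<^esub> c" and e: "dia a v \<otimes>\<^bsub>I\<^esub> inv\<^bsub>I\<^esub> \<gamma> a b = dia a w \<otimes>\<^bsub>I\<^esub> inv\<^bsub>I\<^esub> \<gamma> a c"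
          using eq x(1,2) z(1,2,4,5) unfolding x(3) z(3,6) by simp_all
        have "b = c" using ab H.dot_cancel[OF x(1) z(1,4)] by blast
        have "dia a v = dia a w" using e x(1) z(1,2,5) unfolding \<open>b = c\<close>[symmetric] by simp
        then show "z = z'" using \<open>b = c\<close> dia_inj[OF z(2,5)] z(3,6) by simp
      qed
      show "(\<lambda>z. x \<cdot>\<^bsub>B\<^esub> z) ` carrier B = carrier B"
      proof
        show "(\<lambda>z. x \<cdot>\<^bsub>B\<^esub> z) ` carrier B \<subseteq> carrier B"
        proof (rule image_subsetI)
          fix z assume "z \<in> carrier B"
          then obtain c w where "c \<in> carrier H" "w \<in> carrier I" "z = emb (c, w)" unfolding carrier by blast
          then show "x \<cdot>\<^bsub>B\<^esub> z \<in> carrier B" using x by simp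
        qed
        show "carrier B \<subseteq> (\<lambda>z. x \<cdot>\<^bsub>B\<^esub> z) ` carrier B"
        proof
          fix z assume "z \<in> carrier B"
          then obtain c w where z: "c \<in> carrier H" "w \<in> carrier I" "z = emb (c, w)" unfolding carrier by blast
          have "c \<in> (\<lambda>b. a \<cdot>\<^bsub>H\<^esub> b) ` carrier H"
            unfolding bij_betw_imp_surj_on[OF H.dot_bij[OF x(1)]] by (rule z(1))
          then obtain b where b: "b \<in> carrier H" "a \<cdot>\<^bsub>H\<^esub> b = c" by auto
          \<comment> \<open>A preimage of (c, w) is found coordinate by coordinate: \<open>b\<close>
            solves a \<cdot> b = c, and then \<open>dia a v\<close> must compensate the correction -
            \<gamma>(a, b).\<close>
          have "w \<otimes>\<^bsub>I\<^esub> \<gamma> a b \<in> dia a ` carrier I"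
            using x(1) z(2) b(1) unfolding bij_betw_imp_surj_on[OF dia_bij[OF x(1)]] by simp
          then obtain v where v: "v \<in> carrier I" "dia a v = w \<otimes>\<^bsub>I\<^esub> \<gamma> a b" by auto
          have "z = x \<cdot>\<^bsub>B\<^esub> emb (b, v)"
            unfolding x(3) z(3) using x(1,2) z(1,2) b v by (simp add: I.m_assoc)
          then show "z \<in> (\<lambda>z. x \<cdot>\<^bsub>B\<^esub> z) ` carrier B" using emb_closed[OF b(1) v(1)] by (rule image_eqI)
        qed
      qed
    qed
  next
    fix x y z assume "x \<in> carrier B" "y \<in> carrier B" "z \<in> carrier B"
    then obtain a u b v c w where x: "a \<in> carrier H" "u \<in> carrier I" "x = emb (a, u)"
      "b \<in> carrier H" "v \<in> carrier I" "y = emb (b, v)" "c \<in> carrier H" "w \<in> carrier I" "z = emb (c, w)"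
      unfolding carrier by blast
    have B_eq: "dia a (\<beta> b c) \<otimes>\<^bsub>I\<^esub> inv\<^bsub>I\<^esub> \<gamma> a (b \<otimes>\<^bsub>H\<^esub> c) =
        \<beta> (a \<cdot>\<^bsub>H\<^esub> b) (a \<cdot>\<^bsub>H\<^esub> c) \<otimes>\<^bsub>I\<^esub> inv\<^bsub>I\<^esub> (\<gamma> a b \<otimes>\<^bsub>I\<^esub> \<gamma> a c)"
      using x cocycleD(9)[OF cocycle, of a b c] by (subst I.inv_cross_eq_iff) simp_all
    have "dia a (v \<otimes>\<^bsub>I\<^esub> w \<otimes>\<^bsub>I\<^esub> \<beta> b c) \<otimes>\<^bsub>I\<^esub> inv\<^bsub>I\<^esub> \<gamma> a (b \<otimes>\<^bsub>H\<^esub> c) =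
        dia a v \<otimes>\<^bsub>I\<^esub> dia a w \<otimes>\<^bsub>I\<^esub> (dia a (\<beta> b c) \<otimes>\<^bsub>I\<^esub> inv\<^bsub>I\<^esub> \<gamma> a (b \<otimes>\<^bsub>H\<^esub> c))"
      using x by (simp add: dia_add I.m_assoc)
    also have "\<dots> = dia a v \<otimes>\<^bsub>I\<^esub> dia a w \<otimes>\<^bsub>I\<^esub>
        (\<beta> (a \<cdot>\<^bsub>H\<^esub> b) (a \<cdot>\<^bsub>H\<^esub> c) \<otimes>\<^bsub>I\<^esub> inv\<^bsub>I\<^esub> (\<gamma> a b \<otimes>\<^bsub>I\<^esub> \<gamma> a c))"
      by (simp only: B_eq)
    also have "\<dots> = dia a v \<otimes>\<^bsub>I\<^esub> inv\<^bsub>I\<^esub> \<gamma> a b \<otimes>\<^bsub>I\<^esub> (dia a w \<otimes>\<^bsub>I\<^esub> inv\<^bsub>I\<^esub> \<gamma> a c) \<otimes>\<^bsub>I\<^esub>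
        \<beta> (a \<cdot>\<^bsub>H\<^esub> b) (a \<cdot>\<^bsub>H\<^esub> c)"
      using x by (simp add: I.inv_mult I.m_ac)
    finally have "dia a (v \<otimes>\<^bsub>I\<^esub> w \<otimes>\<^bsub>I\<^esub> \<beta> b c) \<otimes>\<^bsub>I\<^esub> inv\<^bsub>I\<^esub> \<gamma> a (b \<otimes>\<^bsub>H\<^esub> c) =
        dia a v \<otimes>\<^bsub>I\<^esub> inv\<^bsub>I\<^esub> \<gamma> a b \<otimes>\<^bsub>I\<^esub> (dia a w \<otimes>\<^bsub>I\<^esub> inv\<^bsub>I\<^esub> \<gamma> a c) \<otimes>\<^bsub>I\<^esub> \<beta> (a \<cdot>\<^bsub>H\<^esub> b) (a \<cdot>\<^bsub>H\<^esub> c)" .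
    then show "x \<cdot>\<^bsub>B\<^esub> (y \<otimes>\<^bsub>B\<^esub> z) = (x \<cdot>\<^bsub>B\<^esub> y) \<otimes>\<^bsub>B\<^esub> (x \<cdot>\<^bsub>B\<^esub> z)"
      using x by (simp add: H.dot_distrib)
    \<comment> \<open>\<open>dia_dot\<close> merges the two nested actions into the action of a + b;
      what remains is the third cocycle equation with reversed sign.\<close>
    have "dia (a \<cdot>\<^bsub>H\<^esub> b) (dia a w \<otimes>\<^bsub>I\<^esub> inv\<^bsub>I\<^esub> \<gamma> a c) \<otimes>\<^bsub>I\<^esub> inv\<^bsub>I\<^esub> \<gamma> (a \<cdot>\<^bsub>H\<^esub> b) (a \<cdot>\<^bsub>H\<^esub> c) =
        dia (a \<otimes>\<^bsub>H\<^esub> b) w \<otimes>\<^bsub>I\<^esub> inv\<^bsub>I\<^esub> (\<gamma> (a \<cdot>\<^bsub>H\<^esub> b) (a \<cdot>\<^bsub>H\<^esub> c) \<otimes>\<^bsub>I\<^esub> dia (a \<cdot>\<^bsub>H\<^esub> b) (\<gamma> a c))"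
      using x by (simp add: dia_add dia_dot dia_inv I.inv_mult I.m_ac)
    also have "\<dots> = dia (a \<otimes>\<^bsub>H\<^esub> b) w \<otimes>\<^bsub>I\<^esub> inv\<^bsub>I\<^esub> \<gamma> (a \<otimes>\<^bsub>H\<^esub> b) c"
      using x cocycleD(10)[OF cocycle, of a b c] by simp
    finally show "(x \<otimes>\<^bsub>B\<^esub> y) \<cdot>\<^bsub>B\<^esub> z = (x \<cdot>\<^bsub>B\<^esub> y) \<cdot>\<^bsub>B\<^esub> (x \<cdot>\<^bsub>B\<^esub> z)"
      using x by (simp add: H.dot_cycle)
  qed
  have ext: "is_extension H I (\<iota>, B, \<pi>)"
    unfolding is_extension_def prod.case
  proof (intro conjI)
    show "\<iota> \<in> lcs_hom I B"
      using I_trivial by (auto simp: lcs_hom_def hom_def \<iota> lcs_trivial_def dia_zero)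
    have "\<pi> x \<in> carrier H \<and> \<pi> (x \<otimes>\<^bsub>B\<^esub> x') = \<pi> x \<otimes>\<^bsub>H\<^esub> \<pi> x' \<and> \<pi> (x \<cdot>\<^bsub>B\<^esub> x') = \<pi> x \<cdot>\<^bsub>H\<^esub> \<pi> x'"
      if xB: "x \<in> carrier B" "x' \<in> carrier B" for x x'
    proof -
      obtain a u where x: "a \<in> carrier H" "u \<in> carrier I" "x = emb (a, u)"
        using xB(1) unfolding carrier by blast
      obtain b v where x': "b \<in> carrier H" "v \<in> carrier I" "x' = emb (b, v)"
        using xB(2) unfolding carrier by blast
      show ?thesis unfolding x(3) x'(3) using x(1,2) x'(1,2) by simp
    qed
    then show "\<pi> \<in> lcs_hom B H" by (simp add: lcs_hom_def hom_def)
    show "inj_on \<iota> (carrier I)"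
      by (auto simp: inj_on_def \<iota>)
    show "\<iota> ` carrier I = kernel B H \<pi>"
    proof
      show "\<iota> ` carrier I \<subseteq> kernel B H \<pi>" by (rule image_subsetI) (simp add: \<iota> kernel_def)
      show "kernel B H \<pi> \<subseteq> \<iota> ` carrier I"
      proof
        fix x assume "x \<in> kernel B H \<pi>"
        then obtain a u where "a \<in> carrier H" "u \<in> carrier I" "x = emb (a, u)" "\<pi> x = \<one>\<^bsub>H\<^esub>"
          unfolding kernel_def carrier by blast
        then show "x \<in> \<iota> ` carrier I" by (intro image_eqI[of _ _ u]) (simp_all add: \<iota>)
      qed
    qed
    show "\<pi> ` carrier B = carrier H"
    proof
      show "carrier H \<subseteq> \<pi> ` carrier B"
      proof
        fix a assume "a \<in> carrier H"
        then show "a \<in> \<pi> ` carrier B" by (intro image_eqI[of _ _ "emb (a, \<one>\<^bsub>I\<^esub>)"]) simp_all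
      qed
    next
      show "\<pi> ` carrier B \<subseteq> carrier H" unfolding image_subset_iff Ball_def carrier by fastforce
    qed
  qed (rule B)
  \<comment> \<open>The condition concerns every normalized section, so \<open>s h\<close> is (h, t)
    with unknown \<open>t\<close>. In s h \<cdot> \<iota> y the coordinate \<open>t\<close> of the
    left factor does not enter, and in \<iota> y \<cdot> s h it is kept, since 0 acts as the
    identity and \<gamma>(0, h) = 0.\<close>
  have "s h \<cdot>\<^bsub>B\<^esub> \<iota> y = \<iota> (dia h y) \<and> \<iota> y \<cdot>\<^bsub>B\<^esub> s h \<otimes>\<^bsub>B\<^esub> inv\<^bsub>B\<^esub> s h = \<one>\<^bsub>B\<^esub>"
    if s: "normalized_section H B \<pi> s" and h: "h \<in> carrier H" and y: "y \<in> carrier I" for s h y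
  proof -
    have sh: "s h \<in> carrier B" "\<pi> (s h) = h"
      using s h unfolding normalized_section_def by blast+
    then obtain a t where "a \<in> carrier H" "t \<in> carrier I" "s h = emb (a, t)" unfolding carrier by blast
    with sh(2) have t: "t \<in> carrier I" "s h = emb (h, t)" by simp_all
    have 1: "s h \<cdot>\<^bsub>B\<^esub> \<iota> y = \<iota> (dia h y)" unfolding t(2) \<iota> using t(1) h y by simp
    have 2: "\<iota> y \<cdot>\<^bsub>B\<^esub> s h = s h" unfolding t(2) \<iota> using t(1) h y by (simp add: dia_zero)
    show ?thesis unfolding 2 using 1 B.r_inv[OF sh(1)] by blast
  qed
  with ext show "cocycle_extension emb \<beta> \<gamma> \<in> extensions H I dia"
    unfolding E extensions_def by simp
  show "represents (cocycle_extension emb \<beta> \<gamma>) \<beta> \<gamma>"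
    unfolding E represents_def prod.case
  \<comment> \<open>The section a \<mapsto> (a, 0) recovers \<beta> and \<gamma> exactly, not merely
    up to a coboundary.\<close>
  proof (intro exI[of _ "\<lambda>a. emb (a, \<one>\<^bsub>I\<^esub>)"] conjI ballI)
    show "normalized_section H B \<pi> (\<lambda>a. emb (a, \<one>\<^bsub>I\<^esub>))"
      by (auto simp: normalized_section_def one)
  qed (simp_all add: \<iota>)
qed

lemma represents_cong:
  assumes "represents E \<beta> \<gamma>"
    and "\<And>a b. \<lbrakk>a \<in> carrier H; b \<in> carrier H\<rbrakk> \<Longrightarrow> \<beta>' a b = \<beta> a b \<and> \<gamma>' a b = \<gamma> a b"
  shows "represents E \<beta>' \<gamma>'"
  using assms unfolding represents_def by (auto split: prod.splits)

text \<open>Passes from a witness \<theta> to equality of cosets, the form in which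
  \<open>bij_betw_quotient\<close> compares two cocycles.\<close>

lemma tot_cohomologous_iff_classes_eq:
  assumes c: "c \<in> carrier (Tot H I 2)" and c': "c' \<in> carrier (Tot H I 2)"
  shows "tot_cohomologous c c' \<longleftrightarrow>
    {x \<in> carrier (Tot H I 2). tot_cohomologous x c} = {x \<in> carrier (Tot H I 2). tot_cohomologous x c'}"
proof -
  have clo: "beta x a b \<in> carrier I \<and> gamma x a b \<in> carrier I"
    if "x \<in> carrier (Tot H I 2)" "a \<in> carrier H" "b \<in> carrier H" for x a b
    using beta_gamma_normalized(1,2)[OF that] by blast
  have refl: "tot_cohomologous x x" if "x \<in> carrier (Tot H I 2)" for x
    by (rule cohomologous_refl) (rule clo[OF that])
  have sym: "tot_cohomologous y x" if "tot_cohomologous x y" "x \<in> carrier (Tot H I 2)" "y \<in> carrier (Tot H I 2)" for x y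
    by (rule cohomologous_sym[OF clo[OF that(2)] clo[OF that(3)] that(1)])
  have trans: "tot_cohomologous x z" if "tot_cohomologous x y" "tot_cohomologous y z"
    "x \<in> carrier (Tot H I 2)" "y \<in> carrier (Tot H I 2)" "z \<in> carrier (Tot H I 2)" for x y z
    by (rule cohomologous_trans[OF clo[OF that(3)] clo[OF that(4)] clo[OF that(5)] that(1,2)])
  show ?thesis
  proof
    assume "tot_cohomologous c c'"
    then show "{x \<in> carrier (Tot H I 2). tot_cohomologous x c} = {x \<in> carrier (Tot H I 2). tot_cohomologous x c'}"
      using sym trans c c' by blast
  next
    assume "{x \<in> carrier (Tot H I 2). tot_cohomologous x c} = {x \<in> carrier (Tot H I 2). tot_cohomologous x c'}"
    moreover have "c \<in> {x \<in> carrier (Tot H I 2). tot_cohomologous x c}" using refl c by simp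
    ultimately show "tot_cohomologous c c'" by simp
  qed
qed

end

theorem corollary5p5:
  fixes H :: "'h lcs" and I :: "'i lcs"
    and dia :: "'h \<Rightarrow> 'i \<Rightarrow> 'i"
    and emb :: "'h \<times> 'i \<Rightarrow> 'b"
  assumes "linear_cycle_set H"
    and "linear_cycle_set I" and "lcs_trivial I"
    and "dia \<in> carrier H \<rightarrow> carrier I \<rightarrow> carrier I"
    and "\<And>h h' y. \<lbrakk>h \<in> carrier H; h' \<in> carrier H; y \<in> carrier I\<rbrakk>
           \<Longrightarrow> dia (lcs_mult H h' h) y = dia h (dia h' y)"
    and "\<And>h y y'. \<lbrakk>h \<in> carrier H; y \<in> carrier I; y' \<in> carrier I\<rbrakk>
           \<Longrightarrow> dia h (y \<otimes>\<^bsub>I\<^esub> y') = dia h y \<otimes>\<^bsub>I\<^esub> dia h y'"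
    and "\<And>y. y \<in> carrier I \<Longrightarrow> dia \<one>\<^bsub>H\<^esub> y = y"
    and "inj_on emb (carrier H \<times> carrier I)"
  shows "\<exists>\<Phi>. bij_betw \<Phi> (Ext H I dia :: ('h, 'i, 'b) extension set set)
                 (carrier (cohomology H I dia 2))"
proof -
  interpret lcs_action H I dia
    using assms(1-7) by (simp add: lcs_action_def lcs_action_axioms_def)
  let ?X = "extensions H I dia :: ('h, 'i, 'b) extension set"
  \<comment> \<open>\<open>represents\<close> serves as the correspondence, and \<open>g\<close>
    sends a cocycle to its coset. Equivalence of extensions is compared with equality of cosets
    through \<open>cohomologous\<close>.\<close>
  show ?thesis
    unfolding Ext_def carrier_cohomology_2
  proof (rule bij_betw_quotient[where P = "\<lambda>E c. represents E (beta c) (gamma c)"])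
    fix E assume E: "E \<in> ?X"
    obtain \<iota> B \<pi> where E_eq: "E = (\<iota>, B, \<pi>)" by (cases E)
    obtain \<beta> \<gamma> where "cocycle \<beta> \<gamma>" and r: "represents E \<beta> \<gamma>"
      using cocycle_exists[OF E] by blast
    then obtain c where c: "c \<in> carrier (Tot H I 2)"
      "\<And>a b. \<lbrakk>a \<in> carrier H; b \<in> carrier H\<rbrakk> \<Longrightarrow> beta c a b = \<beta> a b \<and> gamma c a b = \<gamma> a b"
      using Tot_2_exists by blast
    have rc: "represents E (beta c) (gamma c)"
      using r c(2) by (rule represents_cong)
    \<comment> \<open>The pair of \<open>c\<close> agrees with (\<beta>, \<gamma>) on the carrier of
      \<open>H\<close>. Its cocycle property is read off from the representation rather than
      transported along this agreement.\<close>
    then obtain s where "represented_extension H I dia \<iota> B \<pi> s (beta c) (gamma c)"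
      using representsE E unfolding E_eq by metis
    then have "cocycle (beta c) (gamma c)" by (rule represented_extension.cocycle)
    with c(1) rc show "\<exists>c\<in>Z2. represents E (beta c) (gamma c)" by blast
  next
    fix c assume "c \<in> Z2"
    then show "\<exists>E\<in>?X. represents E (beta c) (gamma c)"
      using cocycle_extension[OF assms(8)] by blast
  next
    fix E c E' c'
    assume X: "E \<in> ?X" "E' \<in> ?X" and Z: "c \<in> Z2" "c' \<in> Z2"
      and r: "represents E (beta c) (gamma c)" "represents E' (beta c') (gamma c')"
    obtain \<iota> B \<pi> \<iota>' B' \<pi>' where eq: "E = (\<iota>, B, \<pi>)" "E' = (\<iota>', B', \<pi>')" by (cases E, cases E')
    obtain s where s: "represented_extension H I dia \<iota> B \<pi> s (beta c) (gamma c)"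
      using X(1) r(1) unfolding eq by (rule representsE)
    obtain s' where s': "represented_extension H I dia \<iota>' B' \<pi>' s' (beta c') (gamma c')"
      using X(2) r(2) unfolding eq by (rule representsE)
    show "(E, E') \<in> {(E, E'). E \<in> ?X \<and> E' \<in> ?X \<and> ext_equiv H I E E'} \<longleftrightarrow>
        {x \<in> carrier (Tot H I 2). tot_cohomologous x c} = {x \<in> carrier (Tot H I 2). tot_cohomologous x c'}"
      using ext_equiv_iff_cohomologous[OF s s'] tot_cohomologous_iff_classes_eq[of c c'] X Z
      unfolding eq by simp
  qed auto
qed

end
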